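(* Let $s\in(\frac34,1)$ and $1<p\le2$. Then for every $\lambda\ge\frac14$ the system $$(-\Delta)^su+u+\lambda\phi u=|u|^{p-1}u\ \text{ in }\mathbb{R}^3,\qquad (-\Delta)^s\phi=u^2\ \text{ in }\mathbb{R}^3$$ has no nontrivial solution $(u,\phi)\in H^s(\mathbb{R}^3)\times\mathcal{D}^{s,2}(\mathbb{R}^3)$; that is, every solution satisfies $u=0$ and $\phi=0$.
   Context: Functions are real-valued. $(-\Delta)^{s}$ is defined by $\mathcal{F}((-\Delta)^su)=|\xi|^{2s}\mathcal{F}u$, and $(-\Delta)^{s/2}$ likewise with $|\xi|^{s}$. $H^s(\mathbb{R}^3)$ is the usual fractional Sobolev space, and $\mathcal{D}^{s,2}(\mathbb{R}^3)=\{u\in L^{2_s^*}(\mathbb{R}^3): |\xi|^s\hat u\in L^2(\mathbb{R}^3)\}$ with $2_s^{*}=\frac{6}{3-2s}$, the completion of $C_0^\infty(\mathbb{R}^3)$ with respect to $\big(\int|(-\Delta)^{s/2}u|^2dx\big)^{1/2}$. A (weak) solution is a pair $(u,\phi)\in H^s(\mathbb{R}^3)\times\mathcal{D}^{s,2}(\mathbb{R}^3)$ such that $\int_{\mathbb{R}^3}(-\Delta)^{s/2}\phi(-\Delta)^{s/2}v\,dx=\int_{\mathbb{R}^3}u^2v\,dx$ for all $v\in\mathcal{D}^{s,2}(\mathbb{R}^3)$ and $\int_{\mathbb{R}^3}\big((-\Delta)^{s/2}u(-\Delta)^{s/2}v+uv+\lambda\phi uv-|u|^{p-1}uv\big)dx=0$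 for all $v\in H^s(\mathbb{R}^3)$. *)

theory Defs
  imports "HOL-Analysis.Analysis"
begin

(* Elements of L^q are represented by Borel functions, without passing to
   equivalence classes: every almost-everywhere class has a Borel representative. *)

definition Lq :: "real \<Rightarrow> ('a::euclidean_space \<Rightarrow> 'b::{real_normed_vector, second_countable_topology}) set"
  where "Lq q = {f. f \<in> borel_measurable lborel \<and> integrable lborel (\<lambda>x. norm (f x) powr q)}"

primrec iter_deriv :: "'a::euclidean_space list \<Rightarrow> ('a \<Rightarrow> complex) \<Rightarrow> 'a \<Rightarrow> complex"
  where
    "iter_deriv [] f = f"
  | "iter_deriv (b # bs) f = (\<lambda>x. frechet_derivative (iter_deriv bs f) (at x) b)"

definition schwartz :: "('a::euclidean_space \<Rightarrow> complex) \<Rightarrow> bool"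
  where "schwartz f \<longleftrightarrow>
    (\<forall>bs. set bs \<subseteq> Basis \<longrightarrow>
       iter_deriv bs f differentiable_on UNIV \<and>
       (\<forall>k::nat. bounded (range (\<lambda>x. norm x ^ k *\<^sub>R iter_deriv bs f x))))"

(* The unitary normalisation, with angular frequency: the symbol of the
   negative Laplacian is exactly |xi|^2. *)

definition fourier :: "('a::euclidean_space \<Rightarrow> complex) \<Rightarrow> 'a \<Rightarrow> complex"
  where "fourier f \<xi> =
    complex_of_real ((2 * pi) powr (- real DIM('a) / 2)) *
      (LINT x|lborel. exp (- \<i> * complex_of_real (x \<bullet> \<xi>)) * f x)"

(* g is the Fourier transform of f in the sense of tempered distributions. It agrees
   with the Plancherel extension on L^2, and is determined almost everywhere by f.
   This covers elements of L^q with q > 2, whose transform is not given by an integral. *)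

definition has_fourier :: "('a::euclidean_space \<Rightarrow> complex) \<Rightarrow> ('a \<Rightarrow> complex) \<Rightarrow> bool"
  where "has_fourier f g \<longleftrightarrow>
    f \<in> borel_measurable lborel \<and> g \<in> borel_measurable lborel \<and>
    (\<forall>\<psi>. schwartz \<psi> \<longrightarrow>
       integrable lborel (\<lambda>x. f x * fourier \<psi> x) \<and>
       integrable lborel (\<lambda>\<xi>. g \<xi> * \<psi> \<xi>) \<and>
       (LINT x|lborel. f x * fourier \<psi> x) = (LINT \<xi>|lborel. g \<xi> * \<psi> \<xi>))"

(* frac_laplacian a u is (-Delta)^a u. The choice is only among functions
   that agree almost everywhere. For u in H^s or D^{s,2} and a = s/2 such a
   function exists and lies in L^2; it is real because u is real and the
   multiplier is even. *)

definition frac_laplacian :: "real \<Rightarrow> ('a::euclidean_space \<Rightarrow> real) \<Rightarrow> 'a \<Rightarrow> real"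
  where "frac_laplacian a u =
    (SOME w. \<exists>g. has_fourier (\<lambda>x. complex_of_real (u x)) g \<and>
       has_fourier (\<lambda>x. complex_of_real (w x))
         (\<lambda>\<xi>. complex_of_real (norm \<xi> powr (2 * a)) * g \<xi>))"

definition Hs :: "real \<Rightarrow> (real^3 \<Rightarrow> real) set"
  where "Hs s = {u. u \<in> Lq 2 \<and>
    (\<exists>g. has_fourier (\<lambda>x. complex_of_real (u x)) g \<and>
       (\<lambda>\<xi>. complex_of_real ((1 + (norm \<xi>)\<^sup>2) powr (s / 2)) * g \<xi>) \<in> Lq 2)}"

definition Ds2 :: "real \<Rightarrow> (real^3 \<Rightarrow> real) set"
  where "Ds2 s = {u. u \<in> Lq (6 / (3 - 2 * s)) \<and>
    (\<exists>g. has_fourier (\<lambda>x. complex_of_real (u x)) g \<and>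
       (\<lambda>\<xi>. complex_of_real (norm \<xi> powr s) * g \<xi>) \<in> Lq 2)}"

(* No integrability clauses are imposed: for 3/4 < s < 1 and 1 < p \<le> 2 the Sobolev
   embedding makes all integrands below integrable, so the value 0 that the
   library assigns to non-integrable functions never occurs. *)

definition weak_solution ::
    "real \<Rightarrow> real \<Rightarrow> real \<Rightarrow> (real^3 \<Rightarrow> real) \<Rightarrow> (real^3 \<Rightarrow> real) \<Rightarrow> bool"
  where "weak_solution s p lam u \<phi> \<longleftrightarrow>
    u \<in> Hs s \<and> \<phi> \<in> Ds2 s \<and>
    (\<forall>v\<in>Ds2 s.
       (LINT x|lborel. frac_laplacian (s / 2) \<phi> x * frac_laplacian (s / 2) v x) =
       (LINT x|lborel. (u x)\<^sup>2 * v x)) \<and>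
    (\<forall>v\<in>Hs s.
       (LINT x|lborel. frac_laplacian (s / 2) u x * frac_laplacian (s / 2) v x
          + u x * v x + lam * \<phi> x * u x * v x
          - \<bar>u x\<bar> powr (p - 1) * u x * v x) = 0)"

end

theory Submission
  imports Defs "HOL-Probability.Characteristic_Functions" "HOL-Probability.Sinc_Integral"
begin

text \<open>Write \<open>D\<close> for the operator with multiplier \<open>|\<xi>| powr s\<close>. Testing the equation for \<open>\<phi>\<close> with \<open>|u|\<close> gives
\<open>\<integral> |u|\<^sup>3 = \<integral> D \<phi> \<cdot> D |u|\<close>. Since \<open>lam \<ge> 1 / 4\<close>, the right-hand side is at most
\<open>lam \<parallel>D \<phi>\<parallel>\<^sup>2 + \<parallel>D |u|\<parallel>\<^sup>2\<close>, and \<open>\<parallel>D |u|\<parallel> \<le> \<parallel>D u\<parallel>\<close> because taking absolute values is a contraction.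
Testing the same equation with \<open>\<phi>\<close> gives \<open>\<parallel>D \<phi>\<parallel>\<^sup>2 = \<integral> \<phi> u\<^sup>2\<close>, and testing the equation for \<open>u\<close> with
\<open>u\<close> gives \<open>\<parallel>D u\<parallel>\<^sup>2 + \<integral> u\<^sup>2 + lam \<integral> \<phi> u\<^sup>2 = \<integral> |u| powr (p + 1)\<close>. Together,
\<open>\<integral> (u\<^sup>2 + |u|\<^sup>3 - |u| powr (p + 1)) \<le> 0\<close>. For \<open>1 < p \<le> 2\<close> the integrand is positive wherever \<open>u\<close> does
not vanish, so \<open>u = 0\<close>; then \<open>D \<phi> = 0\<close>, and so \<open>\<phi> = 0\<close>.

The test function \<open>|u|\<close> is replaced by \<open>min |u| n\<close> (\<open>truncation_Ds2\<close>). These truncations are bounded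
and square-integrable, hence lie in the critical Lebesgue space, and the limit \<open>n \<rightarrow> \<infinity>\<close> yields \<open>u \<in> L\<^sup>3\<close> (\<open>cubic_integrable\<close>). The integrability of \<open>\<phi> u\<^sup>2\<close>
follows by Young's inequality, since the exponent \<open>6 / (3 + 2 * s)\<close> conjugate to the critical one lies
between 1 and 3/2.

That contractions decrease the energy (\<open>fractional_energy_contraction\<close>) follows from a representation
by differences. A change of variable shows that \<open>|\<xi>| powr (2 * s)\<close> is, up to a constant factor, the
integral of \<open>1 - exp (- e\<^sup>2 |\<xi>|\<^sup>2 / 2)\<close> over \<open>e > 0\<close> with the weight \<open>e powr (- 1 - 2 * s)\<close>, and
\<open>2 \<integral> |g|\<^sup>2 (1 - exp (- e\<^sup>2 |\<xi>|\<^sup>2 / 2))\<close>, where \<open>g\<close> is the transform of \<open>f\<close>, is the integral of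
\<open>|f (x + e h) - f x|\<^sup>2\<close> over \<open>x\<close> and over a standard Gaussian displacement \<open>h\<close>
(\<open>gauss_difference_fourier\<close>).

The same Gaussian calculus supplies the Fourier analysis. The damped Parseval identity
\<open>fourier_gauss_regularised\<close> gives Plancherel's theorem for integrable functions, which completeness
extends to all of \<open>L\<^sup>2\<close>. Modulated Gaussians are Schwartz functions, and Gaussians separate functions
(\<open>gauss_test_imp_AE_zero\<close>), so a function and its distributional transform determine each other. This
identifies the functions selected by \<open>frac_laplacian\<close> and computes their norms (\<open>frac_laplacian_L2\<close>).\<close>

section \<open>The Gaussian and its Fourier transform\<close>

lemma
  fixes f :: "'a::euclidean_space \<Rightarrow> 'b::{banach, second_countable_topology}"
  assumes "c \<noteq> 0" and [measurable]: "f \<in> borel_measurable borel"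
  shows integrable_affine_iff: "integrable lborel (\<lambda>x. f (t + c *\<^sub>R x)) \<longleftrightarrow> integrable lborel f"
    and integral_affine: "integral\<^sup>L lborel f = \<bar>c\<bar> ^ DIM('a) *\<^sub>R (LINT x|lborel. f (t + c *\<^sub>R x))"
proof -
  have eq: "lborel = density (distr lborel borel (\<lambda>x::'a. t + c *\<^sub>R x)) (\<lambda>_. ennreal (\<bar>c\<bar>^DIM('a)))"
    by (rule lborel_affine[OF assms(1)])
  have scaleR_iff: "integrable M (\<lambda>x. d *\<^sub>R g x) \<longleftrightarrow> integrable M g" if "d \<noteq> 0" for d M and g :: "'a \<Rightarrow> 'b"
    using integrable_scaleR_right[of "inverse d" M "\<lambda>x. d *\<^sub>R g x"] that by auto
  have "integrable lborel f \<longleftrightarrow> integrable (density (distr lborel borel (\<lambda>x::'a. t + c *\<^sub>R x)) (\<lambda>_. ennreal (\<bar>c\<bar>^DIM('a)))) f"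
    using eq by metis
  also have "\<dots> \<longleftrightarrow> integrable lborel (\<lambda>x. f (t + c *\<^sub>R x))"
    using assms(1) by (subst integrable_density) (auto simp: integrable_distr_eq scaleR_iff)
  finally show "integrable lborel (\<lambda>x. f (t + c *\<^sub>R x)) \<longleftrightarrow> integrable lborel f" by simp
  have "integral\<^sup>L lborel f = integral\<^sup>L (density (distr lborel borel (\<lambda>x::'a. t + c *\<^sub>R x)) (\<lambda>_. ennreal (\<bar>c\<bar>^DIM('a)))) f"
    using eq by metis
  also have "\<dots> = \<bar>c\<bar> ^ DIM('a) *\<^sub>R (LINT x|lborel. f (t + c *\<^sub>R x))"
    by (subst integral_density) (auto simp: integral_distr)
  finally show "integral\<^sup>L lborel f = \<bar>c\<bar> ^ DIM('a) *\<^sub>R (LINT x|lborel. f (t + c *\<^sub>R x))" .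
qed

lemma nn_integral_affine:
  fixes f :: "'a::euclidean_space \<Rightarrow> ennreal"
  assumes "c \<noteq> 0" and [measurable]: "f \<in> borel_measurable borel"
  shows "(\<integral>\<^sup>+x. f x \<partial>lborel) = ennreal (\<bar>c\<bar> ^ DIM('a)) * (\<integral>\<^sup>+x. f (t + c *\<^sub>R x) \<partial>lborel)"
proof -
  have eq: "lborel = density (distr lborel borel (\<lambda>x::'a. t + c *\<^sub>R x)) (\<lambda>_. ennreal (\<bar>c\<bar>^DIM('a)))"
    by (rule lborel_affine[OF assms(1)])
  have "(\<integral>\<^sup>+x. f x \<partial>lborel) = (\<integral>\<^sup>+x. f x \<partial>(density (distr lborel borel (\<lambda>x::'a. t + c *\<^sub>R x)) (\<lambda>_. ennreal (\<bar>c\<bar>^DIM('a)))))"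
    using eq by metis
  also have "\<dots> = ennreal (\<bar>c\<bar> ^ DIM('a)) * (\<integral>\<^sup>+x. f (t + c *\<^sub>R x) \<partial>lborel)"
    by (simp add: nn_integral_density nn_integral_distr nn_integral_cmult)
  finally show ?thesis .
qed

text \<open>Integrals of functions with separated variables reduce to one variable. This is how the
Gaussian transform and the integrability of rapidly decreasing functions are obtained in
arbitrary dimension.\<close>
lemma has_bochner_integral_lborel_prod:
  fixes f :: "'a::euclidean_space \<Rightarrow> real \<Rightarrow> complex"
  assumes "\<And>b. b \<in> Basis \<Longrightarrow> integrable lborel (f b)"
  shows "has_bochner_integral lborel (\<lambda>x::'a. \<Prod>b\<in>Basis. f b (x \<bullet> b)) (\<Prod>b\<in>Basis. integral\<^sup>L lborel (f b))"
proof -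
  interpret product_sigma_finite "\<lambda>_::'a. lborel :: real measure" ..
  let ?T = "\<lambda>g. \<Sum>b\<in>Basis. g b *\<^sub>R (b::'a)"
  have [measurable]: "\<And>b. b \<in> Basis \<Longrightarrow> f b \<in> borel_measurable borel"
    using assms[THEN borel_measurable_integrable] by simp
  have T: "?T g \<bullet> b = g b" if "b \<in> Basis" for g b
    using that by simp
  have m: "(\<lambda>x::'a. \<Prod>b\<in>Basis. f b (x \<bullet> b)) \<in> borel_measurable borel" by measurable
  have i: "integrable (\<Pi>\<^sub>M b\<in>Basis. lborel) (\<lambda>x. \<Prod>b\<in>(Basis::'a set). f b (x b))"
    by (rule product_integrable_prod) (auto intro: assms)
  have "integrable lborel (\<lambda>x::'a. \<Prod>b\<in>Basis. f b (x \<bullet> b))"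
    unfolding lborel_eq[where 'a='a] using i by (subst integrable_distr_eq) (auto simp: m)
  moreover have "integral\<^sup>L lborel (\<lambda>x::'a. \<Prod>b\<in>Basis. f b (x \<bullet> b)) = (\<Prod>b\<in>Basis. integral\<^sup>L lborel (f b))"
    unfolding lborel_eq[where 'a='a]
    by (subst integral_distr) (auto simp: m product_integral_prod assms)
  ultimately show ?thesis by (simp add: has_bochner_integral_iff)
qed

definition gauss :: "'a::euclidean_space \<Rightarrow> real"
  where "gauss x = (2 * pi) powr (- real DIM('a) / 2) * exp (- (norm x)\<^sup>2 / 2)"

lemma gauss_pos: "gauss x > 0" by (simp add: gauss_def)

lemma gauss_measurable [measurable]: "gauss \<in> borel_measurable borel"
  unfolding gauss_def[abs_def] by measurable

lemma gauss_minus [simp]: "gauss (- x) = gauss x" by (simp add: gauss_def)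

lemma norm_sq_Basis: "(norm (x::'a::euclidean_space))\<^sup>2 = (\<Sum>b\<in>Basis. (x \<bullet> b)\<^sup>2)"
proof -
  have "x \<bullet> x = (\<Sum>b\<in>Basis. (x \<bullet> b) * (x \<bullet> b))" by (rule euclidean_inner)
  then show ?thesis by (simp only: power2_norm_eq_inner) (simp only: power2_eq_square)
qed

lemma gauss_prod: "gauss (x::'a::euclidean_space) = (\<Prod>b\<in>Basis. std_normal_density (x \<bullet> b))"
proof -
  have "(\<Prod>b\<in>(Basis::'a set). 1 / sqrt (2 * pi)) = (2 * pi) powr (- real DIM('a) / 2)"
  proof -
    have "1 / sqrt (2 * pi) = (2 * pi) powr (- 1 / 2)"
      by (simp add: powr_minus powr_half_sqrt inverse_eq_divide)
    then have "(\<Prod>b\<in>(Basis::'a set). 1 / sqrt (2 * pi)) = ((2 * pi) powr (- 1 / 2)) powr real DIM('a)"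
      by (simp add: powr_realpow)
    then show ?thesis by (simp only: powr_powr) simp
  qed
  then show ?thesis
    unfolding gauss_def std_normal_density_def prod.distrib norm_sq_Basis
    by (simp add: exp_sum[symmetric] sum_negf sum_divide_distrib)
qed

text \<open>The Gaussian is a product of standard normal densities, so its transform is the product of the
characteristic functions of the standard normal distribution.\<close>
lemma gauss_fourier:
  fixes \<xi> :: "'a::euclidean_space"
  shows "has_bochner_integral lborel (\<lambda>x. complex_of_real (gauss x) * exp (\<i> * complex_of_real (x \<bullet> \<xi>)))
     (complex_of_real (exp (- (norm \<xi>)\<^sup>2 / 2)))"
proof -
  let ?f = "\<lambda>(b::'a) y. complex_of_real (std_normal_density y) * exp (\<i> * complex_of_real (y * (\<xi> \<bullet> b)))"
  have int: "integrable lborel (?f b)" for b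
  proof (rule Bochner_Integration.integrable_bound[where f=std_normal_density])
    show "integrable lborel std_normal_density" using integrable_std_normal_moment[of 0] by simp
  qed (auto simp: norm_mult)
  have val: "integral\<^sup>L lborel (?f b) = complex_of_real (exp (- (\<xi> \<bullet> b)\<^sup>2 / 2))" for b
  proof -
    have "char std_normal_distribution (\<xi> \<bullet> b) = (LINT y|lborel. std_normal_density y *\<^sub>R iexp ((\<xi> \<bullet> b) * y))"
      unfolding char_def by (subst integral_density) (auto simp: normal_density_nonneg)
    then show ?thesis
      by (simp add: char_std_normal_distribution scaleR_conv_of_real mult.commute)
  qed
  have "has_bochner_integral lborel (\<lambda>x::'a. \<Prod>b\<in>Basis. ?f b (x \<bullet> b)) (\<Prod>b\<in>Basis. integral\<^sup>L lborel (?f b))"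
    by (rule has_bochner_integral_lborel_prod) (rule int)
  moreover have "(\<Prod>b\<in>Basis. ?f b (x \<bullet> b)) = complex_of_real (gauss x) * exp (\<i> * complex_of_real (x \<bullet> \<xi>))" for x :: 'a
    by (simp add: prod.distrib gauss_prod exp_sum[symmetric] sum_distrib_left[symmetric]
        euclidean_inner[of x \<xi>])
  moreover have "(\<Prod>b\<in>(Basis::'a set). integral\<^sup>L lborel (?f b)) = complex_of_real (exp (- (norm \<xi>)\<^sup>2 / 2))"
    unfolding val
    by (simp add: exp_sum[symmetric] norm_sq_Basis sum_negf sum_divide_distrib flip: of_real_prod)
  ultimately show ?thesis by simp
qed

lemma gauss_integral: "has_bochner_integral lborel (gauss :: 'a::euclidean_space \<Rightarrow> real) 1"
proof -
  have "has_bochner_integral lborel (\<lambda>x::'a. complex_of_real (gauss x)) (of_real 1)"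
    using gauss_fourier[of "0::'a"] by simp
  then show ?thesis
    by (simp add: has_bochner_integral_iff complex_of_real_integrable_eq)
qed

text \<open>The same Gaussian as a probability measure: averaging against it is what turns the multiplier
\<open>exp (- e\<^sup>2 |\<xi>|\<^sup>2 / 2)\<close> into translations by \<open>e h\<close>.\<close>
definition gaussian :: "'a::euclidean_space measure"
  where "gaussian = density lborel (\<lambda>x. ennreal (gauss x))"

lemma sets_gaussian [simp, measurable_cong]: "sets gaussian = sets borel"
  by (simp add: gaussian_def)

lemma space_gaussian [simp]: "space gaussian = UNIV"
  by (simp add: gaussian_def)

lemma prob_space_gaussian: "prob_space (gaussian :: 'a::euclidean_space measure)"
proof
  have "(\<integral>\<^sup>+x. ennreal (gauss x) \<partial>(lborel::'a measure)) = ennreal 1"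
    using gauss_integral[where 'a='a] by (subst nn_integral_eq_integral) (auto simp: has_bochner_integral_iff gauss_pos less_imp_le)
  then show "emeasure (gaussian::'a measure) (space gaussian) = 1"
    by (simp add: gaussian_def emeasure_density)
qed

interpretation gaussian: prob_space "gaussian :: 'a::euclidean_space measure"
  by (rule prob_space_gaussian)

lemma integral_gaussian:
  fixes f :: "'a::euclidean_space \<Rightarrow> 'b::{banach, second_countable_topology}"
  assumes [measurable]: "f \<in> borel_measurable borel"
  shows "integral\<^sup>L gaussian f = (LINT x|lborel. gauss x *\<^sub>R f x)"
  unfolding gaussian_def by (subst integral_density) (auto simp: gauss_pos less_imp_le)

text \<open>A Gaussian of width \<open>1/e\<close> with a centre and a frequency. The unmodulated packets with arbitrary
centre test the Fourier side, while the packets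
centred at the origin have the translated Gaussians as their transforms and thus test the
physical side.\<close>
definition wavepacket :: "real \<Rightarrow> 'a::euclidean_space \<Rightarrow> 'a \<Rightarrow> 'a \<Rightarrow> complex"
  where "wavepacket e c a x = exp (complex_of_real (- e\<^sup>2 * (norm (x - c))\<^sup>2 / 2) + \<i> * complex_of_real (a \<bullet> x))"

lemma wavepacket_measurable [measurable]: "wavepacket e c a \<in> borel_measurable borel"
  unfolding wavepacket_def[abs_def] by measurable

lemma norm_wavepacket: "norm (wavepacket e c a x) = exp (- e\<^sup>2 * (norm (x - c))\<^sup>2 / 2)"
  by (simp add: wavepacket_def norm_exp_eq_Re)

lemma fourier_wavepacket:
  fixes a x :: "'a::euclidean_space"
  assumes e: "e > 0"
  shows "integrable lborel (\<lambda>\<xi>. wavepacket e c a \<xi>)"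
    "fourier (wavepacket e 0 a) x = complex_of_real ((1/e) ^ DIM('a) * exp (- (norm ((1/e) *\<^sub>R (x - a)))\<^sup>2 / 2))"
proof -
  let ?C = "(2 * pi) powr (- real DIM('a) / 2)"
  have C: "?C > 0" by simp
  have gi: "integrable lborel (\<lambda>x::'a. gauss x)" using gauss_integral[where 'a='a] by (simp add: has_bochner_integral_iff)
  then have "integrable lborel (\<lambda>x::'a. gauss ((- e *\<^sub>R c) + e *\<^sub>R x))"
    using e by (intro integrable_affine_iff[THEN iffD2]) auto
  then have "integrable lborel (\<lambda>x::'a. gauss ((- e *\<^sub>R c) + e *\<^sub>R x) / ?C)"
    by (rule integrable_divide)
  then show wi: "integrable lborel (\<lambda>\<xi>. wavepacket e c a \<xi>)"
  proof (rule Bochner_Integration.integrable_bound, goal_cases)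
    case 2
    have "norm (- e *\<^sub>R c + e *\<^sub>R x) = e * norm (x - c)" for x
      using e by (metis (no_types) abs_of_pos add.commute norm_scaleR scaleR_diff_right scaleR_minus_left uminus_add_conv_diff)
    then show ?case using e by (auto simp: norm_wavepacket gauss_def power_mult_distrib)
  qed auto
  let ?g = "\<lambda>\<xi>. exp (- \<i> * complex_of_real (\<xi> \<bullet> x)) * wavepacket e 0 a \<xi>"
  have "fourier (wavepacket e 0 a) x = complex_of_real ?C * (LINT \<xi>|lborel. ?g \<xi>)"
    by (simp add: fourier_def)
  also have "(LINT \<xi>|lborel. ?g \<xi>) = \<bar>1/e\<bar> ^ DIM('a) *\<^sub>R (LINT \<xi>|lborel. ?g (0 + (1/e) *\<^sub>R \<xi>))"
    using e by (subst integral_affine[where c="1/e" and t=0]) auto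
  also have "(\<lambda>\<xi>. ?g (0 + (1/e) *\<^sub>R \<xi>)) = (\<lambda>\<xi>. complex_of_real (1/?C) * (complex_of_real (gauss \<xi>) * exp (\<i> * complex_of_real (\<xi> \<bullet> ((1/e) *\<^sub>R (a - x))))))"
  proof
    fix \<xi> :: 'a
    have 1: "wavepacket e 0 a ((1/e) *\<^sub>R \<xi>) = complex_of_real (gauss \<xi> / ?C) * exp (\<i> * complex_of_real (a \<bullet> ((1/e) *\<^sub>R \<xi>)))"
      using e by (simp add: wavepacket_def gauss_def power_mult_distrib power_divide mult_exp_exp flip: exp_of_real)
    show "?g (0 + (1/e) *\<^sub>R \<xi>) = complex_of_real (1/?C) * (complex_of_real (gauss \<xi>) * exp (\<i> * complex_of_real (\<xi> \<bullet> ((1/e) *\<^sub>R (a - x)))))"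
      unfolding add_0 1 by (simp add: inner_diff_right right_diff_distrib diff_divide_distrib exp_diff exp_minus inner_commute field_simps)
  qed
  also have "(LINT \<xi>|lborel. complex_of_real (1/?C) * (complex_of_real (gauss \<xi>) * exp (\<i> * complex_of_real (\<xi> \<bullet> ((1/e) *\<^sub>R (a - x))))))
     = complex_of_real (1/?C) * complex_of_real (exp (- (norm ((1/e) *\<^sub>R (a - x)))\<^sup>2 / 2))"
    using gauss_fourier[of "(1/e) *\<^sub>R (a - x)"] by (subst integral_mult_right_zero) (simp add: has_bochner_integral_iff)
  finally show "fourier (wavepacket e 0 a) x = complex_of_real ((1/e) ^ DIM('a) * exp (- (norm ((1/e) *\<^sub>R (x - a)))\<^sup>2 / 2))"
    using e C by (simp add: norm_minus_commute scaleR_conv_of_real)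
qed

section \<open>Schwartz functions\<close>

text \<open>Polynomial functions, generated just far enough that multiples of a wave packet by them are closed
under differentiation.\<close>
inductive poly_fun :: "('a::euclidean_space \<Rightarrow> complex) \<Rightarrow> bool" where
  const: "poly_fun (\<lambda>_. k)"
| coord: "poly_fun (\<lambda>x. complex_of_real (x \<bullet> b))"
| add: "poly_fun P \<Longrightarrow> poly_fun Q \<Longrightarrow> poly_fun (\<lambda>x. P x + Q x)"
| mult: "poly_fun P \<Longrightarrow> poly_fun Q \<Longrightarrow> poly_fun (\<lambda>x. P x * Q x)"

lemma poly_fun_has_derivative:
  assumes "poly_fun P"
  shows "\<exists>P'. (\<forall>x. (P has_derivative P' x) (at x)) \<and> (\<forall>b. poly_fun (\<lambda>x. P' x b))"
  using assms
proof induction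
  case (const k)
  show ?case by (rule exI[of _ "\<lambda>_ _. 0"]) (auto intro: poly_fun.const)
next
  case (coord b)
  show ?case
    by (rule exI[of _ "\<lambda>_ h. complex_of_real (h \<bullet> b)"])
      (auto intro!: poly_fun.const derivative_eq_intros)
next
  case (add P Q)
  then obtain P' Q' where "\<forall>x. (P has_derivative P' x) (at x)" "\<forall>b. poly_fun (\<lambda>x. P' x b)"
    "\<forall>x. (Q has_derivative Q' x) (at x)" "\<forall>b. poly_fun (\<lambda>x. Q' x b)" by auto
  then show ?case
    by (intro exI[of _ "\<lambda>x h. P' x h + Q' x h"]) (auto intro!: poly_fun.add has_derivative_add)
next
  case (mult P Q)
  then obtain P' Q' where "\<forall>x. (P has_derivative P' x) (at x)" "\<forall>b. poly_fun (\<lambda>x. P' x b)"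
    "\<forall>x. (Q has_derivative Q' x) (at x)" "\<forall>b. poly_fun (\<lambda>x. Q' x b)" by auto
  then show ?case using mult
    by (intro exI[of _ "\<lambda>x h. P x * Q' x h + P' x h * Q x"]) (auto intro!: poly_fun.add poly_fun.mult has_derivative_mult)
qed

lemma poly_fun_growth:
  assumes "poly_fun P"
  shows "\<exists>C m. C \<ge> 0 \<and> (\<forall>x. norm (P x) \<le> C * (1 + norm x) ^ m)"
  using assms
proof induction
  case (const k)
  show ?case by (rule exI[of _ "norm k"], rule exI[of _ 0]) auto
next
  case (coord b)
  have "norm (x \<bullet> b) \<le> norm b * (1 + norm x) ^ 1" for x
    using Cauchy_Schwarz_ineq2[of x b] by (simp add: distrib_left mult.commute[of "norm x"] add_increasing)
  then show ?case by (intro exI[of _ "norm b"] exI[of _ 1]) auto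
next
  case (add P Q)
  then obtain C m D n where *: "C \<ge> 0" "\<forall>x. norm (P x) \<le> C * (1 + norm x) ^ m" "D \<ge> 0" "\<forall>x. norm (Q x) \<le> D * (1 + norm x) ^ n"
    by auto
  have "norm (P x + Q x) \<le> (C + D) * (1 + norm x) ^ (m + n)" for x
  proof -
    have "norm (P x + Q x) \<le> C * (1 + norm x) ^ m + D * (1 + norm x) ^ n"
      using * by (intro norm_triangle_le add_mono) auto
    also have "\<dots> \<le> C * (1 + norm x) ^ (m + n) + D * (1 + norm x) ^ (m + n)"
      using * by (intro add_mono mult_left_mono power_increasing) auto
    finally show ?thesis by (simp add: algebra_simps)
  qed
  then show ?case using * by (intro exI[of _ "C + D"] exI[of _ "m + n"]) auto
next
  case (mult P Q)
  then obtain C m D n where *: "C \<ge> 0" "\<forall>x. norm (P x) \<le> C * (1 + norm x) ^ m" "D \<ge> 0" "\<forall>x. norm (Q x) \<le> D * (1 + norm x) ^ n"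
    by auto
  have "norm (P x * Q x) \<le> (C * D) * (1 + norm x) ^ (m + n)" for x
  proof -
    have "norm (P x * Q x) \<le> (C * (1 + norm x) ^ m) * (D * (1 + norm x) ^ n)"
      using * unfolding norm_mult by (intro mult_mono) auto
    then show ?thesis by (simp add: algebra_simps power_add)
  qed
  then show ?case using * by (intro exI[of _ "C * D"] exI[of _ "m + n"]) auto
qed

lemma has_derivative_wavepacket:
  "(wavepacket e c a has_derivative
      (\<lambda>h. (complex_of_real (- e\<^sup>2 * ((x - c) \<bullet> h)) + \<i> * complex_of_real (a \<bullet> h)) * wavepacket e c a x)) (at x)"
proof -
  let ?q = "\<lambda>x. complex_of_real (- e\<^sup>2 * ((x - c) \<bullet> (x - c)) / 2) + \<i> * complex_of_real (a \<bullet> x)"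
  let ?q' = "\<lambda>h. complex_of_real (- e\<^sup>2 * ((x - c) \<bullet> h)) + \<i> * complex_of_real (a \<bullet> h)"
  have "((\<lambda>x. - e\<^sup>2 * ((x - c) \<bullet> (x - c)) / 2) has_derivative (\<lambda>h. - e\<^sup>2 * ((x - c) \<bullet> h))) (at x)"
    by (auto intro!: derivative_eq_intros simp: inner_commute)
  moreover have "((\<lambda>x. a \<bullet> x) has_derivative (\<lambda>h. a \<bullet> h)) (at x)"
    by (auto intro!: derivative_eq_intros)
  ultimately have q: "(?q has_derivative ?q') (at x)"
    by (intro has_derivative_add has_derivative_of_real has_derivative_mult_right)
  have "((\<lambda>x. exp (?q x)) has_derivative (\<lambda>h. exp (?q x) * ?q' h)) (at x)"
    by (rule has_derivative_compose[OF q DERIV_exp[unfolded has_field_derivative_def]])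
  then show ?thesis
    unfolding wavepacket_def power2_norm_eq_inner by (simp only: mult.commute)
qed

lemma iter_deriv_wavepacket:
  "\<exists>P. poly_fun P \<and> iter_deriv bs (wavepacket e c a) = (\<lambda>x. P x * wavepacket e c a x)"
proof (induction bs)
  case Nil
  show ?case by (rule exI[of _ "\<lambda>_. 1"]) (auto intro: poly_fun.const)
next
  case (Cons b bs)
  then obtain P where P: "poly_fun P" "iter_deriv bs (wavepacket e c a) = (\<lambda>x. P x * wavepacket e c a x)" by auto
  obtain P' where P': "\<And>x. (P has_derivative P' x) (at x)" "\<And>b. poly_fun (\<lambda>x. P' x b)"
    using poly_fun_has_derivative[OF P(1)] by auto
  define R where "R = (\<lambda>x. complex_of_real (- e\<^sup>2 * ((x - c) \<bullet> b)) + \<i> * complex_of_real (a \<bullet> b))"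
  have "poly_fun (\<lambda>x. (complex_of_real (- e\<^sup>2) * (complex_of_real (x \<bullet> b) + complex_of_real (- (c \<bullet> b)))) + \<i> * complex_of_real (a \<bullet> b))"
    by (intro poly_fun.add poly_fun.mult poly_fun.const poly_fun.coord)
  moreover have "R = (\<lambda>x. (complex_of_real (- e\<^sup>2) * (complex_of_real (x \<bullet> b) + complex_of_real (- (c \<bullet> b)))) + \<i> * complex_of_real (a \<bullet> b))"
    by (simp add: R_def inner_diff_left)
  ultimately have R: "poly_fun R" by simp
  have "frechet_derivative (\<lambda>x. P x * wavepacket e c a x) (at x) b = (P x * R x + P' x b) * wavepacket e c a x" for x
    using frechet_derivative_at[OF has_derivative_mult[OF P'(1)[of x] has_derivative_wavepacket[of e c a x]], symmetric]
    by (simp add: R_def algebra_simps)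
  then show ?case using P R P'
    by (intro exI[of _ "\<lambda>x. P x * R x + P' x b"]) (auto intro!: poly_fun.add poly_fun.mult)
qed

text \<open>Every iterated derivative of a wave packet is a polynomial times the packet, and a Gaussian
outweighs every polynomial.\<close>
lemma schwartz_wavepacket:
  fixes c a :: "'a::euclidean_space"
  assumes e: "e > 0"
  shows "schwartz (wavepacket e c a)"
  unfolding schwartz_def
proof (intro allI impI conjI)
  fix bs :: "'a list"
  obtain P where P: "poly_fun P" "iter_deriv bs (wavepacket e c a) = (\<lambda>x. P x * wavepacket e c a x)"
    using iter_deriv_wavepacket by metis
  show "iter_deriv bs (wavepacket e c a) differentiable_on UNIV"
  proof -
    obtain P' where P': "\<And>x. (P has_derivative P' x) (at x)"
      using poly_fun_has_derivative[OF P(1)] by auto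
    show ?thesis
      unfolding P(2) differentiable_on_def differentiable_def
      using has_derivative_mult[OF P' has_derivative_wavepacket] by fastforce
  qed
  fix k :: nat
  obtain C m where C: "C \<ge> 0" "\<And>x. norm (P x) \<le> C * (1 + norm x) ^ m" using poly_fun_growth[OF P(1)] by auto
  have "norm (norm x ^ k *\<^sub>R (P x * wavepacket e c a x)) \<le> C * (1 + norm c) ^ (k + m) * exp ((real (k + m))\<^sup>2 / (2 * e\<^sup>2))" for x
  proof -
    define r where "r = norm (x - c)"
    have x: "1 + norm x \<le> (1 + norm c) * exp r"
    proof -
      have "norm x \<le> norm c + r" unfolding r_def by (metis add.commute diff_add_cancel norm_triangle_ineq)
      then have "1 + norm x \<le> (1 + norm c) * (1 + r)"
        using mult_nonneg_nonneg[OF norm_ge_zero[of c] norm_ge_zero[of "x - c"]] unfolding r_def ring_distribs by linarith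
      also have "\<dots> \<le> (1 + norm c) * exp r" by (intro mult_left_mono) auto
      finally show ?thesis .
    qed
    have "norm (norm x ^ k *\<^sub>R (P x * wavepacket e c a x)) \<le> (1 + norm x) ^ k * (C * (1 + norm x) ^ m) * exp (- e\<^sup>2 * r\<^sup>2 / 2)"
    proof -
      have "norm x ^ k * norm (P x) \<le> (1 + norm x) ^ k * (C * (1 + norm x) ^ m)"
        by (intro mult_mono C power_mono) auto
      then show ?thesis
        by (simp add: norm_mult norm_wavepacket r_def mult.assoc[symmetric] mult_right_mono)
    qed
    also have "\<dots> = C * (1 + norm x) ^ (k + m) * exp (- e\<^sup>2 * r\<^sup>2 / 2)" by (simp add: power_add)
    also have "\<dots> \<le> C * ((1 + norm c) * exp r) ^ (k + m) * exp (- e\<^sup>2 * r\<^sup>2 / 2)"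
      by (intro mult_right_mono mult_left_mono power_mono x C) auto
    also have "\<dots> = C * (1 + norm c) ^ (k + m) * exp (real (k + m) * r - e\<^sup>2 * r\<^sup>2 / 2)"
    proof -
      have "exp (real (k + m) * r - e\<^sup>2 * r\<^sup>2 / 2) = exp r ^ (k + m) * exp (- e\<^sup>2 * r\<^sup>2 / 2)"
        unfolding exp_of_nat_mult[symmetric] mult_exp_exp by simp
      then show ?thesis by (simp add: power_mult_distrib)
    qed
    also have "\<dots> \<le> C * (1 + norm c) ^ (k + m) * exp ((real (k + m))\<^sup>2 / (2 * e\<^sup>2))"
    proof -
      have "(e * r - real (k + m) / e)\<^sup>2 = e\<^sup>2 * r\<^sup>2 - 2 * (real (k + m) * r) + (real (k + m))\<^sup>2 / e\<^sup>2"
        using e by (simp add: power2_diff power_divide power_mult_distrib)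
      moreover have "0 \<le> (e * r - real (k + m) / e)\<^sup>2" by simp
      moreover have "(real (k + m))\<^sup>2 / (2 * e\<^sup>2) = (real (k + m))\<^sup>2 / e\<^sup>2 / 2" by simp
      ultimately have "real (k + m) * r - e\<^sup>2 * r\<^sup>2 / 2 \<le> (real (k + m))\<^sup>2 / (2 * e\<^sup>2)"
        by linarith
      then show ?thesis using C by (intro mult_left_mono) auto
    qed
    finally show ?thesis .
  qed
  then show "bounded (range (\<lambda>x. norm x ^ k *\<^sub>R iter_deriv bs (wavepacket e c a) x))"
    unfolding P(2) by (intro boundedI) auto
qed

lemma integrable_prod_inverse_1_plus_square:
  "integrable lborel (\<lambda>x::'a::euclidean_space. \<Prod>b\<in>Basis. inverse (1 + (x \<bullet> b)\<^sup>2))"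
proof -
  have 1: "integrable lborel (\<lambda>x::real. inverse (1 + x\<^sup>2))"
    using integrable_inverse_1_plus_square by (simp add: set_integrable_def)
  have "has_bochner_integral lborel (\<lambda>x::'a. \<Prod>b\<in>Basis. complex_of_real (inverse (1 + (x \<bullet> b)\<^sup>2)))
    (\<Prod>b\<in>(Basis::'a set). integral\<^sup>L lborel (\<lambda>x. complex_of_real (inverse (1 + x\<^sup>2))))"
    by (rule has_bochner_integral_lborel_prod[where f="\<lambda>b x. complex_of_real (inverse (1 + x\<^sup>2))"])
      (simp only: complex_of_real_integrable_eq 1)
  then show ?thesis
    unfolding of_real_prod[symmetric] has_bochner_integral_iff complex_of_real_integrable_eq by simp
qed

lemma
  fixes \<psi> :: "'a::euclidean_space \<Rightarrow> complex"
  assumes "schwartz \<psi>"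
  shows schwartz_measurable: "\<psi> \<in> borel_measurable borel"
    and schwartz_bounded: "\<exists>B. \<forall>x. norm (\<psi> x) \<le> B"
    and schwartz_integrable: "integrable lborel \<psi>"
proof -
  have d: "\<psi> differentiable_on UNIV" and b: "\<And>k. bounded (range (\<lambda>x. norm x ^ k *\<^sub>R \<psi> x))"
    using assms unfolding schwartz_def by (auto dest: spec[of _ "[]"])
  show m [measurable]: "\<psi> \<in> borel_measurable borel"
    using differentiable_imp_continuous_on[OF d] by (rule borel_measurable_continuous_onI)
  obtain B where B: "\<And>x. norm (\<psi> x) \<le> B" using b[of 0] by (auto simp: bounded_iff)
  then show "\<exists>B. \<forall>x. norm (\<psi> x) \<le> B" by auto
  let ?n = "DIM('a)"
  obtain D where D: "\<And>x. norm x ^ (2 * ?n) * norm (\<psi> x) \<le> D" using b[of "2 * ?n"] by (auto simp: bounded_iff)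
  show "integrable lborel \<psi>"
  proof (rule Bochner_Integration.integrable_bound)
    show "integrable lborel (\<lambda>x::'a. (2 ^ ?n * (B + D)) * (\<Prod>b\<in>Basis. inverse (1 + (x \<bullet> b)\<^sup>2)))"
      by (intro integrable_mult_right integrable_prod_inverse_1_plus_square)
    have "norm (\<psi> x) \<le> (2 ^ ?n * (B + D)) * (\<Prod>b\<in>Basis. inverse (1 + (x \<bullet> b)\<^sup>2))" for x
    proof -
      let ?Q = "\<Prod>b\<in>(Basis::'a set). (1 + (x \<bullet> b)\<^sup>2)"
      have Q: "?Q > 0" by (intro prod_pos) (auto simp: add_pos_nonneg)
      have "?Q \<le> (\<Prod>b\<in>(Basis::'a set). (1 + (norm x)\<^sup>2))"
        by (intro prod_mono) (auto simp: abs_le_square_iff[symmetric] Basis_le_norm)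
      also have "\<dots> = (1 + (norm x)\<^sup>2) ^ ?n" by simp
      also have "\<dots> \<le> (2 * max 1 ((norm x)\<^sup>2)) ^ ?n" by (intro power_mono) auto
      also have "\<dots> \<le> 2 ^ ?n * (1 + (norm x) ^ (2 * ?n))"
      proof -
        have "(max 1 ((norm x)\<^sup>2)) ^ ?n \<le> 1 + (norm x) ^ (2 * ?n)"
          by (cases "1 \<le> (norm x)\<^sup>2") (simp_all add: max_absorb1 max_absorb2 power_mult)
        then show ?thesis unfolding power_mult_distrib by (intro mult_left_mono) auto
      qed
      finally have "?Q * norm (\<psi> x) \<le> 2 ^ ?n * (1 + (norm x) ^ (2 * ?n)) * norm (\<psi> x)"
        by (intro mult_right_mono) auto
      also have "\<dots> \<le> 2 ^ ?n * (B + D)"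
      proof -
        have "(1 + (norm x) ^ (2 * ?n)) * norm (\<psi> x) \<le> B + D"
          using add_mono[OF B[of x] D[of x]] by (simp add: distrib_right)
        then show ?thesis unfolding mult.assoc by (intro mult_left_mono) auto
      qed
      finally have *: "?Q * norm (\<psi> x) \<le> 2 ^ ?n * (B + D)" .
      show ?thesis
      proof -
        have "(\<Prod>b\<in>(Basis::'a set). inverse (1 + (x \<bullet> b)\<^sup>2)) = inverse ?Q"
          using prod_inversef[of "\<lambda>b. 1 + (x \<bullet> b)\<^sup>2" "Basis::'a set"] by (simp only: o_def)
        with * Q show ?thesis
          by (simp only: inverse_eq_divide mult_1_right times_divide_eq_right pos_le_divide_eq mult.commute)
      qed
    qed
    then show "AE x in lborel. norm (\<psi> x) \<le> norm ((2 ^ ?n * (B + D)) * (\<Prod>b\<in>Basis. inverse (1 + (x \<bullet> b)\<^sup>2)))"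
      by (auto intro!: AE_I2 order_trans[OF _ abs_ge_self])
  qed simp
qed

section \<open>Square-integrable functions\<close>

definition square_integrable :: "'a measure \<Rightarrow> ('a \<Rightarrow> complex) \<Rightarrow> bool"
  where "square_integrable M f \<longleftrightarrow> f \<in> borel_measurable M \<and> integrable M (\<lambda>x. (norm (f x))\<^sup>2)"

definition L2norm :: "'a measure \<Rightarrow> ('a \<Rightarrow> complex) \<Rightarrow> real"
  where "L2norm M f = sqrt (LINT x|M. (norm (f x))\<^sup>2)"

lemma L2norm_nonneg [simp]: "L2norm M f \<ge> 0"
  by (simp add: L2norm_def)

lemma L2norm_sq: "(L2norm M f)\<^sup>2 = (LINT x|M. (norm (f x))\<^sup>2)"
  by (simp add: L2norm_def)

lemma square_integrable_bound:
  assumes g: "square_integrable M g" and [measurable]: "f \<in> borel_measurable M"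
    and le: "AE x in M. norm (f x) \<le> C * norm (g x)"
  shows "square_integrable M f"
  unfolding square_integrable_def
proof
  have [measurable]: "g \<in> borel_measurable M" using g by (simp add: square_integrable_def)
  show "integrable M (\<lambda>x. (norm (f x))\<^sup>2)"
  proof (rule Bochner_Integration.integrable_bound)
    show "integrable M (\<lambda>x. C\<^sup>2 * (norm (g x))\<^sup>2)" using g by (simp add: square_integrable_def)
    show "AE x in M. norm ((norm (f x))\<^sup>2) \<le> norm (C\<^sup>2 * (norm (g x))\<^sup>2)"
      using le
    proof eventually_elim
      case (elim x)
      then have "(norm (f x))\<^sup>2 \<le> (C * norm (g x))\<^sup>2" by (intro power_mono) auto
      then show ?case by (simp add: power_mult_distrib)
    qed
  qed measurable
qed fact

lemma borel_measurable_cnj [measurable (raw)]: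
  "f \<in> borel_measurable M \<Longrightarrow> (\<lambda>x. cnj (f x)) \<in> borel_measurable M"
  by (rule borel_measurable_continuous_on[where g=f and f=cnj]) (auto intro: continuous_intros)

lemma square_integrable_cnj [simp]: "square_integrable M f \<Longrightarrow> square_integrable M (\<lambda>x. cnj (f x))"
  by (auto simp: square_integrable_def intro: borel_measurable_cnj)

lemma square_integrable_add:
  assumes "square_integrable M f" "square_integrable M g"
  shows "square_integrable M (\<lambda>x. f x + g x)"
  unfolding square_integrable_def
proof
  have [measurable]: "f \<in> borel_measurable M" "g \<in> borel_measurable M" using assms by (auto simp: square_integrable_def)
  show "(\<lambda>x. f x + g x) \<in> borel_measurable M" by measurable
  show "integrable M (\<lambda>x. (norm (f x + g x))\<^sup>2)"
  proof (rule Bochner_Integration.integrable_bound)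
    show "integrable M (\<lambda>x. 2 * (norm (f x))\<^sup>2 + 2 * (norm (g x))\<^sup>2)" using assms by (simp add: square_integrable_def)
    have "(norm (f x + g x))\<^sup>2 \<le> 2 * (norm (f x))\<^sup>2 + 2 * (norm (g x))\<^sup>2" for x
    proof -
      have "(norm (f x + g x))\<^sup>2 \<le> (norm (f x) + norm (g x))\<^sup>2" by (intro power_mono norm_triangle_ineq) auto
      also have "\<dots> \<le> 2 * (norm (f x))\<^sup>2 + 2 * (norm (g x))\<^sup>2"
        using sum_squares_bound[of "norm (f x)" "norm (g x)"] by (simp add: power2_sum)
      finally show ?thesis .
    qed
    then show "AE x in M. norm ((norm (f x + g x))\<^sup>2) \<le> norm (2 * (norm (f x))\<^sup>2 + 2 * (norm (g x))\<^sup>2)"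
      by simp
  qed measurable
qed

lemma square_integrable_minus [simp]: "square_integrable M f \<Longrightarrow> square_integrable M (\<lambda>x. - f x)"
  by (simp add: square_integrable_def)

lemma square_integrable_diff:
  assumes "square_integrable M f" "square_integrable M g"
  shows "square_integrable M (\<lambda>x. f x - g x)"
  using square_integrable_add[OF assms(1) square_integrable_minus[OF assms(2)]] by simp

lemma square_integrable_mult:
  assumes "square_integrable M f" "square_integrable M g"
  shows "integrable M (\<lambda>x. f x * g x)"
proof (rule Bochner_Integration.integrable_bound)
  have [measurable]: "f \<in> borel_measurable M" "g \<in> borel_measurable M" using assms by (auto simp: square_integrable_def)
  show "(\<lambda>x. f x * g x) \<in> borel_measurable M" by measurable
  show "integrable M (\<lambda>x. (norm (f x))\<^sup>2 + (norm (g x))\<^sup>2)" using assms by (simp add: square_integrable_def)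
  have "norm (f x * g x) \<le> (norm (f x))\<^sup>2 + (norm (g x))\<^sup>2" for x
    using sum_squares_bound[of "norm (f x)" "norm (g x)"] mult_nonneg_nonneg[OF norm_ge_zero[of "f x"] norm_ge_zero[of "g x"]]
    unfolding norm_mult by linarith
  then show "AE x in M. norm (f x * g x) \<le> norm ((norm (f x))\<^sup>2 + (norm (g x))\<^sup>2)" by simp
qed

lemma L2_Cauchy_Schwarz:
  assumes f: "square_integrable M f" and g: "square_integrable M g"
  shows "norm (LINT x|M. f x * g x) \<le> L2norm M f * L2norm M g"
proof -
  have [measurable]: "f \<in> borel_measurable M" "g \<in> borel_measurable M" using f g by (auto simp: square_integrable_def)
  have i: "integrable M (\<lambda>x. norm (f x) * norm (g x))"
    using integrable_norm[OF square_integrable_mult[OF f g]] by (simp add: norm_mult)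
  have sq: "(\<integral>\<^sup>+x. (ennreal (norm (h x)))\<^sup>2 \<partial>M) = ennreal ((L2norm M h)\<^sup>2)" if "square_integrable M h" for h
    using that unfolding L2norm_sq square_integrable_def
    by (simp add: ennreal_power nn_integral_eq_integral)
  have nn: "(\<integral>\<^sup>+x. ennreal (norm (f x)) * ennreal (norm (g x)) \<partial>M) = ennreal (LINT x|M. norm (f x) * norm (g x))"
    using i by (simp add: ennreal_mult[symmetric] nn_integral_eq_integral)
  have "(\<integral>\<^sup>+x. ennreal (norm (f x)) * ennreal (norm (g x)) \<partial>M)\<^sup>2
     \<le> (\<integral>\<^sup>+x. (ennreal (norm (f x)))\<^sup>2 \<partial>M) * (\<integral>\<^sup>+x. (ennreal (norm (g x)))\<^sup>2 \<partial>M)"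
    by (rule Cauchy_Schwarz_nn_integral) measurable
  then have "ennreal ((LINT x|M. norm (f x) * norm (g x))\<^sup>2) \<le> ennreal ((L2norm M f * L2norm M g)\<^sup>2)"
    unfolding nn sq[OF f] sq[OF g] by (simp add: ennreal_power ennreal_mult[symmetric] power_mult_distrib)
  then have "(LINT x|M. norm (f x) * norm (g x))\<^sup>2 \<le> (L2norm M f * L2norm M g)\<^sup>2" by (subst (asm) ennreal_le_iff) auto
  then have "(LINT x|M. norm (f x) * norm (g x)) \<le> L2norm M f * L2norm M g"
    by (rule power2_le_imp_le) simp
  moreover have "norm (LINT x|M. f x * g x) \<le> (LINT x|M. norm (f x) * norm (g x))"
    using integral_norm_bound[of M "\<lambda>x. f x * g x"] by (simp add: norm_mult)
  ultimately show ?thesis by linarith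
qed

lemma L2norm_triangle:
  assumes f: "square_integrable M f" and g: "square_integrable M g"
  shows "L2norm M (\<lambda>x. f x + g x) \<le> L2norm M f + L2norm M g"
proof -
  have f2: "integrable M (\<lambda>x. (norm (f x))\<^sup>2)" and g2: "integrable M (\<lambda>x. (norm (g x))\<^sup>2)"
    using f g by (auto simp: square_integrable_def)
  have fg: "integrable M (\<lambda>x. f x * cnj (g x))" using square_integrable_mult[OF f square_integrable_cnj[OF g]] .
  have "(L2norm M (\<lambda>x. f x + g x))\<^sup>2 = (LINT x|M. (norm (f x))\<^sup>2 + (norm (g x))\<^sup>2 + 2 * Re (f x * cnj (g x)))"
    unfolding L2norm_sq by (intro Bochner_Integration.integral_cong refl) (simp only: cmod_power2, simp add: power2_eq_square algebra_simps)
  also have "\<dots> = (L2norm M f)\<^sup>2 + (L2norm M g)\<^sup>2 + 2 * Re (LINT x|M. f x * cnj (g x))"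
  proof -
    define r where "r = (\<lambda>x. Re (f x * cnj (g x)))"
    have r1: "integrable M r" unfolding r_def by (rule integrable_Re[OF fg])
    have r2: "integral\<^sup>L M r = Re (LINT x|M. f x * cnj (g x))" unfolding r_def by (rule integral_Re[OF fg])
    have "(LINT x|M. (norm (f x))\<^sup>2 + (norm (g x))\<^sup>2 + 2 * r x)
      = (LINT x|M. (norm (f x))\<^sup>2) + (LINT x|M. (norm (g x))\<^sup>2) + 2 * integral\<^sup>L M r"
      using f2 g2 r1 by simp
    then show ?thesis unfolding r2 L2norm_sq by (simp only: r_def)
  qed
  also have "\<dots> \<le> (L2norm M f)\<^sup>2 + (L2norm M g)\<^sup>2 + 2 * (L2norm M f * L2norm M g)"
    using L2_Cauchy_Schwarz[OF f square_integrable_cnj[OF g]] complex_Re_le_cmod[of "LINT x|M. f x * cnj (g x)"]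
    by (simp add: L2norm_def)
  also have "\<dots> = (L2norm M f + L2norm M g)\<^sup>2" by (simp add: power2_sum)
  finally show ?thesis by (rule power2_le_imp_le) simp
qed

lemma L2norm_minus_commute: "L2norm M (\<lambda>x. f x - g x) = L2norm M (\<lambda>x. g x - f x)"
  by (simp add: L2norm_def norm_minus_commute)

lemma L2norm_triangle_diff:
  assumes "square_integrable M f" "square_integrable M g" "square_integrable M h"
  shows "L2norm M (\<lambda>x. f x - h x) \<le> L2norm M (\<lambda>x. f x - g x) + L2norm M (\<lambda>x. g x - h x)"
  using L2norm_triangle[OF square_integrable_diff[OF assms(1,2)] square_integrable_diff[OF assms(2,3)]] by simp

definition L2_tendsto :: "'a measure \<Rightarrow> (nat \<Rightarrow> 'a \<Rightarrow> complex) \<Rightarrow> ('a \<Rightarrow> complex) \<Rightarrow> bool"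
  where "L2_tendsto M F f \<longleftrightarrow> (\<forall>n. square_integrable M (F n)) \<and> square_integrable M f \<and>
     (\<lambda>n. L2norm M (\<lambda>x. F n x - f x)) \<longlonglongrightarrow> 0"

lemma L2_tendsto_const: "square_integrable M f \<Longrightarrow> L2_tendsto M (\<lambda>_. f) f"
  by (simp add: L2_tendsto_def L2norm_def)

lemma L2_tendsto_cnj: "L2_tendsto M F f \<Longrightarrow> L2_tendsto M (\<lambda>n x. cnj (F n x)) (\<lambda>x. cnj (f x))"
  unfolding L2_tendsto_def L2norm_def complex_cnj_diff[symmetric] complex_mod_cnj by simp

lemma L2_tendsto_integral_mult:
  assumes F: "L2_tendsto M F f" and G: "L2_tendsto M G g"
  shows "(\<lambda>n. LINT x|M. F n x * G n x) \<longlonglongrightarrow> (LINT x|M. f x * g x)"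
proof (rule Lim_null[THEN iffD2], rule Lim_null_comparison)
  have sF: "square_integrable M (F n)" "square_integrable M (G n)" for n
    using F G by (auto simp: L2_tendsto_def)
  have sf: "square_integrable M f" "square_integrable M g"
    using F G by (auto simp: L2_tendsto_def)
  note d = square_integrable_diff[OF sF(1) sf(1)] square_integrable_diff[OF sF(2) sf(2)]
  let ?d = "\<lambda>n. L2norm M (\<lambda>x. F n x - f x)" and ?e = "\<lambda>n. L2norm M (\<lambda>x. G n x - g x)"
  have "norm ((LINT x|M. F n x * G n x) - (LINT x|M. f x * g x)) \<le> ?d n * ?e n + ?d n * L2norm M g + L2norm M f * ?e n" for n
  proof -
    have "(LINT x|M. F n x * G n x) - (LINT x|M. f x * g x) = (LINT x|M. F n x * G n x - f x * g x)"
      by (intro Bochner_Integration.integral_diff[symmetric] square_integrable_mult sF sf)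
    also have "\<dots> = (LINT x|M. (F n x - f x) * (G n x - g x) + (F n x - f x) * g x + f x * (G n x - g x))"
      by (intro Bochner_Integration.integral_cong refl) (simp add: algebra_simps)
    also have "\<dots> = (LINT x|M. (F n x - f x) * (G n x - g x) + (F n x - f x) * g x) + (LINT x|M. f x * (G n x - g x))"
      by (intro Bochner_Integration.integral_add Bochner_Integration.integrable_add square_integrable_mult d sf)
    also have "(LINT x|M. (F n x - f x) * (G n x - g x) + (F n x - f x) * g x) = (LINT x|M. (F n x - f x) * (G n x - g x)) + (LINT x|M. (F n x - f x) * g x)"
      by (intro Bochner_Integration.integral_add square_integrable_mult d sf)
    finally have eq: "(LINT x|M. F n x * G n x) - (LINT x|M. f x * g x) =
      (LINT x|M. (F n x - f x) * (G n x - g x)) + (LINT x|M. (F n x - f x) * g x) + (LINT x|M. f x * (G n x - g x))" .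
    show ?thesis
      unfolding eq by (intro norm_triangle_le add_mono L2_Cauchy_Schwarz d sf)
  qed
  then show "\<forall>\<^sub>F n in sequentially. norm ((LINT x|M. F n x * G n x) - (LINT x|M. f x * g x)) \<le> ?d n * ?e n + ?d n * L2norm M g + L2norm M f * ?e n"
    by simp
  have "?d \<longlonglongrightarrow> 0" "?e \<longlonglongrightarrow> 0" using F G by (auto simp: L2_tendsto_def)
  then have "(\<lambda>n. ?d n * ?e n + ?d n * L2norm M g + L2norm M f * ?e n) \<longlonglongrightarrow> 0 * 0 + 0 * L2norm M g + L2norm M f * 0"
    by (intro tendsto_intros)
  then show "(\<lambda>n. ?d n * ?e n + ?d n * L2norm M g + L2norm M f * ?e n) \<longlonglongrightarrow> 0" by simp
qed

lemma integral_mult_cnj_self: "(LINT x|M. f x * cnj (f x)) = complex_of_real ((L2norm M f)\<^sup>2)"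
  unfolding L2norm_sq by (simp add: complex_norm_square[symmetric] flip: of_real_power)

lemma L2_tendsto_norm:
  assumes "L2_tendsto M F f"
  shows "(\<lambda>n. (L2norm M (F n))\<^sup>2) \<longlonglongrightarrow> (L2norm M f)\<^sup>2"
  using L2_tendsto_integral_mult[OF assms L2_tendsto_cnj[OF assms]]
  unfolding integral_mult_cnj_self tendsto_of_real_iff .

text \<open>A measurable function is an almost everywhere limit of continuous functions; composing these with
the radial retraction onto a ball keeps the limit and makes the bound uniform.\<close>
lemma bounded_continuous_approximation:
  fixes f :: "'a::euclidean_space \<Rightarrow> complex"
  assumes f: "f \<in> borel_measurable borel" and B: "\<And>x. norm (f x) \<le> B"
  shows "\<exists>g. (\<forall>n. continuous_on UNIV (g n)) \<and> (\<forall>n x. norm (g n x) \<le> B) \<and>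
     (AE x in lborel. (\<lambda>n. g n x) \<longlonglongrightarrow> f x)"
proof -
  have "f \<in> borel_measurable lebesgue" using f by (simp add: measurable_completion)
  then have "f measurable_on UNIV" by (intro lebesgue_measurable_imp_measurable_on) auto
  then obtain N g where N: "negligible N" and g: "\<And>n. continuous_on UNIV (g n)"
    and lim: "\<And>x. x \<notin> N \<Longrightarrow> (\<lambda>n. g n x) \<longlonglongrightarrow> f x"
    unfolding measurable_on_def by auto
  have "AE x in lebesgue. x \<notin> N" using N by (simp add: negligible_iff_null_sets AE_not_in)
  then have N': "AE x in lborel. x \<notin> N" by (simp add: AE_completion_iff)
  have B0: "B \<ge> 0" using B[of 0] norm_ge_zero order_trans by blast
  show ?thesis
  proof (cases "B = 0")
    case True
    then have "f = (\<lambda>_. 0)" using B by auto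
    with True show ?thesis by (intro exI[of _ "\<lambda>_ _. 0"]) auto
  next
    case False
    with B0 have Bp: "B > 0" by simp
    \<comment> \<open>the radial retraction onto the ball of radius \<open>B\<close>\<close>
    define c where "c = (\<lambda>z::complex. z / complex_of_real (max 1 (norm z / B)))"
    have mx: "max 1 (norm z / B) > 0" for z :: complex by (simp add: max_def)
    have c_cont: "continuous_on UNIV c" unfolding c_def
      using mx Bp by (intro continuous_intros) (auto simp: max_def)
    have c_le: "norm (c z) \<le> B" for z
      using Bp mx[of z] by (auto simp: c_def norm_divide max_def field_simps)
    have c_id: "c z = z" if "norm z \<le> B" for z
      using that Bp by (auto simp: c_def max_def)
    have "AE x in lborel. (\<lambda>n. c (g n x)) \<longlonglongrightarrow> f x"
      using N'
    proof eventually_elim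
      case (elim x)
      have "isCont c (f x)" using c_cont by (simp add: continuous_on_eq_continuous_at)
      from isCont_tendsto_compose[OF this lim[OF elim]] show ?case by (simp add: c_id B)
    qed
    moreover have "continuous_on UNIV (\<lambda>x. c (g n x))" for n
      using continuous_on_compose2[OF c_cont g] by auto
    ultimately show ?thesis using c_le by (intro exI[of _ "\<lambda>n x. c (g n x)"]) auto
  qed
qed

text \<open>Averages over narrow Gaussians converge pointwise and boundedly on this class, and the class is
dense in \<open>L\<^sup>2\<close>; Plancherel's theorem is proved on it and then extended.\<close>
definition test_function :: "('a::euclidean_space \<Rightarrow> complex) \<Rightarrow> bool"
  where "test_function g \<longleftrightarrow> continuous_on UNIV g \<and> bounded (range g) \<and> integrable lborel g"

lemma integrable_bounded_imp_square_integrable: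
  assumes "integrable M g" "\<And>x. norm (g x) \<le> B"
  shows "square_integrable M g"
  unfolding square_integrable_def
proof
  show [measurable]: "g \<in> borel_measurable M" using assms(1) by auto
  show "integrable M (\<lambda>x. (norm (g x))\<^sup>2)"
  proof (rule Bochner_Integration.integrable_bound)
    show "integrable M (\<lambda>x. B * norm (g x))" using assms(1) by simp
    have "(norm (g x))\<^sup>2 \<le> B * norm (g x)" for x
      unfolding power2_eq_square using assms(2) by (intro mult_right_mono) auto
    then show "AE x in M. norm ((norm (g x))\<^sup>2) \<le> norm (B * norm (g x))"
      by (auto intro: order_trans[OF _ abs_ge_self])
  qed measurable
qed

lemma test_function_square_integrable: "test_function g \<Longrightarrow> square_integrable lborel g"
  unfolding test_function_def bounded_iff using integrable_bounded_imp_square_integrable by blast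

lemma L2_approx_bounded_support:
  fixes f :: "'a::euclidean_space \<Rightarrow> complex"
  assumes f: "f \<in> borel_measurable borel" and B: "\<And>x. norm (f x) \<le> B" and supp: "\<And>x. norm x > R \<Longrightarrow> f x = 0"
  shows "\<exists>g. (\<forall>n. test_function (g n)) \<and> L2_tendsto lborel g f"
proof -
  obtain g where g: "\<And>n. continuous_on UNIV (g n)" "\<And>n x. norm (g n x) \<le> B"
     "AE x in lborel. (\<lambda>n. g n x) \<longlonglongrightarrow> f x"
    using bounded_continuous_approximation[OF f B] by blast
  \<comment> \<open>a continuous cutoff, equal to one on the support of \<open>f\<close>\<close>
  define k where "k = (\<lambda>x::'a. max 0 (min 1 (R + 1 - norm x)))"
  have B0: "B \<ge> 0" using B[of 0] norm_ge_zero order_trans by blast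
  have k: "continuous_on UNIV k" "\<And>x. 0 \<le> k x" "\<And>x. k x \<le> 1" "\<And>x. norm x \<le> R \<Longrightarrow> k x = 1" "\<And>x. norm x > R + 1 \<Longrightarrow> k x = 0"
    unfolding k_def by (auto intro!: continuous_intros)
  define h where "h = (\<lambda>n x. complex_of_real (k x) * g n x)"
  have h_cont: "continuous_on UNIV (h n)" for n unfolding h_def by (intro continuous_intros k g)
  have h_le: "norm (h n x) \<le> B * indicator (cball 0 (R + 1)) x" for n x
    using mult_mono[OF k(3)[of x] g(2)[of n x]] k(2)[of x] k(5)[of x]
    by (auto simp: h_def norm_mult indicator_def)
  have f_le: "norm (f x) \<le> B * indicator (cball 0 (R + 1)) x" for x
    using B[of x] supp[of x] by (auto simp: indicator_def)
  have ind: "integrable lborel (\<lambda>x::'a. B * indicator (cball 0 (R + 1)) x)"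
    by (intro integrable_mult_right integrable_real_indicator) (auto intro: emeasure_bounded_finite[unfolded infinity_ennreal_def])
  have [measurable]: "h n \<in> borel_measurable borel" for n using h_cont by (rule borel_measurable_continuous_onI)
  note [measurable] = f
  have le: "B * indicator (cball 0 (R + 1)) x \<le> B" for x :: 'a using B0 by (simp add: indicator_def)
  have hi: "integrable lborel (h n)" for n
    by (rule Bochner_Integration.integrable_bound[OF ind]) (auto intro!: AE_I2 order_trans[OF h_le abs_ge_self])
  have fi: "integrable lborel f"
    by (rule Bochner_Integration.integrable_bound[OF ind]) (auto intro!: AE_I2 order_trans[OF f_le abs_ge_self])
  have test: "test_function (h n)" for n
    unfolding test_function_def using h_cont hi h_le[of n] le
    by (auto simp: bounded_iff intro!: exI[of _ B] order_trans[OF h_le])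
  have fs: "square_integrable lborel f" using integrable_bounded_imp_square_integrable[OF fi B] .
  have hs: "square_integrable lborel (h n)" for n using test test_function_square_integrable by blast
  have lim: "AE x in lborel. (\<lambda>n. (norm (h n x - f x))\<^sup>2) \<longlonglongrightarrow> 0"
    using g(3)
  proof eventually_elim
    case (elim x)
    have "(\<lambda>n. h n x) \<longlonglongrightarrow> complex_of_real (k x) * f x" unfolding h_def by (intro tendsto_intros elim)
    moreover have "complex_of_real (k x) * f x = f x" using k(4)[of x] supp[of x] by (cases "norm x \<le> R") auto
    ultimately have "(\<lambda>n. (norm (h n x - f x))\<^sup>2) \<longlonglongrightarrow> (norm (f x - f x))\<^sup>2"
      by (intro tendsto_intros) simp
    then show ?case by simp
  qed
  have "(\<lambda>n. LINT x|lborel. (norm (h n x - f x))\<^sup>2) \<longlonglongrightarrow> (LINT x|(lborel::'a measure). 0)"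
  proof (rule integral_dominated_convergence)
    show "integrable lborel (\<lambda>x::'a. 4 * B * (B * indicator (cball 0 (R + 1)) x))"
      using ind by (rule integrable_mult_right)
    show "AE x in lborel. norm ((norm (h n x - f x))\<^sup>2) \<le> 4 * B * (B * indicator (cball 0 (R + 1)) x)" for n
    proof (rule AE_I2)
      fix x
      have "norm (h n x - f x) \<le> 2 * (B * indicator (cball 0 (R + 1)) x)"
        using h_le[of n x] f_le[of x] by (intro norm_triangle_le_diff) linarith
      then have "(norm (h n x - f x))\<^sup>2 \<le> (2 * (B * indicator (cball 0 (R + 1)) x))\<^sup>2" by (intro power_mono) auto
      then show "norm ((norm (h n x - f x))\<^sup>2) \<le> 4 * B * (B * indicator (cball 0 (R + 1)) x)"
        by (cases "x \<in> cball 0 (R + 1)") (simp_all add: power2_eq_square)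
    qed
  qed (use lim in auto)
  then have "(\<lambda>n. L2norm lborel (\<lambda>x. h n x - f x)) \<longlonglongrightarrow> sqrt 0"
    unfolding L2norm_def by (intro tendsto_real_sqrt) simp
  then show ?thesis using test fs hs unfolding L2_tendsto_def by (intro exI[of _ h]) auto
qed

lemma L2_approx_test:
  fixes f :: "'a::euclidean_space \<Rightarrow> complex"
  assumes f: "square_integrable lborel f" and d: "d > 0"
  shows "\<exists>g. test_function g \<and> L2norm lborel (\<lambda>x. g x - f x) < d"
proof -
  have [measurable]: "f \<in> borel_measurable borel" using f by (simp add: square_integrable_def)
  \<comment> \<open>first cut off both the domain and the values\<close>
  define F where "F = (\<lambda>n x. if norm x \<le> real n \<and> norm (f x) \<le> real n then f x else 0)"
  have [measurable]: "F n \<in> borel_measurable borel" for n unfolding F_def by measurable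
  have Fs: "square_integrable lborel (F n)" for n
    by (rule square_integrable_bound[OF f, where C=1]) (auto simp: F_def)
  have "(\<lambda>n. LINT x|lborel. (norm (F n x - f x))\<^sup>2) \<longlonglongrightarrow> (LINT x|(lborel::'a measure). 0)"
  proof (rule integral_dominated_convergence)
    show "integrable lborel (\<lambda>x. (norm (f x))\<^sup>2)" using f by (simp add: square_integrable_def)
    show "AE x in lborel. (\<lambda>n. (norm (F n x - f x))\<^sup>2) \<longlonglongrightarrow> 0"
    proof (rule AE_I2)
      fix x
      have "\<forall>\<^sub>F n in sequentially. (norm (F n x - f x))\<^sup>2 = 0"
        using eventually_ge_at_top[of "nat \<lceil>max (norm x) (norm (f x))\<rceil>"]
        by eventually_elim (auto simp: F_def nat_le_iff ceiling_le_iff)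
      then show "(\<lambda>n. (norm (F n x - f x))\<^sup>2) \<longlonglongrightarrow> 0" by (rule tendsto_eventually)
    qed
  qed (auto simp: F_def)
  then have "(\<lambda>n. L2norm lborel (\<lambda>x. F n x - f x)) \<longlonglongrightarrow> sqrt 0"
    unfolding L2norm_def by (intro tendsto_real_sqrt) simp
  then have "\<forall>\<^sub>F n in sequentially. L2norm lborel (\<lambda>x. F n x - f x) < d / 2"
    using d by (intro order_tendstoD(2)[where y=0]) auto
  then obtain n where n: "L2norm lborel (\<lambda>x. F n x - f x) < d / 2"
    by (auto dest: eventually_happens)
  have "\<exists>g. (\<forall>m. test_function (g m)) \<and> L2_tendsto lborel g (F n)"
    by (rule L2_approx_bounded_support[of _ "real n" "real n"]) (auto simp: F_def)
  then obtain g where g: "\<And>m. test_function (g m)" "L2_tendsto lborel g (F n)" by blast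
  have "\<forall>\<^sub>F m in sequentially. L2norm lborel (\<lambda>x. g m x - F n x) < d / 2"
    using d g(2) unfolding L2_tendsto_def by (intro order_tendstoD(2)[where y=0]) auto
  then obtain m where m: "L2norm lborel (\<lambda>x. g m x - F n x) < d / 2"
    by (auto dest: eventually_happens)
  have "L2norm lborel (\<lambda>x. g m x - f x) \<le> L2norm lborel (\<lambda>x. g m x - F n x) + L2norm lborel (\<lambda>x. F n x - f x)"
    using g test_function_square_integrable Fs f by (intro L2norm_triangle_diff) auto
  also have "\<dots> < d" using m n by simp
  finally show ?thesis using g(1) by blast
qed

section \<open>Gaussians separate functions\<close>

lemma prob_gaussian_UNIV [simp]: "measure (gaussian :: 'a::euclidean_space measure) UNIV = 1"
  using gaussian.prob_space[where 'a='a] by simp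

definition gauss_average :: "real \<Rightarrow> ('a::euclidean_space \<Rightarrow> complex) \<Rightarrow> 'a \<Rightarrow> complex"
  where "gauss_average e g x = (LINT h|gaussian. g (x + e *\<^sub>R h))"

lemma gauss_average_measurable [measurable]:
  assumes [measurable]: "g \<in> borel_measurable borel"
  shows "gauss_average e g \<in> borel_measurable borel"
  unfolding gauss_average_def[abs_def] by measurable

text \<open>A Gaussian average is a convolution with the Gaussian kernel of width \<open>e\<close>, an approximate
identity as \<open>e\<close> tends to zero.\<close>
lemma gauss_average_kernel:
  fixes g :: "'a::euclidean_space \<Rightarrow> complex"
  assumes e: "e > 0" and [measurable]: "g \<in> borel_measurable borel"
  shows "gauss_average e g x = complex_of_real ((1/e) ^ DIM('a)) * (LINT y|lborel. complex_of_real (gauss ((1/e) *\<^sub>R (y - x))) * g y)"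
proof -
  have "(LINT y|lborel. complex_of_real (gauss ((1/e) *\<^sub>R (y - x))) * g y)
     = \<bar>e\<bar> ^ DIM('a) *\<^sub>R (LINT h|lborel. complex_of_real (gauss ((1/e) *\<^sub>R (x + e *\<^sub>R h - x))) * g (x + e *\<^sub>R h))"
    using e by (subst integral_affine[where c=e and t=x]) auto
  also have "(LINT h|lborel. complex_of_real (gauss ((1/e) *\<^sub>R (x + e *\<^sub>R h - x))) * g (x + e *\<^sub>R h)) = gauss_average e g x"
    using e unfolding gauss_average_def by (subst integral_gaussian) (auto simp: scaleR_conv_of_real)
  finally show ?thesis using e by (simp add: scaleR_conv_of_real power_one_over)
qed

lemma gauss_average_tendsto:
  fixes g :: "'a::euclidean_space \<Rightarrow> complex"
  assumes g: "continuous_on UNIV g" and B: "\<And>x. norm (g x) \<le> B"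
  shows "(\<lambda>n. gauss_average (1 / real (Suc n)) g x) \<longlonglongrightarrow> g x"
proof -
  have [measurable]: "g \<in> borel_measurable borel" using g by (rule borel_measurable_continuous_onI)
  have "(\<lambda>n. LINT h|gaussian. g (x + (1 / real (Suc n)) *\<^sub>R h)) \<longlonglongrightarrow> (LINT h|(gaussian::'a measure). g x)"
  proof (rule integral_dominated_convergence[where w="\<lambda>_. B"])
    show "AE h in gaussian. (\<lambda>n. g (x + (1 / real (Suc n)) *\<^sub>R h)) \<longlonglongrightarrow> g x"
    proof (rule AE_I2)
      fix h :: 'a
      have "(\<lambda>n. x + (1 / real (Suc n)) *\<^sub>R h) \<longlonglongrightarrow> x + 0 *\<^sub>R h"
        by (intro tendsto_intros LIMSEQ_Suc[OF lim_1_over_n])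
      moreover have "isCont g x" using g by (simp add: continuous_on_eq_continuous_at)
      ultimately show "(\<lambda>n. g (x + (1 / real (Suc n)) *\<^sub>R h)) \<longlonglongrightarrow> g x"
        using isCont_tendsto_compose[of x g] by simp
    qed
  qed (auto simp: B)
  then show ?thesis by (simp add: gauss_average_def gaussian.prob_space)
qed

lemma norm_gauss_average_le:
  fixes g :: "'a::euclidean_space \<Rightarrow> complex"
  assumes [measurable]: "g \<in> borel_measurable borel" and B: "\<And>x. norm (g x) \<le> B"
  shows "norm (gauss_average e g x) \<le> B"
proof -
  have "norm (gauss_average e g x) \<le> (LINT h|gaussian. norm (g (x + e *\<^sub>R h)))"
    unfolding gauss_average_def by (rule integral_norm_bound)
  also have "\<dots> \<le> (LINT h|(gaussian::'a measure). B)"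
    using B by (intro Bochner_Integration.integral_mono) (auto intro!: gaussian.integrable_const_bound[of _ B])
  finally have "norm (gauss_average e g x) \<le> (LINT h|(gaussian::'a measure). B)" .
  then show ?thesis by (simp add: gaussian.prob_space)
qed

text \<open>Testing with continuous functions that approximate the conjugate phase of \<open>H\<close> makes the integral
converge to the \<open>L\<^sup>1\<close> norm of \<open>H\<close>.\<close>
lemma integral_bounded_continuous_zero_imp_AE_zero:
  fixes H :: "'a::euclidean_space \<Rightarrow> complex"
  assumes H: "integrable lborel H"
    and z: "\<And>\<theta>. continuous_on UNIV \<theta> \<Longrightarrow> (\<And>x. norm (\<theta> x) \<le> 1) \<Longrightarrow> (LINT x|lborel. H x * \<theta> x) = 0"
  shows "AE x in lborel. H x = 0"
proof -
  have [measurable]: "H \<in> borel_measurable borel" using borel_measurable_integrable[OF H] by simp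
  have "\<exists>g. (\<forall>n. continuous_on UNIV (g n)) \<and> (\<forall>n x. norm (g n x) \<le> 1) \<and>
     (AE x in lborel. (\<lambda>n. g n x) \<longlonglongrightarrow> cnj (sgn (H x)))"
    by (rule bounded_continuous_approximation) (auto simp: norm_sgn intro!: borel_measurable_cnj)
  then obtain \<theta> where \<theta>: "\<And>n. continuous_on UNIV (\<theta> n)" "\<And>n x. norm (\<theta> n x) \<le> 1"
     "AE x in lborel. (\<lambda>n. \<theta> n x) \<longlonglongrightarrow> cnj (sgn (H x))" by blast
  have [measurable]: "\<theta> n \<in> borel_measurable borel" for n using \<theta>(1) by (rule borel_measurable_continuous_onI)
  have "(\<lambda>n. LINT x|lborel. H x * \<theta> n x) \<longlonglongrightarrow> (LINT x|lborel. H x * cnj (sgn (H x)))"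
  proof (rule integral_dominated_convergence[where w="\<lambda>x. norm (H x)"])
    show "AE x in lborel. (\<lambda>n. H x * \<theta> n x) \<longlonglongrightarrow> H x * cnj (sgn (H x))"
      using \<theta>(3) by eventually_elim (intro tendsto_intros)
    show "AE x in lborel. norm (H x * \<theta> n x) \<le> norm (H x)" for n
      using \<theta>(2) by (auto simp: norm_mult mult_left_le)
  qed (use H in \<open>auto simp: sgn_eq\<close>)
  then have "(LINT x|lborel. H x * cnj (sgn (H x))) = 0"
    using z[OF \<theta>(1,2)] by (simp add: LIMSEQ_const_iff)
  moreover have "H x * cnj (sgn (H x)) = complex_of_real (norm (H x))" for x
    by (cases "H x = 0") (simp_all add: sgn_eq complex_norm_square[symmetric] power2_eq_square)
  ultimately have "(LINT x|lborel. norm (H x)) = 0" by simp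
  then show ?thesis using H by (subst (asm) integral_nonneg_eq_0_iff_AE) auto
qed

text \<open>By Fubini, \<open>H\<close> annihilates every Gaussian average of a bounded continuous function, and these
averages converge boundedly to the function itself.\<close>
lemma gauss_test_imp_AE_zero_integrable:
  fixes H :: "'a::euclidean_space \<Rightarrow> complex"
  assumes H: "integrable lborel H"
    and z: "\<And>e a. e > 0 \<Longrightarrow> (LINT x|lborel. H x * complex_of_real (gauss ((1/e) *\<^sub>R (x - a)))) = 0"
  shows "AE x in lborel. H x = 0"
proof (rule integral_bounded_continuous_zero_imp_AE_zero[OF H])
  fix \<theta> :: "'a \<Rightarrow> complex"
  assume \<theta>: "continuous_on UNIV \<theta>" "\<And>x. norm (\<theta> x) \<le> 1"
  have [measurable]: "H \<in> borel_measurable borel" using borel_measurable_integrable[OF H] by simp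
  have [measurable]: "\<theta> \<in> borel_measurable borel" using \<theta>(1) by (rule borel_measurable_continuous_onI)
  have zero: "(LINT x|lborel. H x * gauss_average e \<theta> x) = 0" if e: "e > 0" for e
  proof -
    let ?k = "\<lambda>x y. complex_of_real (gauss ((1/e) *\<^sub>R (y - x)))"
    let ?f = "\<lambda>(x, y). H x * (?k x y * \<theta> y)"
    have gi: "integrable lborel (\<lambda>y. gauss ((1/e) *\<^sub>R (y - x)))"
      and gv: "(LINT y|lborel. gauss ((1/e) *\<^sub>R (y - x))) = e ^ DIM('a)" for x :: 'a
    proof -
      have G: "integrable lborel (gauss :: 'a \<Rightarrow> real)" "(LINT y|lborel. gauss (y :: 'a)) = 1"
        using gauss_integral[where 'a='a] by (simp_all add: has_bochner_integral_iff)
      have eq: "(1/e) *\<^sub>R (y - x) = (- (1/e) *\<^sub>R x) + (1/e) *\<^sub>R y" for y by (simp add: algebra_simps)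
      show "integrable lborel (\<lambda>y. gauss ((1/e) *\<^sub>R (y - x)))"
        unfolding eq using e G by (intro integrable_affine_iff[THEN iffD2]) auto
      have "(LINT y|lborel. gauss (y :: 'a)) = \<bar>1/e\<bar> ^ DIM('a) *\<^sub>R (LINT y|lborel. gauss ((- (1/e) *\<^sub>R x) + (1/e) *\<^sub>R y))"
        using e by (intro integral_affine) auto
      then show "(LINT y|lborel. gauss ((1/e) *\<^sub>R (y - x))) = e ^ DIM('a)"
        unfolding eq using e G(2) by (simp add: power_one_over field_simps)
    qed
    have ki: "integrable lborel (\<lambda>y. ?k x y * \<theta> y)" for x
      by (rule Bochner_Integration.integrable_bound[OF gi[of x]])
         (auto simp: norm_mult gauss_pos less_imp_le intro!: mult_left_le \<theta>)
    have F: "integrable (lborel \<Otimes>\<^sub>M lborel) ?f"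
    proof (rule lborel_pair.Fubini_integrable)
      show "?f \<in> borel_measurable (lborel \<Otimes>\<^sub>M lborel)" by measurable
      show "integrable lborel (\<lambda>x. LINT y|lborel. norm (?f (x, y)))"
      proof (rule Bochner_Integration.integrable_bound)
        show "integrable lborel (\<lambda>x. norm (H x) * e ^ DIM('a))" using H by simp
        have "norm (LINT y|lborel. norm (?f (x, y))) \<le> norm (H x) * e ^ DIM('a)" for x
        proof -
          have "norm (LINT y|lborel. norm (?f (x, y))) = norm (H x) * (LINT y|lborel. norm (?k x y * \<theta> y))"
            by (simp add: norm_mult)
          also have "\<dots> \<le> norm (H x) * (LINT y|lborel. gauss ((1/e) *\<^sub>R (y - x)))"
            by (intro mult_left_mono integral_mono gi integrable_norm ki)
               (auto simp: norm_mult gauss_pos less_imp_le intro!: mult_left_le \<theta>)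
          finally show ?thesis by (simp add: gv)
        qed
        then show "AE x in lborel. norm (LINT y|lborel. norm (?f (x, y))) \<le> norm (norm (H x) * e ^ DIM('a))"
          using e by (auto simp: abs_mult)
      qed measurable
      show "AE x in lborel. integrable lborel (\<lambda>y. ?f (x, y))" using ki by simp
    qed
    have "(LINT x|lborel. H x * gauss_average e \<theta> x) = complex_of_real ((1/e) ^ DIM('a)) * (LINT x|lborel. LINT y|lborel. ?f (x, y))"
      using e by (subst integral_mult_right_zero[symmetric]) (simp add: gauss_average_kernel mult.left_commute)
    also have "(LINT x|lborel. LINT y|lborel. ?f (x, y)) = (LINT y|lborel. LINT x|lborel. ?f (x, y))"
      using lborel_pair.Fubini_integral[of "\<lambda>x y. ?f (x, y)"] F by simp
    also have "\<dots> = (LINT y|lborel. \<theta> y * (LINT x|lborel. H x * complex_of_real (gauss ((1/e) *\<^sub>R (x - y)))))"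
    proof (intro Bochner_Integration.integral_cong refl)
      fix y
      have "gauss ((1/e) *\<^sub>R (y - x)) = gauss ((1/e) *\<^sub>R (x - y))" for x :: 'a
        using gauss_minus[of "(1/e) *\<^sub>R (x - y)"] by (simp add: algebra_simps)
      then show "(LINT x|lborel. ?f (x, y)) = \<theta> y * (LINT x|lborel. H x * complex_of_real (gauss ((1/e) *\<^sub>R (x - y))))"
        by (subst integral_mult_right_zero[symmetric]) (simp add: ac_simps)
    qed
    also have "\<dots> = 0" using z e by simp
    finally show ?thesis by simp
  qed
  have "(\<lambda>n. LINT x|lborel. H x * gauss_average (1 / real (Suc n)) \<theta> x) \<longlonglongrightarrow> (LINT x|lborel. H x * \<theta> x)"
  proof (rule integral_dominated_convergence[where w="\<lambda>x. norm (H x)"])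
    show "AE x in lborel. (\<lambda>n. H x * gauss_average (1 / real (Suc n)) \<theta> x) \<longlonglongrightarrow> H x * \<theta> x"
      by (intro AE_I2 tendsto_mult tendsto_const gauss_average_tendsto[OF \<theta>])
    show "AE x in lborel. norm (H x * gauss_average (1 / real (Suc n)) \<theta> x) \<le> norm (H x)" for n
      using norm_gauss_average_le[of \<theta> 1] \<theta> by (auto simp: norm_mult mult_left_le)
  qed (use H in auto)
  then show "(LINT x|lborel. H x * \<theta> x) = 0" using zero by (simp add: LIMSEQ_const_iff)
qed

text \<open>Completing the square. It lets one factor of a Gaussian be split off to make a merely locally
integrable function integrable without leaving the class of Gaussian tests.\<close>
lemma gauss_mult_gauss:
  fixes a x :: "'a::euclidean_space"
  assumes e: "e > 0"
  shows "\<exists>d>0. \<exists>b K. \<forall>x. gauss x * gauss ((1/e) *\<^sub>R (x - a)) = K * gauss ((1/d) *\<^sub>R (x - b))"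
proof -
  \<comment> \<open>the sum of the two inverse variances, which is the inverse variance of the product\<close>
  define q where "q = 1 + 1 / e\<^sup>2"
  have q: "q > 0" using e by (auto simp: q_def intro!: add_pos_pos)
  define d where "d = 1 / sqrt q"
  define b where "b = (1 / (e\<^sup>2 * q)) *\<^sub>R a"
  define s where "s = (a \<bullet> a) / e\<^sup>2 - (a \<bullet> a) / (e\<^sup>2 * e\<^sup>2 * q)"
  have d: "d > 0" using q by (simp add: d_def)
  have key: "(norm x)\<^sup>2 + (norm ((1/e) *\<^sub>R (x - a)))\<^sup>2 = (norm ((1/d) *\<^sub>R (x - b)))\<^sup>2 + s" for x
  proof -
    have 1: "(norm ((1/e) *\<^sub>R (x - a)))\<^sup>2 = (x \<bullet> x - 2 * (x \<bullet> a) + a \<bullet> a) / e\<^sup>2"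
      unfolding norm_scaleR power_mult_distrib power2_norm_eq_inner[of "x - a"]
      using e by (simp add: inner_diff_left inner_diff_right inner_commute power_one_over)
    have 2: "(norm ((1/d) *\<^sub>R (x - b)))\<^sup>2 = q * (x \<bullet> x - 2 * (x \<bullet> b) + b \<bullet> b)"
      unfolding norm_scaleR power_mult_distrib power2_norm_eq_inner[of "x - b"]
      using q by (simp add: inner_diff_left inner_diff_right inner_commute d_def)
    have 3: "q * (x \<bullet> b) = (x \<bullet> a) / e\<^sup>2" using q e by (simp add: b_def)
    have 4: "q * (b \<bullet> b) = (a \<bullet> a) / (e\<^sup>2 * e\<^sup>2 * q)" using q e by (simp add: b_def)
    have 5: "q * (x \<bullet> x) = x \<bullet> x + (x \<bullet> x) / e\<^sup>2" by (simp add: q_def distrib_right)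
    have "q * (x \<bullet> x - 2 * (x \<bullet> b) + b \<bullet> b) = q * (x \<bullet> x) - 2 * (q * (x \<bullet> b)) + q * (b \<bullet> b)" by (simp add: algebra_simps)
    then show ?thesis unfolding 1 2 3 4 5 s_def power2_norm_eq_inner[of x]
      by (simp add: add_divide_distrib diff_divide_distrib)
  qed
  have fin: "gauss x * gauss ((1/e) *\<^sub>R (x - a)) = ((2 * pi) powr (- real DIM('a) / 2) * exp (- s / 2)) * gauss ((1/d) *\<^sub>R (x - b))" for x
  proof -
    have *: "exp (- (norm x)\<^sup>2 / 2) * exp (- (norm ((1/e) *\<^sub>R (x - a)))\<^sup>2 / 2) = exp (- s / 2) * exp (- (norm ((1/d) *\<^sub>R (x - b)))\<^sup>2 / 2)"
    proof -
      have "- (norm x)\<^sup>2 / 2 + - (norm ((1/e) *\<^sub>R (x - a)))\<^sup>2 / 2 = - s / 2 + - (norm ((1/d) *\<^sub>R (x - b)))\<^sup>2 / 2"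
        using key[of x] by linarith
      then show ?thesis unfolding mult_exp_exp by (rule arg_cong)
    qed
    have "C * exp (- (norm x)\<^sup>2 / 2) * (C * exp (- (norm ((1/e) *\<^sub>R (x - a)))\<^sup>2 / 2))
      = C * exp (- s / 2) * (C * exp (- (norm ((1/d) *\<^sub>R (x - b)))\<^sup>2 / 2))" for C :: real
    proof -
      have "C * p * (C * q) = (C * C) * (p * q)" for p q :: real by simp
      then show ?thesis by (simp only: *)
    qed
    then show ?thesis unfolding gauss_def .
  qed
  show ?thesis by (rule exI, rule conjI[OF d], rule exI, rule exI, rule allI, rule fin)
qed

text \<open>Multiplying by one fixed Gaussian makes \<open>H\<close> integrable, and the products of that Gaussian with the
others are again Gaussians. Integrability against Gaussians is what the distributional definition
of the Fourier transform provides, on both of its sides.\<close>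
lemma gauss_test_imp_AE_zero:
  fixes H :: "'a::euclidean_space \<Rightarrow> complex"
  assumes i: "\<And>e a. e > 0 \<Longrightarrow> integrable lborel (\<lambda>x. H x * complex_of_real (gauss ((1/e) *\<^sub>R (x - a))))"
    and z: "\<And>e a. e > 0 \<Longrightarrow> (LINT x|lborel. H x * complex_of_real (gauss ((1/e) *\<^sub>R (x - a)))) = 0"
  shows "AE x in lborel. H x = 0"
proof -
  have "AE x in lborel. H x * complex_of_real (gauss x) = 0"
  proof (rule gauss_test_imp_AE_zero_integrable)
    show "integrable lborel (\<lambda>x. H x * complex_of_real (gauss x))" using i[of 1 0] by simp
    fix e :: real and a :: 'a
    assume "e > 0"
    from gauss_mult_gauss[OF \<open>e > 0\<close>, of a] obtain d b K where d: "d > 0"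
      and eq: "\<forall>x. gauss x * gauss ((1/e) *\<^sub>R (x - a)) = K * gauss ((1/d) *\<^sub>R (x - b))"
      by (elim exE conjE)
    have *: "H x * complex_of_real (gauss x) * complex_of_real (gauss ((1/e) *\<^sub>R (x - a)))
      = complex_of_real K * (H x * complex_of_real (gauss ((1/d) *\<^sub>R (x - b))))" for x
      using arg_cong[OF eq[rule_format, of x], of complex_of_real] by (simp add: mult.assoc mult.left_commute)
    show "(LINT x|lborel. H x * complex_of_real (gauss x) * complex_of_real (gauss ((1/e) *\<^sub>R (x - a)))) = 0"
      unfolding * using z[OF d, of b] by simp
  qed
  then show ?thesis
  proof eventually_elim
    case (elim x)
    then show ?case using gauss_pos[of x] by simp
  qed
qed

section \<open>Plancherel's theorem\<close>

lemma fourier_measurable [measurable]: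
  assumes [measurable]: "f \<in> borel_measurable borel"
  shows "fourier f \<in> borel_measurable borel"
  unfolding fourier_def[abs_def] by measurable

lemma norm_fourier_le:
  fixes f :: "'a::euclidean_space \<Rightarrow> complex"
  shows "norm (fourier f \<xi>) \<le> (2 * pi) powr (- real DIM('a) / 2) * (LINT x|lborel. norm (f x))"
proof -
  have "norm (LINT x|lborel. exp (- \<i> * complex_of_real (x \<bullet> \<xi>)) * f x) \<le> (LINT x|lborel. norm (exp (- \<i> * complex_of_real (x \<bullet> \<xi>)) * f x))"
    by (rule integral_norm_bound)
  then show ?thesis unfolding fourier_def norm_mult by (simp add: norm_mult mult_left_mono)
qed

lemma fourier_diff:
  fixes f g :: "'a::euclidean_space \<Rightarrow> complex"
  assumes f: "integrable lborel f" and g: "integrable lborel g"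
  shows "fourier (\<lambda>x. f x - g x) \<xi> = fourier f \<xi> - fourier g \<xi>"
proof -
  have "integrable lborel (\<lambda>x. exp (- \<i> * complex_of_real (x \<bullet> \<xi>)) * f x)" if "integrable lborel f" for f
    by (rule Bochner_Integration.integrable_bound[OF that]) (use borel_measurable_integrable[OF that] in \<open>auto simp: norm_mult\<close>)
  from this[OF f] this[OF g] show ?thesis unfolding fourier_def by (simp add: right_diff_distrib)
qed

lemma fourier_multiplication_formula:
  fixes f k :: "'a::euclidean_space \<Rightarrow> complex"
  assumes f: "integrable lborel f" and k: "integrable lborel k"
  shows "(LINT x|lborel. f x * fourier k x) = (LINT \<xi>|lborel. fourier f \<xi> * k \<xi>)"
proof -
  have [measurable]: "f \<in> borel_measurable borel" "k \<in> borel_measurable borel"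
    using f k by (auto dest: borel_measurable_integrable)
  let ?C = "complex_of_real ((2 * pi) powr (- real DIM('a) / 2))"
  let ?F = "\<lambda>(x, \<xi>). f x * (exp (- \<i> * complex_of_real (\<xi> \<bullet> x)) * k \<xi>)"
  have F: "integrable (lborel \<Otimes>\<^sub>M lborel) ?F"
  proof (rule lborel_pair.Fubini_integrable)
    show "?F \<in> borel_measurable (lborel \<Otimes>\<^sub>M lborel)" by measurable
    show "integrable lborel (\<lambda>x. LINT y|lborel. norm (?F (x, y)))"
      using f by (simp add: norm_mult)
    show "AE x in lborel. integrable lborel (\<lambda>y. ?F (x, y))"
    proof (rule AE_I2)
      fix x
      have "integrable lborel (\<lambda>\<xi>. exp (- \<i> * complex_of_real (\<xi> \<bullet> x)) * k \<xi>)"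
        by (rule Bochner_Integration.integrable_bound[OF k]) (auto simp: norm_mult)
      then show "integrable lborel (\<lambda>y. ?F (x, y))" by simp
    qed
  qed
  have "(LINT x|lborel. f x * fourier k x) = ?C * (LINT x|lborel. LINT \<xi>|lborel. ?F (x, \<xi>))"
    by (subst integral_mult_right_zero[symmetric]) (simp add: fourier_def mult.left_commute)
  also have "(LINT x|lborel. LINT \<xi>|lborel. ?F (x, \<xi>)) = (LINT \<xi>|lborel. LINT x|lborel. ?F (x, \<xi>))"
    using lborel_pair.Fubini_integral[of "\<lambda>x y. ?F (x, y)"] F by simp
  also have "(LINT \<xi>|lborel. LINT x|lborel. ?F (x, \<xi>)) = (LINT \<xi>|lborel. (LINT x|lborel. exp (- \<i> * complex_of_real (x \<bullet> \<xi>)) * f x) * k \<xi>)"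
    by (subst integral_mult_left_zero[symmetric]) (simp add: ac_simps inner_commute)
  also have "?C * \<dots> = (LINT \<xi>|lborel. fourier f \<xi> * k \<xi>)"
    by (subst integral_mult_right_zero[symmetric]) (simp add: fourier_def mult.assoc)
  finally show ?thesis .
qed

text \<open>The Gaussian-damped Parseval identity: two applications of the multiplication formula move the
damping factor to the physical side, where it becomes a Gaussian average. Letting \<open>e\<close> tend to zero
gives Plancherel's theorem; comparing the identity for fixed \<open>e\<close> with Plancherel's theorem gives
the difference formula for the energy.\<close>
lemma fourier_gauss_regularised:
  fixes f g :: "'a::euclidean_space \<Rightarrow> complex"
  assumes f: "integrable lborel f" and g: "integrable lborel g" and e: "e > 0"
  shows "integrable lborel (\<lambda>\<xi>. cnj (fourier g \<xi>) * complex_of_real (exp (- e\<^sup>2 * (norm \<xi>)\<^sup>2 / 2)))"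
    "(LINT \<xi>|lborel. fourier f \<xi> * (cnj (fourier g \<xi>) * complex_of_real (exp (- e\<^sup>2 * (norm \<xi>)\<^sup>2 / 2))))
     = (LINT x|lborel. f x * cnj (gauss_average e g x))"
proof -
  let ?k = "\<lambda>\<xi>. cnj (fourier g \<xi>) * complex_of_real (exp (- e\<^sup>2 * (norm \<xi>)\<^sup>2 / 2))"
  let ?C = "(2 * pi) powr (- real DIM('a) / 2)"
  have [measurable]: "g \<in> borel_measurable borel" using g by (auto dest: borel_measurable_integrable)
  have [measurable]: "(\<lambda>x. cnj (fourier g x)) \<in> borel_measurable borel" by (rule borel_measurable_cnj) measurable
  show k: "integrable lborel ?k"
  proof (rule Bochner_Integration.integrable_bound)
    show "integrable lborel (\<lambda>\<xi>. complex_of_real (?C * (LINT x|lborel. norm (g x))) * wavepacket e 0 0 \<xi>)"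
      by (intro integrable_mult_right fourier_wavepacket(1) e)
    show "?k \<in> borel_measurable lborel" by measurable
    have "norm (?k \<xi>) \<le> norm (complex_of_real (?C * (LINT x|lborel. norm (g x))) * wavepacket e 0 0 \<xi>)" for \<xi>
    proof -
      have "norm (fourier g \<xi>) \<le> \<bar>?C * (LINT x|lborel. norm (g x))\<bar>"
        using norm_fourier_le[of g \<xi>] by (rule order_trans) (rule abs_ge_self)
      then show ?thesis
        unfolding norm_mult norm_wavepacket norm_of_real complex_mod_cnj by (intro mult_mono) auto
    qed
    then show "AE \<xi> in lborel. norm (?k \<xi>) \<le> norm (complex_of_real (?C * (LINT x|lborel. norm (g x))) * wavepacket e 0 0 \<xi>)"
      by simp
  qed
  have "fourier ?k x = cnj (gauss_average e g x)" for x
  proof -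
    have "fourier ?k x = complex_of_real ?C * cnj (LINT \<xi>|lborel. fourier g \<xi> * wavepacket e 0 x \<xi>)"
    proof -
      have "exp (- \<i> * complex_of_real (\<xi> \<bullet> x)) * ?k \<xi> = cnj (fourier g \<xi> * wavepacket e 0 x \<xi>)" for \<xi>
      proof -
        have "wavepacket e 0 x \<xi> = complex_of_real (exp (- e\<^sup>2 * (norm \<xi>)\<^sup>2 / 2)) * exp (\<i> * complex_of_real (\<xi> \<bullet> x))"
          unfolding wavepacket_def exp_add exp_of_real by (simp add: inner_commute)
        then show ?thesis by (simp add: exp_cnj)
      qed
      then show ?thesis unfolding fourier_def[of ?k] by (simp only: Bochner_Integration.integral_cnj)
    qed
    also have "(LINT \<xi>|lborel. fourier g \<xi> * wavepacket e 0 x \<xi>) = (LINT y|lborel. g y * fourier (wavepacket e 0 x) y)"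
      using fourier_multiplication_formula[OF g fourier_wavepacket(1)[OF e]] by simp
    also have "complex_of_real ?C * cnj \<dots> = cnj (LINT y|lborel. complex_of_real ?C * (g y * fourier (wavepacket e 0 x) y))"
      unfolding integral_mult_right_zero by simp
    also have "(\<lambda>y. complex_of_real ?C * (g y * fourier (wavepacket e 0 x) y))
      = (\<lambda>y. complex_of_real ((1/e) ^ DIM('a)) * (complex_of_real (gauss ((1/e) *\<^sub>R (y - x))) * g y))"
      unfolding fourier_wavepacket(2)[OF e] gauss_def of_real_mult by (intro ext) (simp only: ac_simps)
    also have "cnj (LINT y|lborel. complex_of_real ((1/e) ^ DIM('a)) * (complex_of_real (gauss ((1/e) *\<^sub>R (y - x))) * g y))
      = cnj (gauss_average e g x)"
      using e by (simp add: gauss_average_kernel)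
    finally show ?thesis .
  qed
  then show "(LINT \<xi>|lborel. fourier f \<xi> * ?k \<xi>) = (LINT x|lborel. f x * cnj (gauss_average e g x))"
    using fourier_multiplication_formula[OF f k] by simp
qed

interpretation lborel_gaussian: pair_sigma_finite "lborel :: 'a::euclidean_space measure" "gaussian :: 'a measure" ..

lemma nn_integral_translate:
  fixes k :: "'a::euclidean_space \<Rightarrow> ennreal"
  assumes [measurable]: "k \<in> borel_measurable borel"
  shows "(\<integral>\<^sup>+x. k (x + t) \<partial>lborel) = (\<integral>\<^sup>+x. k x \<partial>lborel)"
  using nn_integral_affine[of 1 k t] by (simp add: add.commute)

lemma nn_integral_gaussian_translate:
  fixes k :: "'a::euclidean_space \<Rightarrow> ennreal"
  assumes [measurable]: "k \<in> borel_measurable borel"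
  shows "(\<integral>\<^sup>+x. (\<integral>\<^sup>+h. k (x + e *\<^sub>R h) \<partial>gaussian) \<partial>lborel) = (\<integral>\<^sup>+x. k x \<partial>lborel)"
proof -
  have "(\<integral>\<^sup>+x. (\<integral>\<^sup>+h. k (x + e *\<^sub>R h) \<partial>gaussian) \<partial>lborel) = (\<integral>\<^sup>+h. (\<integral>\<^sup>+x. k (x + e *\<^sub>R h) \<partial>lborel) \<partial>(gaussian :: 'a measure))"
    by (rule lborel_gaussian.Fubini'[symmetric]) measurable
  also have "\<dots> = (\<integral>\<^sup>+x. k x \<partial>lborel)"
    using gaussian.emeasure_space_1[where 'a='a] by (simp add: nn_integral_translate)
  finally show ?thesis .
qed

lemma nn_integral_norm_sq:
  assumes "square_integrable M f"
  shows "(\<integral>\<^sup>+x. ennreal ((norm (f x))\<^sup>2) \<partial>M) = ennreal ((L2norm M f)\<^sup>2)"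
  using assms unfolding L2norm_sq square_integrable_def by (subst nn_integral_eq_integral) auto

lemma square_integrable_nnI:
  assumes [measurable]: "f \<in> borel_measurable M"
    and le: "(\<integral>\<^sup>+x. ennreal ((norm (f x))\<^sup>2) \<partial>M) \<le> ennreal (B\<^sup>2)" and B: "B \<ge> 0"
  shows "square_integrable M f" "L2norm M f \<le> B"
proof -
  have "(\<integral>\<^sup>+x. ennreal ((norm (f x))\<^sup>2) \<partial>M) < \<infinity>" using le by (simp add: le_less_trans)
  then show f: "square_integrable M f"
    unfolding square_integrable_def by (auto intro!: integrableI_nonneg)
  have "(L2norm M f)\<^sup>2 \<le> B\<^sup>2" using le unfolding nn_integral_norm_sq[OF f] by simp
  then show "L2norm M f \<le> B" using B by (rule power2_le_imp_le)
qed

text \<open>The Cauchy-Schwarz inequality for the Gaussian probability measure, combined with the translation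
invariance of Lebesgue measure.\<close>
lemma gauss_average_L2:
  fixes g :: "'a::euclidean_space \<Rightarrow> complex"
  assumes g: "square_integrable lborel g"
  shows "square_integrable lborel (gauss_average e g)" "L2norm lborel (gauss_average e g) \<le> L2norm lborel g"
proof -
  have [measurable]: "g \<in> borel_measurable borel" using g by (simp add: square_integrable_def)
  have pt: "ennreal ((norm (gauss_average e g x))\<^sup>2) \<le> (\<integral>\<^sup>+h. ennreal ((norm (g (x + e *\<^sub>R h)))\<^sup>2) \<partial>gaussian)" for x
  proof (cases "integrable gaussian (\<lambda>h. g (x + e *\<^sub>R h))")
    case True
    have "ennreal (norm (gauss_average e g x)) \<le> (\<integral>\<^sup>+h. ennreal (norm (g (x + e *\<^sub>R h))) * 1 \<partial>gaussian)"
      unfolding gauss_average_def using integral_norm_bound_ennreal[OF True] by simp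
    then have "(ennreal (norm (gauss_average e g x)))\<^sup>2 \<le> (\<integral>\<^sup>+h. ennreal (norm (g (x + e *\<^sub>R h))) * 1 \<partial>gaussian)\<^sup>2"
      by (rule power_mono) simp
    also have "\<dots> \<le> (\<integral>\<^sup>+h. (ennreal (norm (g (x + e *\<^sub>R h))))\<^sup>2 \<partial>gaussian) * (\<integral>\<^sup>+h. 1\<^sup>2 \<partial>(gaussian :: 'a measure))"
      by (rule Cauchy_Schwarz_nn_integral) measurable
    finally show ?thesis using gaussian.emeasure_space_1[where 'a='a] by (simp add: ennreal_power)
  next
    case False
    then show ?thesis by (simp add: gauss_average_def not_integrable_integral_eq)
  qed
  have "(\<integral>\<^sup>+x. ennreal ((norm (gauss_average e g x))\<^sup>2) \<partial>lborel) \<le> (\<integral>\<^sup>+x. (\<integral>\<^sup>+h. ennreal ((norm (g (x + e *\<^sub>R h)))\<^sup>2) \<partial>gaussian) \<partial>lborel)"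
    by (intro nn_integral_mono pt)
  also have "\<dots> = ennreal ((L2norm lborel g)\<^sup>2)"
    using nn_integral_gaussian_translate[of "\<lambda>x. ennreal ((norm (g x))\<^sup>2)" e] nn_integral_norm_sq[OF g] by simp
  finally have le: "(\<integral>\<^sup>+x. ennreal ((norm (gauss_average e g x))\<^sup>2) \<partial>lborel) \<le> ennreal ((L2norm lborel g)\<^sup>2)" .
  show "square_integrable lborel (gauss_average e g)" "L2norm lborel (gauss_average e g) \<le> L2norm lborel g"
    by (rule square_integrable_nnI[OF _ le]; simp)+
qed

text \<open>In the damped Parseval identity the right-hand side is at most the squared \<open>L\<^sup>2\<close> norm of \<open>f\<close>,
because averaging is a contraction; Fatou's lemma removes the damping. Having this inequality
first allows the identity to be extended from test functions by density.\<close>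
lemma fourier_L2_bound:
  fixes f :: "'a::euclidean_space \<Rightarrow> complex"
  assumes f: "integrable lborel f" and f2: "square_integrable lborel f"
  shows "square_integrable lborel (fourier f)" "L2norm lborel (fourier f) \<le> L2norm lborel f"
proof -
  have [measurable]: "f \<in> borel_measurable borel" using f2 by (simp add: square_integrable_def)
  let ?E = "\<lambda>n \<xi>. exp (- (1 / real (Suc n))\<^sup>2 * (norm \<xi>)\<^sup>2 / 2)"
  let ?u = "\<lambda>n \<xi>. (norm (fourier f \<xi>))\<^sup>2 * ?E n \<xi>"
  have u: "(\<integral>\<^sup>+\<xi>. ennreal (?u n \<xi>) \<partial>lborel) \<le> ennreal ((L2norm lborel f)\<^sup>2)" for n
  proof -
    define e where "e = 1 / real (Suc n)"
    have e: "e > 0" by (simp add: e_def)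
    obtain B where B: "\<And>\<xi>. norm (fourier f \<xi>) \<le> B" using norm_fourier_le by blast
    have eq: "fourier f \<xi> * (cnj (fourier f \<xi>) * complex_of_real (exp (- e\<^sup>2 * (norm \<xi>)\<^sup>2 / 2))) = complex_of_real (?u n \<xi>)" for \<xi>
      unfolding e_def by (simp add: mult.assoc[symmetric] complex_norm_square[symmetric])
    have "integrable lborel (\<lambda>\<xi>. fourier f \<xi> * (cnj (fourier f \<xi>) * complex_of_real (exp (- e\<^sup>2 * (norm \<xi>)\<^sup>2 / 2))))"
    proof (rule Bochner_Integration.integrable_bound)
      show "integrable lborel (\<lambda>\<xi>. complex_of_real B * (cnj (fourier f \<xi>) * complex_of_real (exp (- e\<^sup>2 * (norm \<xi>)\<^sup>2 / 2))))"
        by (intro integrable_mult_right fourier_gauss_regularised(1)[OF f f e])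
      show "(\<lambda>\<xi>. fourier f \<xi> * (cnj (fourier f \<xi>) * complex_of_real (exp (- e\<^sup>2 * (norm \<xi>)\<^sup>2 / 2)))) \<in> borel_measurable lborel"
        unfolding eq by measurable
      show "AE \<xi> in lborel. norm (fourier f \<xi> * (cnj (fourier f \<xi>) * complex_of_real (exp (- e\<^sup>2 * (norm \<xi>)\<^sup>2 / 2))))
         \<le> norm (complex_of_real B * (cnj (fourier f \<xi>) * complex_of_real (exp (- e\<^sup>2 * (norm \<xi>)\<^sup>2 / 2))))"
        unfolding norm_mult[of "fourier f _"] norm_mult[of "complex_of_real B"] norm_of_real[of B]
        by (intro AE_I2 mult_right_mono order_trans[OF B abs_ge_self]) simp
    qed
    then have i: "integrable lborel (?u n)" unfolding eq complex_of_real_integrable_eq .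
    have cr: "complex_of_real (LINT \<xi>|lborel. ?u n \<xi>) = (LINT x|lborel. f x * cnj (gauss_average e f x))"
      using fourier_gauss_regularised(2)[OF f f e] unfolding eq integral_complex_of_real .
    have "(LINT \<xi>|lborel. ?u n \<xi>) \<le> norm (LINT x|lborel. f x * cnj (gauss_average e f x))"
      by (subst cr[symmetric]) (simp only: norm_of_real abs_ge_self)
    also have "\<dots> \<le> L2norm lborel f * L2norm lborel (\<lambda>x. cnj (gauss_average e f x))"
      by (intro L2_Cauchy_Schwarz f2 square_integrable_cnj gauss_average_L2)
    also have "L2norm lborel (\<lambda>x. cnj (gauss_average e f x)) = L2norm lborel (gauss_average e f)" by (simp add: L2norm_def)
    also have "L2norm lborel f * \<dots> \<le> L2norm lborel f * L2norm lborel f"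
      by (intro mult_left_mono gauss_average_L2 f2) simp
    finally have "(LINT \<xi>|lborel. ?u n \<xi>) \<le> (L2norm lborel f)\<^sup>2" by (simp add: power2_eq_square)
    then show ?thesis using i by (subst nn_integral_eq_integral) (auto intro: ennreal_leI)
  qed
  have lim: "(\<lambda>n. ennreal (?u n \<xi>)) \<longlonglongrightarrow> ennreal ((norm (fourier f \<xi>))\<^sup>2)" for \<xi>
  proof -
    have "(\<lambda>n. ?u n \<xi>) \<longlonglongrightarrow> (norm (fourier f \<xi>))\<^sup>2 * exp (- 0\<^sup>2 * (norm \<xi>)\<^sup>2 / 2)"
      by (intro tendsto_intros LIMSEQ_Suc[OF lim_1_over_n]) simp
    then show ?thesis by (intro tendsto_ennrealI) simp
  qed
  have "(\<integral>\<^sup>+\<xi>. ennreal ((norm (fourier f \<xi>))\<^sup>2) \<partial>lborel) = (\<integral>\<^sup>+\<xi>. liminf (\<lambda>n. ennreal (?u n \<xi>)) \<partial>lborel)"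
    using lim_imp_Liminf[OF _ lim] by (simp cong: nn_integral_cong)
  also have "\<dots> \<le> liminf (\<lambda>n. \<integral>\<^sup>+\<xi>. ennreal (?u n \<xi>) \<partial>lborel)" by (rule nn_integral_liminf) measurable
  also have "\<dots> \<le> ennreal ((L2norm lborel f)\<^sup>2)"
    by (rule order_trans[OF Liminf_mono[where g="\<lambda>_. ennreal ((L2norm lborel f)\<^sup>2)"]]) (use u in \<open>auto simp: Liminf_const\<close>)
  finally have le: "(\<integral>\<^sup>+\<xi>. ennreal ((norm (fourier f \<xi>))\<^sup>2) \<partial>lborel) \<le> ennreal ((L2norm lborel f)\<^sup>2)" .
  show "square_integrable lborel (fourier f)" "L2norm lborel (fourier f) \<le> L2norm lborel f"
    by (rule square_integrable_nnI[OF _ le]; simp)+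
qed

lemma plancherel_test:
  fixes f g :: "'a::euclidean_space \<Rightarrow> complex"
  assumes f: "integrable lborel f" and f2: "square_integrable lborel f" and g: "test_function g"
  shows "(LINT \<xi>|lborel. fourier f \<xi> * cnj (fourier g \<xi>)) = (LINT x|lborel. f x * cnj (g x))"
proof -
  have gi: "integrable lborel g" and gc: "continuous_on UNIV g" using g by (auto simp: test_function_def)
  have g2: "square_integrable lborel g" using g by (rule test_function_square_integrable)
  obtain B where B: "\<And>x. norm (g x) \<le> B" using g by (auto simp: test_function_def bounded_iff)
  have [measurable]: "f \<in> borel_measurable borel" "g \<in> borel_measurable borel"
    using f2 g2 by (auto simp: square_integrable_def)
  let ?E = "\<lambda>n \<xi>. complex_of_real (exp (- (1 / real (Suc n))\<^sup>2 * (norm \<xi>)\<^sup>2 / 2))"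
  have Fi: "integrable lborel (\<lambda>\<xi>. fourier f \<xi> * cnj (fourier g \<xi>))"
    by (intro square_integrable_mult square_integrable_cnj fourier_L2_bound f f2 gi g2)
  have [measurable]: "(\<lambda>\<xi>. cnj (fourier g \<xi>)) \<in> borel_measurable borel" "(\<lambda>x. cnj (g x)) \<in> borel_measurable borel"
     "(\<lambda>x. cnj (gauss_average e g x)) \<in> borel_measurable borel" for e
    by (rule borel_measurable_cnj; measurable)+
  have 1: "(\<lambda>n. LINT \<xi>|lborel. fourier f \<xi> * (cnj (fourier g \<xi>) * ?E n \<xi>)) \<longlonglongrightarrow> (LINT \<xi>|lborel. fourier f \<xi> * cnj (fourier g \<xi>))"
  proof (rule integral_dominated_convergence[where w="\<lambda>\<xi>. norm (fourier f \<xi> * cnj (fourier g \<xi>))"])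
    show "AE \<xi> in lborel. (\<lambda>n. fourier f \<xi> * (cnj (fourier g \<xi>) * ?E n \<xi>)) \<longlonglongrightarrow> fourier f \<xi> * cnj (fourier g \<xi>)"
    proof (rule AE_I2)
      fix \<xi>
      have "(\<lambda>n. fourier f \<xi> * (cnj (fourier g \<xi>) * ?E n \<xi>)) \<longlonglongrightarrow> fourier f \<xi> * (cnj (fourier g \<xi>) * complex_of_real (exp (- 0\<^sup>2 * (norm \<xi>)\<^sup>2 / 2)))"
        by (intro tendsto_intros LIMSEQ_Suc[OF lim_1_over_n]) simp
      then show "(\<lambda>n. fourier f \<xi> * (cnj (fourier g \<xi>) * ?E n \<xi>)) \<longlonglongrightarrow> fourier f \<xi> * cnj (fourier g \<xi>)" by simp
    qed
    show "integrable lborel (\<lambda>\<xi>. norm (fourier f \<xi> * cnj (fourier g \<xi>)))" using Fi by (rule integrable_norm)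
    show "AE \<xi> in lborel. norm (fourier f \<xi> * (cnj (fourier g \<xi>) * ?E n \<xi>)) \<le> norm (fourier f \<xi> * cnj (fourier g \<xi>))" for n
      by (intro AE_I2) (simp add: norm_mult mult.assoc[symmetric] mult_left_le)
  qed measurable
  have 2: "(\<lambda>n. LINT x|lborel. f x * cnj (gauss_average (1 / real (Suc n)) g x)) \<longlonglongrightarrow> (LINT x|lborel. f x * cnj (g x))"
  proof (rule integral_dominated_convergence[where w="\<lambda>x. norm (f x) * B"])
    show "AE x in lborel. (\<lambda>n. f x * cnj (gauss_average (1 / real (Suc n)) g x)) \<longlonglongrightarrow> f x * cnj (g x)"
      by (intro AE_I2 tendsto_mult tendsto_const tendsto_cnj gauss_average_tendsto[OF gc B])
    show "integrable lborel (\<lambda>x. norm (f x) * B)" using f by simp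
    show "AE x in lborel. norm (f x * cnj (gauss_average (1 / real (Suc n)) g x)) \<le> norm (f x) * B" for n
      unfolding norm_mult complex_mod_cnj by (intro AE_I2 mult_left_mono norm_gauss_average_le B) auto
  qed measurable
  have "(LINT \<xi>|lborel. fourier f \<xi> * (cnj (fourier g \<xi>) * ?E n \<xi>)) = (LINT x|lborel. f x * cnj (gauss_average (1 / real (Suc n)) g x))" for n
    by (rule fourier_gauss_regularised(2)[OF f gi]) simp
  with 1 2 show ?thesis by (simp only: LIMSEQ_unique)
qed

lemma test_function_sequence:
  fixes f :: "'a::euclidean_space \<Rightarrow> complex"
  assumes f: "square_integrable lborel f"
  shows "\<exists>g. (\<forall>n. test_function (g n)) \<and> L2_tendsto lborel g f \<and> (\<forall>n. L2norm lborel (\<lambda>x. g n x - f x) \<le> (1/2) ^ n)"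
proof -
  have "\<forall>n. \<exists>g. test_function g \<and> L2norm lborel (\<lambda>x. g x - f x) < (1/2) ^ n"
    by (intro allI L2_approx_test f) simp
  from choice[OF this] obtain g where
    "\<forall>n. test_function (g n) \<and> L2norm lborel (\<lambda>x. g n x - f x) < (1/2) ^ n" by (rule exE)
  then have g: "test_function (g n)" "L2norm lborel (\<lambda>x. g n x - f x) \<le> (1/2) ^ n" for n
    by (simp_all add: less_imp_le)
  have "(\<lambda>n. L2norm lborel (\<lambda>x. g n x - f x)) \<longlonglongrightarrow> 0"
    by (rule Lim_null_comparison[OF _ LIMSEQ_power_zero[of "1/2::real"]]) (simp_all add: g(2))
  then have "L2_tendsto lborel g f"
    unfolding L2_tendsto_def by (intro conjI allI f test_function_square_integrable g(1))
  then show ?thesis using g by (intro exI[of _ g] conjI allI)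
qed

lemma L2_tendsto_fourier:
  fixes g :: "'a::euclidean_space \<Rightarrow> complex"
  assumes g: "integrable lborel g" "L2_tendsto lborel G g" and G: "\<And>n. integrable lborel (G n)"
  shows "L2_tendsto lborel (\<lambda>n. fourier (G n)) (fourier g)"
proof -
  have g2: "square_integrable lborel g" "\<And>n. square_integrable lborel (G n)" "(\<lambda>n. L2norm lborel (\<lambda>x. G n x - g x)) \<longlonglongrightarrow> 0"
    using g(2) by (auto simp: L2_tendsto_def)
  have "L2norm lborel (\<lambda>x. fourier (G n) x - fourier g x) \<le> L2norm lborel (\<lambda>x. G n x - g x)" for n
    using fourier_L2_bound(2)[of "\<lambda>x. G n x - g x"] g G g2 by (simp add: fourier_diff[symmetric] square_integrable_diff)
  then have "(\<lambda>n. L2norm lborel (\<lambda>x. fourier (G n) x - fourier g x)) \<longlonglongrightarrow> 0"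
    by (intro Lim_null_comparison[OF _ g2(3)]) auto
  then show ?thesis unfolding L2_tendsto_def by (intro conjI allI fourier_L2_bound(1) g(1) G g2)
qed

lemma plancherel:
  fixes f g :: "'a::euclidean_space \<Rightarrow> complex"
  assumes f: "integrable lborel f" "square_integrable lborel f" and g: "integrable lborel g" "square_integrable lborel g"
  shows "(LINT \<xi>|lborel. fourier f \<xi> * cnj (fourier g \<xi>)) = (LINT x|lborel. f x * cnj (g x))"
proof -
  from test_function_sequence[OF g(2)] obtain G where "\<forall>n. test_function (G n)" and G2: "L2_tendsto lborel G g"
    by (elim exE conjE)
  then have G: "test_function (G n)" "L2_tendsto lborel G g" for n by simp_all
  have Gi: "integrable lborel (G n)" for n using G(1) by (auto simp: test_function_def)
  have "(\<lambda>n. LINT \<xi>|lborel. fourier f \<xi> * cnj (fourier (G n) \<xi>)) \<longlonglongrightarrow> (LINT \<xi>|lborel. fourier f \<xi> * cnj (fourier g \<xi>))"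
    by (intro L2_tendsto_integral_mult L2_tendsto_const fourier_L2_bound f L2_tendsto_cnj L2_tendsto_fourier g G Gi)
  moreover have "(\<lambda>n. LINT x|lborel. f x * cnj (G n x)) \<longlonglongrightarrow> (LINT x|lborel. f x * cnj (g x))"
    by (intro L2_tendsto_integral_mult L2_tendsto_const f L2_tendsto_cnj G)
  ultimately show ?thesis by (simp only: plancherel_test[OF f G(1)] LIMSEQ_unique)
qed

lemma plancherel_norm:
  fixes f :: "'a::euclidean_space \<Rightarrow> complex"
  assumes f: "integrable lborel f" "square_integrable lborel f"
  shows "L2norm lborel (fourier f) = L2norm lborel f"
proof -
  have "(L2norm lborel (fourier f))\<^sup>2 = (L2norm lborel f)\<^sup>2"
    using plancherel[OF f f] unfolding integral_mult_cnj_self of_real_eq_iff .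
  then show ?thesis by (simp add: power2_eq_iff_nonneg)
qed

text \<open>A geometric rate makes the increments
summable almost everywhere, and Fatou's lemma turns the pointwise limit into an \<open>L\<^sup>2\<close> limit.\<close>
lemma L2_fast_Cauchy_limit:
  fixes F :: "nat \<Rightarrow> 'a \<Rightarrow> complex"
  assumes F: "\<And>n. square_integrable M (F n)"
    and d: "\<And>m n. n \<le> m \<Longrightarrow> L2norm M (\<lambda>x. F m x - F n x) \<le> K * (1/2) ^ n"
  shows "\<exists>f. L2_tendsto M F f"
proof -
  have [measurable]: "F n \<in> borel_measurable M" for n using F by (simp add: square_integrable_def)
  have K: "K \<ge> 0" using d[of 0 0] by (simp add: L2norm_def)
  let ?d = "\<lambda>n x. F (Suc n) x - F n x"
  have sq: "square_integrable M (?d n)" for n by (intro square_integrable_diff F)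
  have "(\<integral>\<^sup>+x. (\<Sum>n. ennreal (2 ^ n * (norm (?d n x))\<^sup>2)) \<partial>M) = (\<Sum>n. \<integral>\<^sup>+x. ennreal (2 ^ n * (norm (?d n x))\<^sup>2) \<partial>M)"
    by (rule nn_integral_suminf) measurable
  also have "\<dots> \<le> (\<Sum>n. ennreal (K\<^sup>2 * (1/2) ^ n))"
  proof (intro suminf_le allI summableI)
    fix n
    have "(\<integral>\<^sup>+x. ennreal (2 ^ n * (norm (?d n x))\<^sup>2) \<partial>M) = ennreal (2 ^ n) * (\<integral>\<^sup>+x. ennreal ((norm (?d n x))\<^sup>2) \<partial>M)"
      by (simp add: ennreal_mult nn_integral_cmult)
    also have "\<dots> = ennreal (2 ^ n * (L2norm M (?d n))\<^sup>2)"
      unfolding nn_integral_norm_sq[OF sq] by (simp add: ennreal_mult)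
    also have "\<dots> \<le> ennreal (K\<^sup>2 * (1/2) ^ n)"
    proof (rule ennreal_leI)
      have "(L2norm M (?d n))\<^sup>2 \<le> (K * (1/2) ^ n)\<^sup>2" by (intro power_mono d) auto
      then have "2 ^ n * (L2norm M (?d n))\<^sup>2 \<le> 2 ^ n * (K * (1/2) ^ n)\<^sup>2" by simp
      also have "\<dots> = K\<^sup>2 * (1/2) ^ n" by (simp add: power2_eq_square power_one_over field_simps)
      finally show "2 ^ n * (L2norm M (?d n))\<^sup>2 \<le> K\<^sup>2 * (1/2) ^ n" .
    qed
    finally show "(\<integral>\<^sup>+x. ennreal (2 ^ n * (norm (?d n x))\<^sup>2) \<partial>M) \<le> ennreal (K\<^sup>2 * (1/2) ^ n)" .
  qed
  also have "\<dots> = ennreal (\<Sum>n. K\<^sup>2 * (1/2) ^ n)"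
    by (intro suminf_ennreal2 summable_mult summable_geometric) auto
  also have "\<dots> < \<infinity>" by simp
  finally have "AE x in M. (\<Sum>n. ennreal (2 ^ n * (norm (?d n x))\<^sup>2)) \<noteq> \<infinity>"
    by (intro nn_integral_noteq_infinite) auto
  then have conv: "AE x in M. convergent (\<lambda>n. F n x)"
  proof eventually_elim
    case (elim x)
    have "summable (\<lambda>n. 2 ^ n * (norm (?d n x))\<^sup>2)"
      using elim by (intro summable_suminf_not_top) auto
    moreover have "summable (\<lambda>n. (1/2::real) ^ n)" by (rule summable_geometric) simp
    ultimately have "summable (\<lambda>n. 2 ^ n * (norm (?d n x))\<^sup>2 + (1/2) ^ n)" by (rule summable_add)
    then have "summable (\<lambda>n. ?d n x)"
    proof (rule summable_comparison_test')
      fix n :: nat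
      \<comment> \<open>the weighted squares dominate the increments themselves, by the inequality of the means\<close>
      have "0 \<le> 2 ^ n * (norm (?d n x) - (1/2) ^ n)\<^sup>2" by simp
      also have "\<dots> = 2 ^ n * (norm (?d n x))\<^sup>2 + (1/2) ^ n - 2 * norm (?d n x)"
        by (simp add: power2_eq_square power_one_over field_simps)
      finally show "norm (?d n x) \<le> 2 ^ n * (norm (?d n x))\<^sup>2 + (1/2) ^ n"
        using norm_ge_zero[of "?d n x"] by linarith
    qed
    then have "(\<lambda>n. (\<Sum>i<n. ?d i x) + F 0 x) \<longlonglongrightarrow> (\<Sum>n. ?d n x) + F 0 x"
      by (intro tendsto_add tendsto_const summable_LIMSEQ)
    then show ?case using sum_lessThan_telescope[of "\<lambda>i. F i x"] by (auto simp: convergent_def)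
  qed
  define f where "f = (\<lambda>x. lim (\<lambda>n. F n x))"
  have [measurable]: "f \<in> borel_measurable M" unfolding f_def by measurable
  have lim: "AE x in M. (\<lambda>n. F n x) \<longlonglongrightarrow> f x"
    using conv by eventually_elim (simp add: f_def convergent_LIMSEQ_iff)
  have nn: "(\<integral>\<^sup>+x. ennreal ((norm (F n x - f x))\<^sup>2) \<partial>M) \<le> ennreal ((K * (1/2) ^ n)\<^sup>2)" for n
  proof -
    have "(\<integral>\<^sup>+x. ennreal ((norm (F n x - f x))\<^sup>2) \<partial>M) = (\<integral>\<^sup>+x. liminf (\<lambda>m. ennreal ((norm (F n x - F m x))\<^sup>2)) \<partial>M)"
    proof (rule nn_integral_cong_AE)
      show "AE x in M. ennreal ((norm (F n x - f x))\<^sup>2) = liminf (\<lambda>m. ennreal ((norm (F n x - F m x))\<^sup>2))"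
        using lim
      proof eventually_elim
        case (elim x)
        have "(\<lambda>m. ennreal ((norm (F n x - F m x))\<^sup>2)) \<longlonglongrightarrow> ennreal ((norm (F n x - f x))\<^sup>2)"
          by (intro tendsto_ennrealI tendsto_intros elim)
        then show ?case by (intro lim_imp_Liminf[symmetric]) auto
      qed
    qed
    also have "\<dots> \<le> liminf (\<lambda>m. \<integral>\<^sup>+x. ennreal ((norm (F n x - F m x))\<^sup>2) \<partial>M)"
      by (rule nn_integral_liminf) measurable
    also have "\<dots> \<le> liminf (\<lambda>m. ennreal ((K * (1/2) ^ n)\<^sup>2))"
    proof (rule Liminf_mono)
      show "\<forall>\<^sub>F m in sequentially. (\<integral>\<^sup>+x. ennreal ((norm (F n x - F m x))\<^sup>2) \<partial>M) \<le> ennreal ((K * (1/2) ^ n)\<^sup>2)"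
        using eventually_ge_at_top[of n]
      proof eventually_elim
        case (elim m)
        have "L2norm M (\<lambda>x. F n x - F m x) \<le> K * (1/2) ^ n"
          using d[OF elim] by (simp only: L2norm_minus_commute[of M "F n" "F m"])
        then show ?case unfolding nn_integral_norm_sq[OF square_integrable_diff[OF F F]]
          by (intro ennreal_leI power_mono) auto
      qed
    qed
    also have "\<dots> = ennreal ((K * (1/2) ^ n)\<^sup>2)" by (simp add: Liminf_const)
    finally show ?thesis .
  qed
  have sd: "square_integrable M (\<lambda>x. F n x - f x)" "L2norm M (\<lambda>x. F n x - f x) \<le> K * (1/2) ^ n" for n
    using K by (intro square_integrable_nnI[OF _ nn]; simp)+
  have "square_integrable M f"
    using square_integrable_diff[OF F sd(1), of 0 0] by simp
  moreover have "(\<lambda>n. L2norm M (\<lambda>x. F n x - f x)) \<longlonglongrightarrow> 0"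
  proof (rule Lim_null_comparison)
    show "\<forall>\<^sub>F n in sequentially. norm (L2norm M (\<lambda>x. F n x - f x)) \<le> K * (1/2) ^ n" using sd(2) by simp
    show "(\<lambda>n. K * (1/2::real) ^ n) \<longlonglongrightarrow> 0" by (intro tendsto_mult_right_zero LIMSEQ_power_zero) simp
  qed
  ultimately show ?thesis unfolding L2_tendsto_def using F by blast
qed

section \<open>The Fourier transform on square-integrable functions\<close>

text \<open>The Plancherel extension of the Fourier transform, presented as a relation. Keeping the
approximating test functions in the definition lets every quadratic identity be passed to the
limit.\<close>
definition L2_fourier_pair :: "('a::euclidean_space \<Rightarrow> complex) \<Rightarrow> ('a \<Rightarrow> complex) \<Rightarrow> bool"
  where "L2_fourier_pair f g \<longleftrightarrow> (\<exists>G. (\<forall>n. test_function (G n)) \<and>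
     L2_tendsto lborel G f \<and> L2_tendsto lborel (\<lambda>n. fourier (G n)) g)"

lemma test_function_integrable: "test_function g \<Longrightarrow> integrable lborel g"
  by (simp add: test_function_def)

lemma L2_fourier_pair_square_integrable:
  "L2_fourier_pair f g \<Longrightarrow> square_integrable lborel f" "L2_fourier_pair f g \<Longrightarrow> square_integrable lborel g"
  by (auto simp: L2_fourier_pair_def L2_tendsto_def)

lemma L2_fourier_pair_exists:
  fixes f :: "'a::euclidean_space \<Rightarrow> complex"
  assumes f: "square_integrable lborel f"
  shows "\<exists>g. L2_fourier_pair f g"
proof -
  from test_function_sequence[OF f] obtain G where "\<forall>n. test_function (G n)" and Gf: "L2_tendsto lborel G f"
    and "\<forall>n. L2norm lborel (\<lambda>x. G n x - f x) \<le> (1/2) ^ n"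
    by (elim exE conjE)
  then have G: "test_function (G n)" and Gd: "L2norm lborel (\<lambda>x. G n x - f x) \<le> (1/2) ^ n" for n by simp_all
  note Gi = test_function_integrable[OF G] and G2 = test_function_square_integrable[OF G]
  have "\<exists>g. L2_tendsto lborel (\<lambda>n. fourier (G n)) g"
  proof (rule L2_fast_Cauchy_limit[where K=2])
    show "square_integrable lborel (fourier (G n))" for n by (rule fourier_L2_bound(1)[OF Gi G2])
    fix m n :: nat
    assume "n \<le> m"
    have "L2norm lborel (\<lambda>x. fourier (G m) x - fourier (G n) x) = L2norm lborel (fourier (\<lambda>x. G m x - G n x))"
      unfolding L2norm_def fourier_diff[OF Gi Gi] ..
    also have "\<dots> \<le> L2norm lborel (\<lambda>x. G m x - G n x)"
      by (intro fourier_L2_bound(2) Bochner_Integration.integrable_diff Gi square_integrable_diff G2)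
    also have "\<dots> \<le> L2norm lborel (\<lambda>x. G m x - f x) + L2norm lborel (\<lambda>x. f x - G n x)"
      by (rule L2norm_triangle_diff[OF G2 f G2])
    also have "\<dots> \<le> (1/2) ^ m + (1/2) ^ n"
      using Gd[of m] Gd[of n] by (simp only: L2norm_minus_commute[of lborel f "G n"] add_mono)
    also have "\<dots> \<le> 2 * (1/2) ^ n"
      using power_decreasing[OF \<open>n \<le> m\<close>, of "1/2::real"] by simp
    finally show "L2norm lborel (\<lambda>x. fourier (G m) x - fourier (G n) x) \<le> 2 * (1/2) ^ n" .
  qed
  then show ?thesis unfolding L2_fourier_pair_def using G Gf by blast
qed

lemma L2_fourier_pair_norm:
  assumes "L2_fourier_pair f g"
  shows "L2norm lborel g = L2norm lborel f"
proof -
  obtain G where G: "\<And>n. test_function (G n)" "L2_tendsto lborel G f" "L2_tendsto lborel (\<lambda>n. fourier (G n)) g"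
    using assms by (auto simp: L2_fourier_pair_def)
  have "(L2norm lborel (fourier (G n)))\<^sup>2 = (L2norm lborel (G n))\<^sup>2" for n
    using plancherel_norm[OF test_function_integrable[OF G(1)] test_function_square_integrable[OF G(1)]] by simp
  then have "(L2norm lborel g)\<^sup>2 = (L2norm lborel f)\<^sup>2"
    using LIMSEQ_unique[OF L2_tendsto_norm[OF G(3)]] L2_tendsto_norm[OF G(2)] by simp
  then show ?thesis by (simp add: power2_eq_iff_nonneg)
qed

lemma L2_fourier_pair_multiplication:
  assumes "L2_fourier_pair f g" and \<psi>: "integrable lborel \<psi>" "square_integrable lborel \<psi>"
  shows "(LINT x|lborel. f x * fourier \<psi> x) = (LINT \<xi>|lborel. g \<xi> * \<psi> \<xi>)"
proof -
  obtain G where G: "\<And>n. test_function (G n)" "L2_tendsto lborel G f" "L2_tendsto lborel (\<lambda>n. fourier (G n)) g"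
    using assms(1) by (auto simp: L2_fourier_pair_def)
  have "(\<lambda>n. LINT x|lborel. G n x * fourier \<psi> x) \<longlonglongrightarrow> (LINT x|lborel. f x * fourier \<psi> x)"
    by (intro L2_tendsto_integral_mult L2_tendsto_const fourier_L2_bound \<psi> G)
  moreover have "(\<lambda>n. LINT x|lborel. fourier (G n) x * \<psi> x) \<longlonglongrightarrow> (LINT x|lborel. g x * \<psi> x)"
    by (intro L2_tendsto_integral_mult L2_tendsto_const \<psi> G)
  ultimately show ?thesis
    by (simp only: fourier_multiplication_formula[OF test_function_integrable[OF G(1)] \<psi>(1)] LIMSEQ_unique)
qed

text \<open>The inverse transform is the conjugate of the transform of the conjugate. Its pairing
with the transform of \<open>\<psi>\<close> is therefore a Parseval identity for \<open>\<psi>\<close> and the conjugate of \<open>g\<close>.\<close>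
lemma L2_fourier_pair_inverse:
  assumes "L2_fourier_pair (\<lambda>x. cnj (g x)) h" and \<psi>: "integrable lborel \<psi>" "square_integrable lborel \<psi>"
  shows "(LINT x|lborel. cnj (h x) * fourier \<psi> x) = (LINT \<xi>|lborel. g \<xi> * \<psi> \<xi>)"
proof -
  obtain G where G: "\<And>n. test_function (G n)" "L2_tendsto lborel G (\<lambda>x. cnj (g x))" "L2_tendsto lborel (\<lambda>n. fourier (G n)) h"
    using assms(1) by (auto simp: L2_fourier_pair_def)
  have "(\<lambda>n. LINT x|lborel. fourier \<psi> x * cnj (fourier (G n) x)) \<longlonglongrightarrow> (LINT x|lborel. fourier \<psi> x * cnj (h x))"
    by (intro L2_tendsto_integral_mult L2_tendsto_const fourier_L2_bound \<psi> G L2_tendsto_cnj)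
  moreover have "(\<lambda>n. LINT x|lborel. \<psi> x * cnj (G n x)) \<longlonglongrightarrow> (LINT x|lborel. \<psi> x * cnj (cnj (g x)))"
    by (intro L2_tendsto_integral_mult L2_tendsto_const \<psi> G L2_tendsto_cnj)
  ultimately have "(LINT x|lborel. fourier \<psi> x * cnj (h x)) = (LINT x|lborel. \<psi> x * cnj (cnj (g x)))"
    by (simp only: plancherel[OF \<psi> test_function_integrable[OF G(1)] test_function_square_integrable[OF G(1)]] LIMSEQ_unique)
  then show ?thesis by (simp add: mult.commute)
qed

lemma schwartz_square_integrable: "schwartz \<psi> \<Longrightarrow> square_integrable lborel \<psi>"
  using schwartz_bounded schwartz_integrable integrable_bounded_imp_square_integrable by blast

lemma L2_fourier_pair_has_fourier:
  assumes "L2_fourier_pair f g"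
  shows "has_fourier f g"
  unfolding has_fourier_def
proof (intro conjI allI impI)
  note fg = L2_fourier_pair_square_integrable[OF assms]
  show "f \<in> borel_measurable lborel" "g \<in> borel_measurable lborel" using fg by (auto simp: square_integrable_def)
  fix \<psi> :: "'a \<Rightarrow> complex"
  assume "schwartz \<psi>"
  note \<psi> = schwartz_integrable[OF this] schwartz_square_integrable[OF this]
  show "integrable lborel (\<lambda>x. f x * fourier \<psi> x)" "integrable lborel (\<lambda>\<xi>. g \<xi> * \<psi> \<xi>)"
    by (intro square_integrable_mult fg \<psi> fourier_L2_bound)+
  show "(LINT x|lborel. f x * fourier \<psi> x) = (LINT \<xi>|lborel. g \<xi> * \<psi> \<xi>)"
    by (rule L2_fourier_pair_multiplication[OF assms \<psi>])
qed

text \<open>The source of the functions from which \<open>frac_laplacian\<close> chooses.\<close>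
lemma has_fourier_inverse_exists:
  assumes g: "square_integrable lborel g"
  shows "\<exists>w. square_integrable lborel w \<and> has_fourier w g \<and> L2norm lborel w = L2norm lborel g"
proof -
  obtain h where h: "L2_fourier_pair (\<lambda>x. cnj (g x)) h"
    using L2_fourier_pair_exists[OF square_integrable_cnj[OF g]] by (rule exE)
  note h2 = L2_fourier_pair_square_integrable(2)[OF h]
  note w2 = square_integrable_cnj[OF h2]
  have "has_fourier (\<lambda>x. cnj (h x)) g"
    unfolding has_fourier_def
  proof (intro conjI allI impI)
    show "(\<lambda>x. cnj (h x)) \<in> borel_measurable lborel" "g \<in> borel_measurable lborel" using w2 g by (auto simp: square_integrable_def)
    fix \<psi> :: "'a \<Rightarrow> complex"
    assume "schwartz \<psi>"
    note \<psi> = schwartz_integrable[OF this] schwartz_square_integrable[OF this]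
    show "integrable lborel (\<lambda>x. cnj (h x) * fourier \<psi> x)" "integrable lborel (\<lambda>\<xi>. g \<xi> * \<psi> \<xi>)"
      by (intro square_integrable_mult w2 g \<psi> fourier_L2_bound)+
    show "(LINT x|lborel. cnj (h x) * fourier \<psi> x) = (LINT \<xi>|lborel. g \<xi> * \<psi> \<xi>)"
      by (rule L2_fourier_pair_inverse[OF h \<psi>])
  qed
  moreover have "L2norm lborel (\<lambda>x. cnj (h x)) = L2norm lborel g"
    using L2_fourier_pair_norm[OF h] by (simp add: L2norm_def)
  ultimately show ?thesis using w2 by blast
qed

section \<open>Uniqueness and reality of distributional Fourier transforms\<close>

lemma wavepacket_split:
  "wavepacket e c a x = complex_of_real (exp (- e\<^sup>2 * (norm (x - c))\<^sup>2 / 2)) * exp (\<i> * complex_of_real (a \<bullet> x))"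
  unfolding wavepacket_def exp_add exp_of_real ..

lemma gauss_eq_wavepacket:
  fixes a x :: "'a::euclidean_space"
  shows "complex_of_real (gauss ((1/e) *\<^sub>R (x - a))) = complex_of_real ((2 * pi) powr (- real DIM('a) / 2)) * wavepacket (1/e) a 0 x"
proof -
  have "(norm ((1/e) *\<^sub>R (x - a)))\<^sup>2 = (1/e)\<^sup>2 * (norm (x - a))\<^sup>2" by (simp add: power_divide)
  then show ?thesis by (simp add: gauss_def wavepacket_split)
qed

lemma gauss_eq_fourier_wavepacket:
  fixes a x :: "'a::euclidean_space"
  assumes "e > 0"
  shows "complex_of_real (gauss ((1/e) *\<^sub>R (x - a))) = complex_of_real ((2 * pi) powr (- real DIM('a) / 2) * e ^ DIM('a)) * fourier (wavepacket e 0 a) x"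
proof -
  have "e ^ DIM('a) * (1/e) ^ DIM('a) = 1" using assms by (simp add: power_mult_distrib[symmetric])
  then have "(2 * pi) powr (- real DIM('a) / 2) * e ^ DIM('a) * ((1/e) ^ DIM('a) * exp (- (norm ((1/e) *\<^sub>R (x - a)))\<^sup>2 / 2)) = gauss ((1/e) *\<^sub>R (x - a))"
    unfolding gauss_def by (metis (no_types) mult.assoc mult.right_neutral)
  then show ?thesis unfolding fourier_wavepacket(2)[OF assms] of_real_mult[symmetric] by (rule arg_cong[symmetric])
qed

text \<open>The separation property in the form in which Schwartz functions supply it: \<open>k\<close> is a family of
wave packets or of their transforms, which are Gaussians up to normalisation.\<close>
lemma scaled_gauss_test_imp_AE_eq:
  fixes f f' :: "'a::euclidean_space \<Rightarrow> complex" and k :: "real \<Rightarrow> 'a \<Rightarrow> 'a \<Rightarrow> complex"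
  assumes k: "\<And>e a x. e > 0 \<Longrightarrow> complex_of_real (gauss ((1/e) *\<^sub>R (x - a))) = C e * k e a x"
    and i: "\<And>e a. e > 0 \<Longrightarrow> integrable lborel (\<lambda>x. f x * k e a x)" "\<And>e a. e > 0 \<Longrightarrow> integrable lborel (\<lambda>x. f' x * k e a x)"
    and eq: "\<And>e a. e > 0 \<Longrightarrow> (LINT x|lborel. f x * k e a x) = (LINT x|lborel. f' x * k e a x)"
  shows "AE x in lborel. f x = f' x"
proof -
  have "AE x in lborel. f x - f' x = 0"
  proof (rule gauss_test_imp_AE_zero)
    fix e :: real and a :: 'a
    assume e: "e > 0"
    have *: "(f x - f' x) * complex_of_real (gauss ((1/e) *\<^sub>R (x - a))) = C e * (f x * k e a x - f' x * k e a x)" for x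
      unfolding k[OF e] by (simp only: left_diff_distrib right_diff_distrib mult.left_commute)
    show "integrable lborel (\<lambda>x. (f x - f' x) * complex_of_real (gauss ((1/e) *\<^sub>R (x - a))))"
      unfolding * by (intro integrable_mult_right Bochner_Integration.integrable_diff i e)
    show "(LINT x|lborel. (f x - f' x) * complex_of_real (gauss ((1/e) *\<^sub>R (x - a)))) = 0"
      unfolding * using i[OF e] eq[OF e] by (subst integral_mult_right_zero) simp
  qed
  then show ?thesis by simp
qed

text \<open>The Schwartz functions include all Gaussians, and Gaussians separate functions.\<close>
lemma has_fourier_unique:
  assumes "has_fourier f g" "has_fourier f g'"
  shows "AE \<xi> in lborel. g \<xi> = g' \<xi>"
proof (rule scaled_gauss_test_imp_AE_eq[OF gauss_eq_wavepacket])
  fix e :: real and a :: 'a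
  assume "e > 0"
  then have "schwartz (wavepacket (1/e) a (0::'a))" by (intro schwartz_wavepacket) simp
  then show "integrable lborel (\<lambda>\<xi>. g \<xi> * wavepacket (1/e) a 0 \<xi>)" "integrable lborel (\<lambda>\<xi>. g' \<xi> * wavepacket (1/e) a 0 \<xi>)"
    "(LINT \<xi>|lborel. g \<xi> * wavepacket (1/e) a 0 \<xi>) = (LINT \<xi>|lborel. g' \<xi> * wavepacket (1/e) a 0 \<xi>)"
    using assms unfolding has_fourier_def by auto
qed

text \<open>The transforms of the modulated Gaussians are all the translated Gaussians, which again separate
functions.\<close>
lemma has_fourier_inverse_unique:
  assumes "has_fourier f g" "has_fourier f' g"
  shows "AE x in lborel. f x = f' x"
proof (rule scaled_gauss_test_imp_AE_eq[OF gauss_eq_fourier_wavepacket])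
  fix e :: real and a :: 'a
  assume "e > 0"
  then have "schwartz (wavepacket e (0::'a) a)" by (rule schwartz_wavepacket)
  then show "integrable lborel (\<lambda>x. f x * fourier (wavepacket e 0 a) x)" "integrable lborel (\<lambda>x. f' x * fourier (wavepacket e 0 a) x)"
    "(LINT x|lborel. f x * fourier (wavepacket e 0 a) x) = (LINT x|lborel. f' x * fourier (wavepacket e 0 a) x)"
    using assms unfolding has_fourier_def by auto
qed

lemma has_fourier_cong_AE:
  assumes fg: "has_fourier f g" and f': "AE x in lborel. f x = f' x" "f' \<in> borel_measurable lborel"
    and g': "AE x in lborel. g x = g' x" "g' \<in> borel_measurable lborel"
  shows "has_fourier f' g'"
  unfolding has_fourier_def
proof (intro conjI allI impI f' g')
  fix \<psi> :: "'a \<Rightarrow> complex"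
  assume s: "schwartz \<psi>"
  have [measurable]: "f \<in> borel_measurable borel" "g \<in> borel_measurable borel" "f' \<in> borel_measurable borel" "g' \<in> borel_measurable borel"
    using fg f' g' by (auto simp: has_fourier_def)
  have [measurable]: "\<psi> \<in> borel_measurable borel" by (rule schwartz_measurable[OF s])
  have 1: "AE x in lborel. f x * fourier \<psi> x = f' x * fourier \<psi> x" using f'(1) by eventually_elim simp
  have 2: "AE x in lborel. g x * \<psi> x = g' x * \<psi> x" using g'(1) by eventually_elim simp
  have 3: "integrable lborel (\<lambda>x. f x * fourier \<psi> x)" "integrable lborel (\<lambda>\<xi>. g \<xi> * \<psi> \<xi>)"
    "(LINT x|lborel. f x * fourier \<psi> x) = (LINT \<xi>|lborel. g \<xi> * \<psi> \<xi>)"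
    using fg s unfolding has_fourier_def by auto
  show "integrable lborel (\<lambda>x. f' x * fourier \<psi> x)"
    by (rule integrable_cong_AE_imp[OF 3(1)]) (use 1 in auto)
  show "integrable lborel (\<lambda>\<xi>. g' \<xi> * \<psi> \<xi>)"
    by (rule integrable_cong_AE_imp[OF 3(2)]) (use 2 in auto)
  have "(LINT x|lborel. f' x * fourier \<psi> x) = (LINT x|lborel. f x * fourier \<psi> x)"
    by (rule integral_cong_AE) (use 1 in auto)
  moreover have "(LINT x|lborel. g' x * \<psi> x) = (LINT x|lborel. g x * \<psi> x)"
    by (rule integral_cong_AE) (use 2 in auto)
  ultimately show "(LINT x|lborel. f' x * fourier \<psi> x) = (LINT \<xi>|lborel. g' \<xi> * \<psi> \<xi>)" using 3(3) by simp
qed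

lemma integral_reflect:
  fixes f :: "'a::euclidean_space \<Rightarrow> complex"
  assumes "f \<in> borel_measurable borel"
  shows "(LINT x|lborel. f (- x)) = (LINT x|lborel. f x)"
  using integral_affine[of "-1" f 0] assms by simp

lemma integrable_reflect:
  fixes f :: "'a::euclidean_space \<Rightarrow> complex"
  assumes "integrable lborel f"
  shows "integrable lborel (\<lambda>x. f (- x))"
  using integrable_affine_iff[of "-1" f 0] assms borel_measurable_integrable[OF assms] by simp

text \<open>The reflection of a centred Gaussian is a Gaussian with the opposite centre, and its transform is
the complex conjugate. Since \<open>u\<close> is real, conjugating the defining identity therefore exchanges
\<open>g\<close> with its reflected conjugate.\<close>
lemma has_fourier_real_symmetric:
  fixes u :: "'a::euclidean_space \<Rightarrow> real"
  assumes ug: "has_fourier (\<lambda>x. complex_of_real (u x)) g"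
  shows "AE \<xi> in lborel. cnj (g (- \<xi>)) = g \<xi>"
proof -
  have [measurable]: "g \<in> borel_measurable borel" using ug by (simp add: has_fourier_def)
  have [measurable]: "(\<lambda>\<xi>. cnj (g \<xi>)) \<in> borel_measurable borel" by (rule borel_measurable_cnj) measurable
  show ?thesis
  proof (rule scaled_gauss_test_imp_AE_eq[OF gauss_eq_wavepacket])
    fix e :: real and a :: 'a
    assume e: "e > 0"
    let ?\<psi> = "wavepacket (1/e) a (0::'a)" and ?\<psi>' = "wavepacket (1/e) (-a) (0::'a)"
    let ?C = "complex_of_real ((2 * pi) powr (- real DIM('a) / 2))"
    have s: "schwartz ?\<psi>" "schwartz ?\<psi>'" using e by (auto intro: schwartz_wavepacket)
    have i: "integrable lborel (\<lambda>\<xi>. g \<xi> * ?\<psi> \<xi>)" "(LINT x|lborel. complex_of_real (u x) * fourier ?\<psi> x) = (LINT \<xi>|lborel. g \<xi> * ?\<psi> \<xi>)"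
       "integrable lborel (\<lambda>\<xi>. g \<xi> * ?\<psi>' \<xi>)" "(LINT x|lborel. complex_of_real (u x) * fourier ?\<psi>' x) = (LINT \<xi>|lborel. g \<xi> * ?\<psi>' \<xi>)"
      using ug s unfolding has_fourier_def by auto
    have refl: "cnj (?\<psi>' (- x)) = ?\<psi> x" for x
    proof -
      have "norm (- x - - a) = norm (x - a)" by (metis minus_diff_minus norm_minus_cancel)
      then show ?thesis by (simp add: wavepacket_split)
    qed
    have refl2: "cnj (g (- x)) * ?\<psi> x = cnj (g (- x) * ?\<psi>' (- x))" for x using refl[of x] by simp
    show "integrable lborel (\<lambda>\<xi>. cnj (g (- \<xi>)) * ?\<psi> \<xi>)" "integrable lborel (\<lambda>\<xi>. g \<xi> * ?\<psi> \<xi>)"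
      unfolding refl2 by (rule integrable_cnj[OF integrable_reflect[OF i(3)]], rule i(1))
    have four: "cnj (fourier ?\<psi>' x) = fourier ?\<psi> x" for x
    proof -
      have "fourier ?\<psi> x = ?C * (LINT y|lborel. exp (- \<i> * complex_of_real (y \<bullet> x)) * ?\<psi> y)" by (simp add: fourier_def)
      also have "(LINT y|lborel. exp (- \<i> * complex_of_real (y \<bullet> x)) * ?\<psi> y)
        = (LINT y|lborel. exp (- \<i> * complex_of_real ((- y) \<bullet> x)) * ?\<psi> (- y))"
        by (rule integral_reflect[symmetric]) measurable
      also have "\<dots> = (LINT y|lborel. cnj (exp (- \<i> * complex_of_real (y \<bullet> x)) * ?\<psi>' y))"
      proof -
        have "?\<psi> (- y) = cnj (?\<psi>' y)" for y using refl[of "- y"] by simp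
        then show ?thesis by (simp add: exp_cnj)
      qed
      also have "?C * \<dots> = cnj (fourier ?\<psi>' x)"
        unfolding Bochner_Integration.integral_cnj fourier_def by simp
      finally show ?thesis by simp
    qed
    have "(LINT \<xi>|lborel. cnj (g (- \<xi>)) * ?\<psi> \<xi>) = cnj (LINT \<xi>|lborel. g (- \<xi>) * ?\<psi>' (- \<xi>))"
      unfolding refl2 by (rule Bochner_Integration.integral_cnj)
    also have "(LINT \<xi>|lborel. g (- \<xi>) * ?\<psi>' (- \<xi>)) = (LINT \<xi>|lborel. g \<xi> * ?\<psi>' \<xi>)"
      by (rule integral_reflect) measurable
    also have "cnj \<dots> = (LINT x|lborel. cnj (complex_of_real (u x) * fourier ?\<psi>' x))"
      unfolding i(4)[symmetric] by (rule Bochner_Integration.integral_cnj[symmetric])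
    also have "\<dots> = (LINT \<xi>|lborel. g \<xi> * ?\<psi> \<xi>)"
      unfolding i(2)[symmetric] by (simp add: four)
    finally show "(LINT \<xi>|lborel. cnj (g (- \<xi>)) * ?\<psi> \<xi>) = (LINT \<xi>|lborel. g \<xi> * ?\<psi> \<xi>)" .
  qed
qed

text \<open>The pairing of a Hermitian \<open>g\<close> with a modulated Gaussian is real, so \<open>w\<close> and its conjugate have
the same integrals against all translated Gaussians.\<close>
lemma has_fourier_symmetric_real:
  fixes w :: "'a::euclidean_space \<Rightarrow> complex"
  assumes wg: "has_fourier w g" and sym: "AE \<xi> in lborel. cnj (g (- \<xi>)) = g \<xi>"
  shows "AE x in lborel. w x = complex_of_real (Re (w x))"
proof -
  have [measurable]: "g \<in> borel_measurable borel" "w \<in> borel_measurable borel" using wg by (simp_all add: has_fourier_def)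
  have [measurable]: "(\<lambda>\<xi>. cnj (g \<xi>)) \<in> borel_measurable borel" by (rule borel_measurable_cnj) measurable
  have "AE x in lborel. cnj (w x) = w x"
  proof (rule scaled_gauss_test_imp_AE_eq[where k="\<lambda>e a x. complex_of_real (gauss ((1/e) *\<^sub>R (x - a)))" and C="\<lambda>_. 1"])
    fix e :: real and a :: 'a
    assume e: "e > 0"
    let ?\<psi> = "wavepacket e (0::'a) a"
    let ?C = "complex_of_real ((2 * pi) powr (- real DIM('a) / 2) * e ^ DIM('a))"
    let ?G = "\<lambda>x. complex_of_real (gauss ((1/e) *\<^sub>R (x - a)))"
    have s: "schwartz ?\<psi>" using e by (intro schwartz_wavepacket) simp
    have i: "integrable lborel (\<lambda>x. w x * fourier ?\<psi> x)" "(LINT x|lborel. w x * fourier ?\<psi> x) = (LINT \<xi>|lborel. g \<xi> * ?\<psi> \<xi>)"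
      using wg s unfolding has_fourier_def by auto
    have refl: "cnj (?\<psi> x) = ?\<psi> (- x)" for x
      by (simp add: wavepacket_split exp_cnj)
    have [measurable]: "(\<lambda>\<xi>. cnj (g \<xi> * ?\<psi> \<xi>)) \<in> borel_measurable borel" by (rule borel_measurable_cnj) measurable
    have "cnj (LINT \<xi>|lborel. g \<xi> * ?\<psi> \<xi>) = (LINT \<xi>|lborel. cnj (g \<xi> * ?\<psi> \<xi>))"
      by (rule Bochner_Integration.integral_cnj[symmetric])
    also have "\<dots> = (LINT \<xi>|lborel. cnj (g (- \<xi>) * ?\<psi> (- \<xi>)))"
      by (rule integral_reflect[symmetric]) measurable
    also have "\<dots> = (LINT \<xi>|lborel. g \<xi> * ?\<psi> \<xi>)"
    proof (rule integral_cong_AE)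
      show "AE \<xi> in lborel. cnj (g (- \<xi>) * ?\<psi> (- \<xi>)) = g \<xi> * ?\<psi> \<xi>"
        using sym by eventually_elim (simp flip: refl)
      show "(\<lambda>\<xi>. cnj (g (- \<xi>) * ?\<psi> (- \<xi>))) \<in> borel_measurable lborel"
        using measurable_compose[OF borel_measurable_uminus[OF measurable_ident] \<open>(\<lambda>\<xi>. cnj (g \<xi> * ?\<psi> \<xi>)) \<in> borel_measurable borel\<close>] by simp
    qed measurable
    finally have re: "cnj (LINT x|lborel. w x * fourier ?\<psi> x) = (LINT x|lborel. w x * fourier ?\<psi> x)"
      unfolding i(2) .
    have G: "w x * ?G x = ?C * (w x * fourier ?\<psi> x)" for x
      unfolding gauss_eq_fourier_wavepacket[OF e] by (simp only: mult.left_commute)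
    show wi: "integrable lborel (\<lambda>x. w x * ?G x)" unfolding G by (intro integrable_mult_right i)
    have *: "cnj (w x) * ?G x = cnj (w x * ?G x)" for x by simp
    show "integrable lborel (\<lambda>x. cnj (w x) * ?G x)" unfolding * by (rule integrable_cnj[OF wi])
    have "(LINT x|lborel. w x * ?G x) = ?C * (LINT x|lborel. w x * fourier ?\<psi> x)"
      unfolding G by (rule integral_mult_right_zero)
    then have re2: "cnj (LINT x|lborel. w x * ?G x) = (LINT x|lborel. w x * ?G x)"
      using re by simp
    then show "(LINT x|lborel. cnj (w x) * ?G x) = (LINT x|lborel. w x * ?G x)"
      unfolding * Bochner_Integration.integral_cnj .
  qed simp
  then show ?thesis by eventually_elim (simp add: complex_eq_iff)
qed

text \<open>An \<open>L\<^sup>2\<close> function with the prescribed transform exists, and it can be taken real because the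
multiplier is real and even. Uniqueness on both sides then forces whatever function the choice
operator returns to agree with it almost everywhere.\<close>
lemma frac_laplacian_L2:
  fixes u :: "'a::euclidean_space \<Rightarrow> real"
  assumes ug: "has_fourier (\<lambda>x. complex_of_real (u x)) g"
    and g2: "square_integrable lborel (\<lambda>\<xi>. complex_of_real (norm \<xi> powr (2 * a)) * g \<xi>)"
  shows "square_integrable lborel (\<lambda>x. complex_of_real (frac_laplacian a u x))"
    and "L2norm lborel (\<lambda>x. complex_of_real (frac_laplacian a u x)) = L2norm lborel (\<lambda>\<xi>. complex_of_real (norm \<xi> powr (2 * a)) * g \<xi>)"
proof -
  let ?m = "\<lambda>g \<xi>. complex_of_real (norm \<xi> powr (2 * a)) * g \<xi>"
  obtain w where w: "square_integrable lborel w" "has_fourier w (?m g)" "L2norm lborel w = L2norm lborel (?m g)"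
    using has_fourier_inverse_exists[OF g2] by (elim exE conjE)
  have [measurable]: "w \<in> borel_measurable borel" using w by (simp add: square_integrable_def)
  have mm: "?m g \<in> borel_measurable lborel" using g2 by (simp add: square_integrable_def)
  have sym: "AE \<xi> in lborel. cnj (?m g (- \<xi>)) = ?m g \<xi>"
    using has_fourier_real_symmetric[OF ug] by eventually_elim simp
  have wr: "AE x in lborel. w x = complex_of_real (Re (w x))"
    by (rule has_fourier_symmetric_real[OF w(2) sym])
  have "has_fourier (\<lambda>x. complex_of_real (Re (w x))) (?m g)"
    by (rule has_fourier_cong_AE[OF w(2) wr _ _ mm]) auto
  with ug have "\<exists>v g. has_fourier (\<lambda>x. complex_of_real (u x)) g \<and> has_fourier (\<lambda>x. complex_of_real (v x)) (?m g)"
    by (intro exI[of _ "\<lambda>x. Re (w x)"] exI[of _ g] conjI)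
  from someI_ex[OF this] obtain h where h: "has_fourier (\<lambda>x. complex_of_real (u x)) h"
    "has_fourier (\<lambda>x. complex_of_real (frac_laplacian a u x)) (?m h)"
    unfolding frac_laplacian_def[symmetric] by (elim exE conjE)
  have meas: "(\<lambda>x. complex_of_real (frac_laplacian a u x)) \<in> borel_measurable lborel"
    using h(2) by (simp add: has_fourier_def)
  have "AE \<xi> in lborel. h \<xi> = g \<xi>" by (rule has_fourier_unique[OF h(1) ug])
  then have "AE \<xi> in lborel. ?m h \<xi> = ?m g \<xi>" by eventually_elim simp
  then have "has_fourier (\<lambda>x. complex_of_real (frac_laplacian a u x)) (?m g)"
    by (intro has_fourier_cong_AE[OF h(2)] meas mm) auto
  from has_fourier_inverse_unique[OF this w(2)]
  have eq: "AE x in lborel. complex_of_real (frac_laplacian a u x) = w x" .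
  show "square_integrable lborel (\<lambda>x. complex_of_real (frac_laplacian a u x))"
  proof (rule square_integrable_bound[OF w(1) meas])
    show "AE x in lborel. norm (complex_of_real (frac_laplacian a u x)) \<le> 1 * norm (w x)"
      using eq by eventually_elim (simp del: norm_of_real)
  qed
  have "(LINT x|lborel. (norm (complex_of_real (frac_laplacian a u x)))\<^sup>2) = (LINT x|lborel. (norm (w x))\<^sup>2)"
    using meas by (intro integral_cong_AE) (use eq in \<open>auto simp del: norm_of_real elim!: eventually_mono\<close>)
  then show "L2norm lborel (\<lambda>x. complex_of_real (frac_laplacian a u x)) = L2norm lborel (?m g)"
    unfolding w(3)[symmetric] by (simp only: L2norm_def)
qed

lemma has_fourier_AE_zero:
  assumes "has_fourier f g" "AE \<xi> in lborel. g \<xi> = 0"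
  shows "AE x in lborel. f x = 0"
proof -
  have f: "f \<in> borel_measurable lborel" using assms by (simp add: has_fourier_def)
  have "has_fourier f (\<lambda>_. 0)" by (rule has_fourier_cong_AE[OF assms(1) _ f assms(2)]) auto
  moreover have "has_fourier (\<lambda>_. 0) (\<lambda>_. 0)" by (simp add: has_fourier_def)
  ultimately show ?thesis by (rule has_fourier_inverse_unique)
qed

section \<open>Contractions decrease the fractional energy\<close>

text \<open>Position and displacement: \<open>f (x + e h)\<close> and \<open>f x\<close> are two isometric images of \<open>f\<close> in the \<open>L\<^sup>2\<close>
space of this measure, so the averaged squared difference is continuous in \<open>f\<close>.\<close>
abbreviation shift_measure :: "('a::euclidean_space \<times> 'a) measure"
  where "shift_measure \<equiv> lborel \<Otimes>\<^sub>M gaussian"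

lemma L2_tendsto_diff:
  assumes F: "L2_tendsto M F f" and G: "L2_tendsto M G g"
  shows "L2_tendsto M (\<lambda>n x. F n x - G n x) (\<lambda>x. f x - g x)"
proof -
  have s: "square_integrable M (F n)" "square_integrable M (G n)" for n using F G by (auto simp: L2_tendsto_def)
  have t: "square_integrable M f" "square_integrable M g" using F G by (auto simp: L2_tendsto_def)
  have "L2norm M (\<lambda>x. (F n x - G n x) - (f x - g x)) \<le> L2norm M (\<lambda>x. F n x - f x) + L2norm M (\<lambda>x. G n x - g x)" for n
  proof -
    have "L2norm M (\<lambda>x. (F n x - f x) + (g x - G n x)) \<le> L2norm M (\<lambda>x. F n x - f x) + L2norm M (\<lambda>x. g x - G n x)"
      by (intro L2norm_triangle square_integrable_diff s t)
    moreover have "(\<lambda>x. (F n x - f x) + (g x - G n x)) = (\<lambda>x. (F n x - G n x) - (f x - g x))" by auto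
    ultimately show ?thesis by (simp only: L2norm_minus_commute[of M g "G n"])
  qed
  note le = this
  have lim: "(\<lambda>n. L2norm M (\<lambda>x. F n x - f x) + L2norm M (\<lambda>x. G n x - g x)) \<longlonglongrightarrow> 0"
    using F G by (intro tendsto_add_zero) (auto simp: L2_tendsto_def)
  have "(\<lambda>n. L2norm M (\<lambda>x. (F n x - G n x) - (f x - g x))) \<longlonglongrightarrow> 0"
    by (rule Lim_null_comparison[OF _ lim]) (simp add: le)
  then show ?thesis unfolding L2_tendsto_def by (intro conjI allI square_integrable_diff s t)
qed

lemma L2_tendsto_bounded_mult:
  assumes F: "L2_tendsto M F f" and [measurable]: "k \<in> borel_measurable M" and k: "\<And>x. norm (k x) \<le> 1"
  shows "L2_tendsto M (\<lambda>n x. F n x * k x) (\<lambda>x. f x * k x)"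
proof -
  have s: "square_integrable M (F n)" for n using F by (auto simp: L2_tendsto_def)
  have t: "square_integrable M f" using F by (auto simp: L2_tendsto_def)
  have m: "square_integrable M (\<lambda>x. h x * k x)" if h: "square_integrable M h" for h
  proof (rule square_integrable_bound[OF h])
    have [measurable]: "h \<in> borel_measurable M" using h by (simp add: square_integrable_def)
    show "(\<lambda>x. h x * k x) \<in> borel_measurable M" by measurable
    show "AE x in M. norm (h x * k x) \<le> 1 * norm (h x)" using k by (simp add: norm_mult mult_left_le)
  qed
  have "L2norm M (\<lambda>x. F n x * k x - f x * k x) \<le> L2norm M (\<lambda>x. F n x - f x)" for n
  proof -
    have d: "square_integrable M (\<lambda>x. F n x - f x)" by (intro square_integrable_diff s t)
    have "(LINT x|M. (norm ((F n x - f x) * k x))\<^sup>2) \<le> (LINT x|M. (norm (F n x - f x))\<^sup>2)"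
    proof (rule Bochner_Integration.integral_mono)
      show "integrable M (\<lambda>x. (norm ((F n x - f x) * k x))\<^sup>2)" "integrable M (\<lambda>x. (norm (F n x - f x))\<^sup>2)"
        using d m[OF d] by (auto simp: square_integrable_def)
      show "(norm ((F n x - f x) * k x))\<^sup>2 \<le> (norm (F n x - f x))\<^sup>2" for x
        unfolding norm_mult using k by (intro power_mono mult_left_le) auto
    qed
    then show ?thesis unfolding L2norm_def left_diff_distrib by (rule real_sqrt_le_mono)
  qed
  note le = this
  have lim: "(\<lambda>n. L2norm M (\<lambda>x. F n x - f x)) \<longlonglongrightarrow> 0" using F by (auto simp: L2_tendsto_def)
  have "(\<lambda>n. L2norm M (\<lambda>x. F n x * k x - f x * k x)) \<longlonglongrightarrow> 0"
    by (rule Lim_null_comparison[OF _ lim]) (simp add: le)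
  then show ?thesis unfolding L2_tendsto_def by (intro conjI allI m s t)
qed

lemma shift_isometry:
  fixes f :: "'a::euclidean_space \<Rightarrow> complex"
  assumes f: "square_integrable lborel f"
  shows "square_integrable shift_measure (\<lambda>(x, h). f (x + e *\<^sub>R h))"
    and "L2norm shift_measure (\<lambda>(x, h). f (x + e *\<^sub>R h)) = L2norm lborel f"
proof -
  have [measurable]: "f \<in> borel_measurable borel" using f by (simp add: square_integrable_def)
  have nn: "(\<integral>\<^sup>+z. ennreal ((norm (case z of (x, h) \<Rightarrow> f (x + e *\<^sub>R h)))\<^sup>2) \<partial>shift_measure) = ennreal ((L2norm lborel f)\<^sup>2)"
  proof -
    have "(\<integral>\<^sup>+z. ennreal ((norm (case z of (x, h) \<Rightarrow> f (x + e *\<^sub>R h)))\<^sup>2) \<partial>shift_measure)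
      = (\<integral>\<^sup>+x. \<integral>\<^sup>+h. ennreal ((norm (f (x + e *\<^sub>R h)))\<^sup>2) \<partial>gaussian \<partial>lborel)"
      by (subst gaussian.nn_integral_fst[symmetric]) auto
    also have "\<dots> = ennreal ((L2norm lborel f)\<^sup>2)"
      using nn_integral_gaussian_translate[of "\<lambda>x. ennreal ((norm (f x))\<^sup>2)" e] nn_integral_norm_sq[OF f] by simp
    finally show ?thesis .
  qed
  show s: "square_integrable shift_measure (\<lambda>(x, h). f (x + e *\<^sub>R h))"
    by (rule square_integrable_nnI(1)[where B="L2norm lborel f"]) (use nn in auto)
  have "(L2norm shift_measure (\<lambda>(x, h). f (x + e *\<^sub>R h)))\<^sup>2 = (L2norm lborel f)\<^sup>2"
    using nn nn_integral_norm_sq[OF s] by simp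
  then show "L2norm shift_measure (\<lambda>(x, h). f (x + e *\<^sub>R h)) = L2norm lborel f"
    by (simp add: power2_eq_iff_nonneg)
qed

lemma L2_tendsto_shift:
  assumes F: "L2_tendsto lborel F f"
  shows "L2_tendsto shift_measure (\<lambda>n (x, h). F n (x + e *\<^sub>R h)) (\<lambda>(x, h). f (x + e *\<^sub>R h))"
proof -
  have s: "square_integrable lborel (F n)" for n using F by (auto simp: L2_tendsto_def)
  have t: "square_integrable lborel f" using F by (auto simp: L2_tendsto_def)
  have "L2norm shift_measure (\<lambda>z. (case z of (x, h) \<Rightarrow> F n (x + e *\<^sub>R h)) - (case z of (x, h) \<Rightarrow> f (x + e *\<^sub>R h)))
     = L2norm lborel (\<lambda>x. F n x - f x)" for n
    using shift_isometry(2)[OF square_integrable_diff[OF s t], where e=e] by (simp add: case_prod_beta')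
  then show ?thesis using F unfolding L2_tendsto_def by (auto intro: shift_isometry s t)
qed

text \<open>Expanding the square, the two diagonal terms are the squared norm of \<open>f\<close>, and the cross term is
the pairing of \<open>f\<close> with its Gaussian average, which the damped Parseval identity evaluates.\<close>
lemma gauss_difference_test:
  fixes f :: "'a::euclidean_space \<Rightarrow> complex"
  assumes f: "test_function f" and e: "e > 0"
  shows "(L2norm shift_measure (\<lambda>(x, h). f (x + e *\<^sub>R h) - f x))\<^sup>2
    = 2 * (L2norm lborel f)\<^sup>2 - 2 * Re (LINT \<xi>|lborel. fourier f \<xi> * (cnj (fourier f \<xi>) * complex_of_real (exp (- e\<^sup>2 * (norm \<xi>)\<^sup>2 / 2))))"
proof -
  note fi = test_function_integrable[OF f] and f2 = test_function_square_integrable[OF f]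
  have [measurable]: "f \<in> borel_measurable borel" using f2 by (simp add: square_integrable_def)
  let ?S = "\<lambda>(x, h). f (x + e *\<^sub>R h)" and ?I = "\<lambda>(x, h::'a). f x"
  have I: "?I = (\<lambda>(x, h). f (x + 0 *\<^sub>R h))" by simp
  have sS: "square_integrable shift_measure ?S" "L2norm shift_measure ?S = L2norm lborel f"
    using shift_isometry[OF f2] by auto
  have sI: "square_integrable shift_measure ?I" "L2norm shift_measure ?I = L2norm lborel f"
    unfolding I using shift_isometry[OF f2, of 0] by auto
  have int: "integrable shift_measure (\<lambda>z. ?I z * cnj (?S z))"
    by (intro square_integrable_mult square_integrable_cnj sS sI)
  have "(LINT z|shift_measure. ?I z * cnj (?S z)) = (LINT x|lborel. LINT h|gaussian. f x * cnj (f (x + e *\<^sub>R h)))"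
    using lborel_gaussian.integral_fst'[of "\<lambda>z. ?I z * cnj (?S z)"] int by (simp add: case_prod_beta')
  also have "\<dots> = (LINT x|lborel. f x * cnj (gauss_average e f x))"
    by (simp add: gauss_average_def)
  finally have cross: "(LINT z|shift_measure. ?I z * cnj (?S z))
     = (LINT \<xi>|lborel. fourier f \<xi> * (cnj (fourier f \<xi>) * complex_of_real (exp (- e\<^sup>2 * (norm \<xi>)\<^sup>2 / 2))))"
    using fourier_gauss_regularised(2)[OF fi fi e] by simp
  define r where "r = (\<lambda>z. Re (?I z * cnj (?S z)))"
  have r1: "integrable shift_measure r" unfolding r_def by (rule integrable_Re[OF int])
  have r2: "integral\<^sup>L shift_measure r = Re (LINT z|shift_measure. ?I z * cnj (?S z))" unfolding r_def by (rule integral_Re[OF int])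
  have i2: "integrable shift_measure (\<lambda>z. (norm (?S z))\<^sup>2)" "integrable shift_measure (\<lambda>z. (norm (?I z))\<^sup>2)"
    using sS sI by (auto simp: square_integrable_def)
  have pt: "(norm (case z of (x, h) \<Rightarrow> f (x + e *\<^sub>R h) - f x))\<^sup>2 = (norm (?S z))\<^sup>2 + (norm (?I z))\<^sup>2 - 2 * r z" for z
    unfolding r_def by (cases z) (simp only: cmod_power2 prod.case, simp add: power2_eq_square algebra_simps)
  have "(L2norm shift_measure (\<lambda>(x, h). f (x + e *\<^sub>R h) - f x))\<^sup>2 = (LINT z|shift_measure. (norm (?S z))\<^sup>2 + (norm (?I z))\<^sup>2 - 2 * r z)"
    unfolding L2norm_sq pt ..
  also have "\<dots> = (LINT z|shift_measure. (norm (?S z))\<^sup>2) + (LINT z|shift_measure. (norm (?I z))\<^sup>2) - 2 * integral\<^sup>L shift_measure r"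
    using i2 r1 by simp
  finally show ?thesis unfolding r2 cross L2norm_sq[symmetric] sS(2) sI(2) by simp
qed

text \<open>The multiplier \<open>1 - exp (- e\<^sup>2 |\<xi>|\<^sup>2 / 2)\<close> measures averaged squared differences of \<open>f\<close>. The
right-hand side depends on \<open>f\<close> only through the numbers \<open>|f x - f y|\<close>, which is what makes it
monotone under contractions.\<close>
lemma gauss_difference_fourier:
  fixes f :: "'a::euclidean_space \<Rightarrow> complex"
  assumes fg: "L2_fourier_pair f g" and e: "e > 0"
  shows "2 * (\<integral>\<^sup>+\<xi>. ennreal ((norm (g \<xi>))\<^sup>2 * (1 - exp (- e\<^sup>2 * (norm \<xi>)\<^sup>2 / 2))) \<partial>lborel)
    = (\<integral>\<^sup>+x. \<integral>\<^sup>+h. ennreal ((norm (f (x + e *\<^sub>R h) - f x))\<^sup>2) \<partial>gaussian \<partial>lborel)"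
proof -
  obtain G where G: "\<And>n. test_function (G n)" "L2_tendsto lborel G f" "L2_tendsto lborel (\<lambda>n. fourier (G n)) g"
    using fg by (auto simp: L2_fourier_pair_def)
  note f2 = L2_fourier_pair_square_integrable(1)[OF fg] and g2 = L2_fourier_pair_square_integrable(2)[OF fg]
  have [measurable]: "f \<in> borel_measurable borel" "g \<in> borel_measurable borel" using f2 g2 by (simp_all add: square_integrable_def)
  let ?E = "\<lambda>\<xi>. exp (- e\<^sup>2 * (norm \<xi>)\<^sup>2 / 2)"
  have E1: "?E \<xi> \<le> 1" for \<xi> :: 'a by simp
  let ?D = "\<lambda>f (x, h). f (x + e *\<^sub>R h) - f x :: complex"
  have D_eq: "?D f = (\<lambda>z. (case z of (x, h) \<Rightarrow> f (x + e *\<^sub>R h)) - (case z of (x, h) \<Rightarrow> f (x + 0 *\<^sub>R h)))" for f :: "'a \<Rightarrow> complex"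
    by auto
  have Dt: "L2_tendsto shift_measure (\<lambda>n. ?D (G n)) (?D f)"
    unfolding D_eq by (intro L2_tendsto_diff L2_tendsto_shift G)
  have 1: "(\<lambda>n. (L2norm shift_measure (?D (G n)))\<^sup>2) \<longlonglongrightarrow> (L2norm shift_measure (?D f))\<^sup>2"
    by (rule L2_tendsto_norm[OF Dt])
  have "(\<lambda>n. LINT \<xi>|lborel. fourier (G n) \<xi> * (cnj (fourier (G n) \<xi>) * complex_of_real (?E \<xi>)))
     \<longlonglongrightarrow> (LINT \<xi>|lborel. g \<xi> * (cnj (g \<xi>) * complex_of_real (?E \<xi>)))"
    by (intro L2_tendsto_integral_mult L2_tendsto_bounded_mult L2_tendsto_cnj G) auto
  then have 2: "(\<lambda>n. 2 * (L2norm lborel (G n))\<^sup>2 - 2 * Re (LINT \<xi>|lborel. fourier (G n) \<xi> * (cnj (fourier (G n) \<xi>) * complex_of_real (?E \<xi>))))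
     \<longlonglongrightarrow> 2 * (L2norm lborel f)\<^sup>2 - 2 * Re (LINT \<xi>|lborel. g \<xi> * (cnj (g \<xi>) * complex_of_real (?E \<xi>)))"
    by (intro tendsto_diff tendsto_mult_left tendsto_Re L2_tendsto_norm G)
  have key: "(L2norm shift_measure (?D f))\<^sup>2 = 2 * (L2norm lborel f)\<^sup>2 - 2 * Re (LINT \<xi>|lborel. g \<xi> * (cnj (g \<xi>) * complex_of_real (?E \<xi>)))"
    using LIMSEQ_unique[OF 1[unfolded gauss_difference_test[OF G(1) e]] 2] .
  have gi: "integrable lborel (\<lambda>\<xi>. (norm (g \<xi>))\<^sup>2)" using g2 by (simp add: square_integrable_def)
  have gE: "integrable lborel (\<lambda>\<xi>. (norm (g \<xi>))\<^sup>2 * ?E \<xi>)"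
    by (rule Bochner_Integration.integrable_bound[OF gi]) (auto simp: mult_left_le)
  have "g \<xi> * (cnj (g \<xi>) * complex_of_real (?E \<xi>)) = complex_of_real ((norm (g \<xi>))\<^sup>2 * ?E \<xi>)" for \<xi>
    by (simp add: mult.assoc[symmetric] complex_norm_square[symmetric])
  then have re: "Re (LINT \<xi>|lborel. g \<xi> * (cnj (g \<xi>) * complex_of_real (?E \<xi>))) = (LINT \<xi>|lborel. (norm (g \<xi>))\<^sup>2 * ?E \<xi>)"
    by (simp only: integral_complex_of_real Re_complex_of_real)
  have "(LINT \<xi>|lborel. (norm (g \<xi>))\<^sup>2 * (1 - ?E \<xi>)) = (L2norm lborel f)\<^sup>2 - (LINT \<xi>|lborel. (norm (g \<xi>))\<^sup>2 * ?E \<xi>)"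
    unfolding L2_fourier_pair_norm[OF fg, symmetric] L2norm_sq right_diff_distrib mult_1_right
    using gi gE by (rule Bochner_Integration.integral_diff)
  then have D2: "(L2norm shift_measure (?D f))\<^sup>2 = 2 * (LINT \<xi>|lborel. (norm (g \<xi>))\<^sup>2 * (1 - ?E \<xi>))"
    unfolding key re by simp
  have "(\<integral>\<^sup>+\<xi>. ennreal ((norm (g \<xi>))\<^sup>2 * (1 - ?E \<xi>)) \<partial>lborel) = ennreal (LINT \<xi>|lborel. (norm (g \<xi>))\<^sup>2 * (1 - ?E \<xi>))"
    using gi gE by (intro nn_integral_eq_integral) (auto simp: right_diff_distrib mult_left_le)
  then have "2 * (\<integral>\<^sup>+\<xi>. ennreal ((norm (g \<xi>))\<^sup>2 * (1 - ?E \<xi>)) \<partial>lborel) = ennreal ((L2norm shift_measure (?D f))\<^sup>2)"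
    unfolding D2 by (simp add: ennreal_mult'' Bochner_Integration.integral_nonneg)
  also have "\<dots> = (\<integral>\<^sup>+z. ennreal ((norm (?D f z))\<^sup>2) \<partial>shift_measure)"
    using Dt by (intro nn_integral_norm_sq[symmetric]) (simp add: L2_tendsto_def)
  also have "\<dots> = (\<integral>\<^sup>+x. \<integral>\<^sup>+h. ennreal ((norm (f (x + e *\<^sub>R h) - f x))\<^sup>2) \<partial>gaussian \<partial>lborel)"
    by (subst gaussian.nn_integral_fst[symmetric]) auto
  finally show ?thesis .
qed

text \<open>The value at \<open>|\<xi>| = 1\<close> of the superposition of Gaussian multipliers that represents
\<open>|\<xi>| powr (2 * s)\<close>.\<close>
definition subordination_const :: "real \<Rightarrow> ennreal"
  where "subordination_const s = (\<integral>\<^sup>+e. ennreal (indicator {0<..} e * e powr (- 1 - 2 * s) * (1 - exp (- e\<^sup>2 / 2))) \<partial>lborel)"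

text \<open>The substitution \<open>e \<mapsto> r e\<close> shows that the superposition is homogeneous of degree \<open>2 * s\<close> in \<open>r\<close>.\<close>
lemma subordination_scaling:
  assumes r: "r > 0"
  shows "(\<integral>\<^sup>+e. ennreal (indicator {0<..} e * e powr (- 1 - 2 * s) * (1 - exp (- e\<^sup>2 * r\<^sup>2 / 2))) \<partial>lborel)
    = ennreal (r powr (2 * s)) * subordination_const s"
proof -
  have "subordination_const s = ennreal r * (\<integral>\<^sup>+e. ennreal (indicator {0<..} (r * e) * (r * e) powr (- 1 - 2 * s) * (1 - exp (- (r * e)\<^sup>2 / 2))) \<partial>lborel)"
    unfolding subordination_const_def using r by (subst nn_integral_real_affine[where c=r and t=0]) auto
  also have "(\<lambda>e. ennreal (indicator {0<..} (r * e) * (r * e) powr (- 1 - 2 * s) * (1 - exp (- (r * e)\<^sup>2 / 2))))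
    = (\<lambda>e. ennreal (r powr (- 1 - 2 * s)) * ennreal (indicator {0<..} e * e powr (- 1 - 2 * s) * (1 - exp (- e\<^sup>2 * r\<^sup>2 / 2))))"
  proof
    fix e
    show "ennreal (indicator {0<..} (r * e) * (r * e) powr (- 1 - 2 * s) * (1 - exp (- (r * e)\<^sup>2 / 2)))
      = ennreal (r powr (- 1 - 2 * s)) * ennreal (indicator {0<..} e * e powr (- 1 - 2 * s) * (1 - exp (- e\<^sup>2 * r\<^sup>2 / 2)))"
      using r by (cases "e > 0") (auto simp: ennreal_mult[symmetric] powr_mult power_mult_distrib zero_less_mult_iff ac_simps)
  qed
  also have "(\<integral>\<^sup>+e. ennreal (r powr (- 1 - 2 * s)) * ennreal (indicator {0<..} e * e powr (- 1 - 2 * s) * (1 - exp (- e\<^sup>2 * r\<^sup>2 / 2))) \<partial>lborel)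
    = ennreal (r powr (- 1 - 2 * s)) * (\<integral>\<^sup>+e. ennreal (indicator {0<..} e * e powr (- 1 - 2 * s) * (1 - exp (- e\<^sup>2 * r\<^sup>2 / 2))) \<partial>lborel)"
    by (rule nn_integral_cmult) measurable
  finally have "ennreal (r powr (2 * s)) * subordination_const s = ennreal (r powr (2 * s)) * ennreal r * ennreal (r powr (- 1 - 2 * s)) * (\<integral>\<^sup>+e. ennreal (indicator {0<..} e * e powr (- 1 - 2 * s) * (1 - exp (- e\<^sup>2 * r\<^sup>2 / 2))) \<partial>lborel)"
    by (simp only: ac_simps)
  also have "ennreal (r powr (2 * s)) * ennreal r * ennreal (r powr (- 1 - 2 * s)) = 1"
  proof -
    have "r powr (2 * s) * r * r powr (- 1 - 2 * s) = r powr (2 * s) * r powr 1 * r powr (- 1 - 2 * s)" using r by simp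
    also have "\<dots> = 1" using r by (simp only: powr_add[symmetric]) simp
    finally show ?thesis using r by (simp add: ennreal_mult[symmetric])
  qed
  finally show ?thesis by simp
qed

text \<open>The integrand is of order \<open>e powr (1 - 2 * s)\<close> near zero, which is integrable for \<open>s < 1\<close>, and at
most \<open>e powr (- 1 - 2 * s)\<close> at infinity, which is integrable for \<open>s > 0\<close>. Finiteness and positivity
allow the constant to be cancelled.\<close>
lemma subordination_const_finite:
  assumes s: "0 < s" "s < 1"
  shows "subordination_const s < \<infinity>" "subordination_const s > 0"
proof -
  let ?k = "\<lambda>e. indicator {0<..} e * e powr (- 1 - 2 * s) * (1 - exp (- e\<^sup>2 / 2)) :: real"
  have i1: "(\<integral>\<^sup>+e. ennreal (indicator {0<..1} e * e powr (1 - 2 * s)) \<partial>lborel) < \<infinity>"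
  proof -
    have "((\<lambda>e. e powr (1 - 2 * s)) has_integral (1 powr (1 - 2 * s + 1) / (1 - 2 * s + 1))) {0..1}"
      using has_integral_powr_from_0[of "1 - 2 * s" 1] s by simp
    then have "(\<integral>\<^sup>+e. ennreal (indicator {0..1} e * e powr (1 - 2 * s)) \<partial>lborel) = ennreal (1 powr (1 - 2 * s + 1) / (1 - 2 * s + 1))"
      by (intro nn_integral_has_integral_lebesgue) auto
    then have "(\<integral>\<^sup>+e. ennreal (indicator {0..1} e * e powr (1 - 2 * s)) \<partial>lborel) < \<infinity>" by simp
    moreover have "(\<integral>\<^sup>+e. ennreal (indicator {0<..1} e * e powr (1 - 2 * s)) \<partial>lborel) \<le> (\<integral>\<^sup>+e. ennreal (indicator {0..1} e * e powr (1 - 2 * s)) \<partial>lborel)"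
      by (intro nn_integral_mono) (auto simp: indicator_def)
    ultimately show ?thesis by (rule le_less_trans[rotated])
  qed
  have i2: "(\<integral>\<^sup>+e. ennreal (indicator {1..} e * e powr (- 1 - 2 * s)) \<partial>lborel) < \<infinity>"
  proof -
    have "((\<lambda>e. e powr (- 1 - 2 * s)) has_integral - (1 powr (- 1 - 2 * s + 1)) / (- 1 - 2 * s + 1)) {1..}"
      using has_integral_powr_to_inf[of "- 1 - 2 * s" 1] s by simp
    then have "(\<integral>\<^sup>+e. ennreal (indicator {1..} e * e powr (- 1 - 2 * s)) \<partial>lborel) = ennreal (- (1 powr (- 1 - 2 * s + 1)) / (- 1 - 2 * s + 1))"
      by (intro nn_integral_has_integral_lebesgue) auto
    then show ?thesis by simp
  qed
  have "?k e \<le> indicator {0<..1} e * e powr (1 - 2 * s) + indicator {1..} e * e powr (- 1 - 2 * s)" for e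
  proof (cases "e > 0")
    case True
    have b: "0 \<le> 1 - exp (- e\<^sup>2 / 2)" "1 - exp (- e\<^sup>2 / 2) \<le> 1" "1 - exp (- e\<^sup>2 / 2) \<le> e\<^sup>2"
      using exp_ge_add_one_self[of "- e\<^sup>2 / 2"] zero_le_power2[of e] by (simp_all, linarith)
    show ?thesis
    proof (cases "e \<le> 1")
      case e1: True
      have "e powr (- 1 - 2 * s) * (1 - exp (- e\<^sup>2 / 2)) \<le> e powr (- 1 - 2 * s) * e powr 2"
        using b True by (intro mult_left_mono) (auto simp: powr_numeral)
      also have "\<dots> = e powr (1 - 2 * s)" by (simp add: powr_add[symmetric])
      finally have *: "e powr (- 1 - 2 * s) * (1 - exp (- e\<^sup>2 / 2)) \<le> e powr (1 - 2 * s)" .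
      have "0 \<le> indicator {1..} e * e powr (- 1 - 2 * s)" by simp
      then show ?thesis using True e1 * by (simp only: indicator_simps greaterThan_iff greaterThanAtMost_iff mult_1 add_increasing2)
    next
      case False
      then show ?thesis using True b by (simp add: indicator_def mult_left_le)
    qed
  qed (auto simp: indicator_def)
  then have "subordination_const s \<le> (\<integral>\<^sup>+e. ennreal (indicator {0<..1} e * e powr (1 - 2 * s)) + ennreal (indicator {1..} e * e powr (- 1 - 2 * s)) \<partial>lborel)"
    unfolding subordination_const_def
    by (intro nn_integral_mono) (auto simp: ennreal_plus[symmetric] simp del: ennreal_plus intro!: ennreal_leI)
  also have "\<dots> < \<infinity>" using i1 i2 by (subst nn_integral_add) auto
  finally show "subordination_const s < \<infinity>" .
  show "subordination_const s > 0"
  proof (rule ccontr)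
    assume "\<not> subordination_const s > 0"
    then have "subordination_const s = 0" by (simp add: zero_less_iff_neq_zero)
    then have "AE e in lborel. ennreal (?k e) = 0"
      unfolding subordination_const_def by (subst (asm) nn_integral_0_iff_AE) auto
    moreover have "ennreal (?k e) \<noteq> 0" if "e > 0" for e using that by (simp add: ennreal_eq_0_iff not_le)
    ultimately have "AE e in lborel. \<not> (e > (0::real))" by (auto elim!: eventually_mono)
    then have "AE e in lborel. e \<notin> {0<..<1::real}" by eventually_elim auto
    then have "{0<..<1::real} \<in> null_sets lborel" by (subst (asm) AE_iff_null_sets[symmetric]) auto
    then show False by (simp add: null_sets_def)
  qed
qed

text \<open>The fractional energy is a superposition over \<open>e\<close> of averaged squared differences, each of which
decreases when \<open>|f x - f y|\<close> does. It is applied with \<open>f'\<close> the absolute value of \<open>f\<close>, truncated at a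
constant.\<close>
lemma fractional_energy_contraction:
  fixes f f' g g' :: "'a::euclidean_space \<Rightarrow> complex"
  assumes fg: "L2_fourier_pair f g" and fg': "L2_fourier_pair f' g'"
    and contr: "\<And>x y. norm (f' x - f' y) \<le> norm (f x - f y)" and s: "0 < s" "s < 1"
  shows "(\<integral>\<^sup>+\<xi>. ennreal ((norm (complex_of_real (norm \<xi> powr s) * g' \<xi>))\<^sup>2) \<partial>lborel)
    \<le> (\<integral>\<^sup>+\<xi>. ennreal ((norm (complex_of_real (norm \<xi> powr s) * g \<xi>))\<^sup>2) \<partial>lborel)"
proof -
  let ?K = "\<lambda>e \<xi>. ennreal (indicator {0<..} e * e powr (- 1 - 2 * s) * (1 - exp (- e\<^sup>2 * (norm \<xi>)\<^sup>2 / 2)))"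
  have energy: "(\<integral>\<^sup>+\<xi>. ennreal ((norm (complex_of_real (norm \<xi> powr s) * g \<xi>))\<^sup>2) \<partial>lborel) * subordination_const s
     = (\<integral>\<^sup>+e. ennreal (indicator {0<..} e * e powr (- 1 - 2 * s)) * (\<integral>\<^sup>+\<xi>. ennreal ((norm (g \<xi>))\<^sup>2 * (1 - exp (- e\<^sup>2 * (norm \<xi>)\<^sup>2 / 2))) \<partial>lborel) \<partial>lborel)"
    if "square_integrable lborel g" for g :: "'a \<Rightarrow> complex"
  proof -
    have [measurable]: "g \<in> borel_measurable borel" using that by (simp add: square_integrable_def)
    have "(\<integral>\<^sup>+\<xi>. ennreal ((norm (complex_of_real (norm \<xi> powr s) * g \<xi>))\<^sup>2) \<partial>lborel) * subordination_const s
      = (\<integral>\<^sup>+\<xi>. ennreal ((norm (complex_of_real (norm \<xi> powr s) * g \<xi>))\<^sup>2) * subordination_const s \<partial>lborel)"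
      by (rule nn_integral_multc[symmetric]) measurable
    also have "\<dots> = (\<integral>\<^sup>+\<xi>. (\<integral>\<^sup>+e. ennreal ((norm (g \<xi>))\<^sup>2) * ?K e \<xi> \<partial>lborel) \<partial>lborel)"
    proof (rule nn_integral_cong)
      fix \<xi> :: 'a
      show "ennreal ((norm (complex_of_real (norm \<xi> powr s) * g \<xi>))\<^sup>2) * subordination_const s = (\<integral>\<^sup>+e. ennreal ((norm (g \<xi>))\<^sup>2) * ?K e \<xi> \<partial>lborel)"
      proof (cases "\<xi> = 0")
        case False
        have "(norm (complex_of_real (norm \<xi> powr s) * g \<xi>))\<^sup>2 = (norm (g \<xi>))\<^sup>2 * norm \<xi> powr (2 * s)"
          using False by (simp add: norm_mult power_mult_distrib power2_eq_square[of "norm \<xi> powr s"] powr_add[symmetric])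
        then have "ennreal ((norm (complex_of_real (norm \<xi> powr s) * g \<xi>))\<^sup>2) * subordination_const s = ennreal ((norm (g \<xi>))\<^sup>2) * (ennreal (norm \<xi> powr (2 * s)) * subordination_const s)"
          by (simp add: ennreal_mult mult.assoc)
        also have "\<dots> = ennreal ((norm (g \<xi>))\<^sup>2) * (\<integral>\<^sup>+e. ?K e \<xi> \<partial>lborel)"
          using subordination_scaling[of "norm \<xi>" s] False by simp
        also have "\<dots> = (\<integral>\<^sup>+e. ennreal ((norm (g \<xi>))\<^sup>2) * ?K e \<xi> \<partial>lborel)"
          by (rule nn_integral_cmult[symmetric]) measurable
        finally show ?thesis .
      qed simp
    qed
    also have "\<dots> = (\<integral>\<^sup>+e. (\<integral>\<^sup>+\<xi>. ennreal ((norm (g \<xi>))\<^sup>2) * ?K e \<xi> \<partial>lborel) \<partial>lborel)"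
      by (rule lborel_pair.Fubini') measurable
    also have "\<dots> = (\<integral>\<^sup>+e. ennreal (indicator {0<..} e * e powr (- 1 - 2 * s)) * (\<integral>\<^sup>+\<xi>. ennreal ((norm (g \<xi>))\<^sup>2 * (1 - exp (- e\<^sup>2 * (norm \<xi>)\<^sup>2 / 2))) \<partial>lborel) \<partial>lborel)"
    proof (rule nn_integral_cong)
      fix e :: real
      have *: "ennreal ((norm (g \<xi>))\<^sup>2) * ?K e \<xi> = ennreal (indicator {0<..} e * e powr (- 1 - 2 * s)) * ennreal ((norm (g \<xi>))\<^sup>2 * (1 - exp (- e\<^sup>2 * (norm \<xi>)\<^sup>2 / 2)))" for \<xi> :: 'a
        by (simp add: ennreal_mult[symmetric] ac_simps)
      show "(\<integral>\<^sup>+\<xi>. ennreal ((norm (g \<xi>))\<^sup>2) * ?K e \<xi> \<partial>lborel)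
        = ennreal (indicator {0<..} e * e powr (- 1 - 2 * s)) * (\<integral>\<^sup>+\<xi>. ennreal ((norm (g \<xi>))\<^sup>2 * (1 - exp (- e\<^sup>2 * (norm \<xi>)\<^sup>2 / 2))) \<partial>lborel)"
        unfolding * by (rule nn_integral_cmult) measurable
    qed
    finally show ?thesis .
  qed
  note g2 = L2_fourier_pair_square_integrable(2)[OF fg] and g2' = L2_fourier_pair_square_integrable(2)[OF fg']
  have diff: "(\<integral>\<^sup>+\<xi>. ennreal ((norm (g' \<xi>))\<^sup>2 * (1 - exp (- e\<^sup>2 * (norm \<xi>)\<^sup>2 / 2))) \<partial>lborel)
     \<le> (\<integral>\<^sup>+\<xi>. ennreal ((norm (g \<xi>))\<^sup>2 * (1 - exp (- e\<^sup>2 * (norm \<xi>)\<^sup>2 / 2))) \<partial>lborel)" if e: "e > 0" for e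
  proof -
    have "2 * (\<integral>\<^sup>+\<xi>. ennreal ((norm (g' \<xi>))\<^sup>2 * (1 - exp (- e\<^sup>2 * (norm \<xi>)\<^sup>2 / 2))) \<partial>lborel)
      \<le> 2 * (\<integral>\<^sup>+\<xi>. ennreal ((norm (g \<xi>))\<^sup>2 * (1 - exp (- e\<^sup>2 * (norm \<xi>)\<^sup>2 / 2))) \<partial>lborel)"
      unfolding gauss_difference_fourier[OF fg e] gauss_difference_fourier[OF fg' e]
      by (intro nn_integral_mono ennreal_leI power_mono contr) simp
    then show ?thesis by (subst (asm) ennreal_mult_le_mult_iff) auto
  qed
  have "(\<integral>\<^sup>+\<xi>. ennreal ((norm (complex_of_real (norm \<xi> powr s) * g' \<xi>))\<^sup>2) \<partial>lborel) * subordination_const s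
    \<le> (\<integral>\<^sup>+\<xi>. ennreal ((norm (complex_of_real (norm \<xi> powr s) * g \<xi>))\<^sup>2) \<partial>lborel) * subordination_const s"
    unfolding energy[OF g2] energy[OF g2']
  proof (rule nn_integral_mono)
    fix e :: real
    show "ennreal (indicator {0<..} e * e powr (- 1 - 2 * s)) * (\<integral>\<^sup>+\<xi>. ennreal ((norm (g' \<xi>))\<^sup>2 * (1 - exp (- e\<^sup>2 * (norm \<xi>)\<^sup>2 / 2))) \<partial>lborel)
      \<le> ennreal (indicator {0<..} e * e powr (- 1 - 2 * s)) * (\<integral>\<^sup>+\<xi>. ennreal ((norm (g \<xi>))\<^sup>2 * (1 - exp (- e\<^sup>2 * (norm \<xi>)\<^sup>2 / 2))) \<partial>lborel)"
    proof (cases "e > 0")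
      case True
      then show ?thesis by (intro mult_left_mono diff) auto
    qed simp
  qed
  then show ?thesis
    using subordination_const_finite[OF s] by (subst (asm) (1 2) mult.commute, subst (asm) ennreal_mult_le_mult_iff) auto
qed

section \<open>The system\<close>

lemma powr_two_nonneg: "0 \<le> x \<Longrightarrow> x powr 2 = (x::real)\<^sup>2"
  by (cases "x = 0") (auto simp: powr_numeral)

lemma Lq_2_iff_square_integrable: "f \<in> Lq 2 \<longleftrightarrow> square_integrable lborel f"
  by (simp add: Lq_def square_integrable_def powr_two_nonneg)

lemma borel_measurable_of_real_iff:
  "(\<lambda>x. complex_of_real (f x)) \<in> borel_measurable M \<longleftrightarrow> f \<in> borel_measurable M"
proof
  assume [measurable]: "(\<lambda>x. complex_of_real (f x)) \<in> borel_measurable M"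
  have "(\<lambda>x. Re (complex_of_real (f x))) \<in> borel_measurable M" by measurable
  then show "f \<in> borel_measurable M" by simp
qed simp

lemma Lq_2_real_iff_square_integrable:
  "f \<in> Lq 2 \<longleftrightarrow> square_integrable lborel (\<lambda>x. complex_of_real (f x))"
  by (simp add: Lq_def square_integrable_def powr_two_nonneg borel_measurable_of_real_iff[where M=lborel, simplified])

lemma square_integrable_of_real_iff:
  "square_integrable M (\<lambda>x. complex_of_real (f x)) \<longleftrightarrow> f \<in> borel_measurable M \<and> integrable M (\<lambda>x. (f x)\<^sup>2)"
  by (simp add: square_integrable_def borel_measurable_of_real_iff)

lemma L2norm_of_real_sq: "(L2norm M (\<lambda>x. complex_of_real (f x)))\<^sup>2 = (LINT x|M. (f x)\<^sup>2)"
  by (simp add: L2norm_sq)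

lemma half_frac_laplacian_L2:
  fixes u :: "'a::euclidean_space \<Rightarrow> real"
  assumes "has_fourier (\<lambda>x. complex_of_real (u x)) g"
    and "square_integrable lborel (\<lambda>\<xi>. complex_of_real (norm \<xi> powr s) * g \<xi>)"
  shows "frac_laplacian (s / 2) u \<in> borel_measurable lborel"
    and "integrable lborel (\<lambda>x. (frac_laplacian (s / 2) u x)\<^sup>2)"
    and "(LINT x|lborel. (frac_laplacian (s / 2) u x)\<^sup>2) = (L2norm lborel (\<lambda>\<xi>. complex_of_real (norm \<xi> powr s) * g \<xi>))\<^sup>2"
proof -
  have a: "2 * (s / 2) = s" by simp
  note * = frac_laplacian_L2[where a="s / 2", unfolded a, OF assms]
  show "frac_laplacian (s / 2) u \<in> borel_measurable lborel" "integrable lborel (\<lambda>x. (frac_laplacian (s / 2) u x)\<^sup>2)"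
    using *(1) unfolding square_integrable_of_real_iff by auto
  show "(LINT x|lborel. (frac_laplacian (s / 2) u x)\<^sup>2) = (L2norm lborel (\<lambda>\<xi>. complex_of_real (norm \<xi> powr s) * g \<xi>))\<^sup>2"
    using *(2) L2norm_of_real_sq[of lborel "frac_laplacian (s / 2) u"] by simp
qed

text \<open>Uniqueness identifies the distributional transform in the definition of \<open>Hs\<close> with the Plancherel
transform, for which the energy formula is available.\<close>
lemma Hs_fourier_pair:
  assumes u: "u \<in> Hs s" and s: "0 \<le> s"
  shows "\<exists>g. L2_fourier_pair (\<lambda>x. complex_of_real (u x)) g \<and>
    square_integrable lborel (\<lambda>\<xi>. complex_of_real (norm \<xi> powr s) * g \<xi>)"
proof -
  obtain h where h: "has_fourier (\<lambda>x. complex_of_real (u x)) h"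
    and h2: "square_integrable lborel (\<lambda>\<xi>. complex_of_real ((1 + (norm \<xi>)\<^sup>2) powr (s / 2)) * h \<xi>)"
    using u unfolding Hs_def Lq_2_iff_square_integrable by auto
  have "square_integrable lborel (\<lambda>x. complex_of_real (u x))"
    using u unfolding Hs_def Lq_2_real_iff_square_integrable by simp
  from L2_fourier_pair_exists[OF this] obtain g where g: "L2_fourier_pair (\<lambda>x. complex_of_real (u x)) g" ..
  have [measurable]: "g \<in> borel_measurable borel"
    using L2_fourier_pair_square_integrable(2)[OF g] by (simp add: square_integrable_def)
  have eq: "AE \<xi> in lborel. g \<xi> = h \<xi>"
    by (rule has_fourier_unique[OF L2_fourier_pair_has_fourier[OF g] h])
  have "square_integrable lborel (\<lambda>\<xi>. complex_of_real (norm \<xi> powr s) * g \<xi>)"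
  proof (rule square_integrable_bound[OF h2, where C=1])
    show "AE \<xi> in lborel. norm (complex_of_real (norm \<xi> powr s) * g \<xi>)
        \<le> 1 * norm (complex_of_real ((1 + (norm \<xi>)\<^sup>2) powr (s / 2)) * h \<xi>)"
      using eq
    proof eventually_elim
      case (elim \<xi>)
      have "norm \<xi> powr s = ((norm \<xi>)\<^sup>2) powr (s / 2)"
        using powr_powr[of "norm \<xi>" 2 "s / 2"] by (simp add: powr_two_nonneg)
      also have "\<dots> \<le> (1 + (norm \<xi>)\<^sup>2) powr (s / 2)" using s by (intro powr_mono2) auto
      finally show ?case using elim by (simp add: norm_mult mult_right_mono)
    qed
  qed measurable
  with g show ?thesis by (intro exI[of _ g] conjI)
qed

text \<open>A truncation of \<open>|u|\<close> is bounded and square-integrable, so it belongs to every \<open>L\<^sup>q\<close> with \<open>q \<ge> 2\<close>,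
and its energy is at most that of \<open>u\<close> because truncation is a
contraction.\<close>
lemma truncation_Ds2:
  assumes u: "u \<in> Hs s" and s: "0 < s" "s < 1" and c: "c \<ge> 0"
  defines "v \<equiv> \<lambda>x. min \<bar>u x\<bar> c"
  shows "v \<in> Ds2 s"
    and "frac_laplacian (s / 2) v \<in> borel_measurable lborel"
    and "integrable lborel (\<lambda>x. (frac_laplacian (s / 2) v x)\<^sup>2)"
    and "(LINT x|lborel. (frac_laplacian (s / 2) v x)\<^sup>2) \<le> (LINT x|lborel. (frac_laplacian (s / 2) u x)\<^sup>2)"
proof -
  obtain g where g: "L2_fourier_pair (\<lambda>x. complex_of_real (u x)) g"
    and g2: "square_integrable lborel (\<lambda>\<xi>. complex_of_real (norm \<xi> powr s) * g \<xi>)"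
    using Hs_fourier_pair[OF u less_imp_le[OF s(1)]] by (elim exE conjE)
  have u2: "u \<in> borel_measurable lborel" "integrable lborel (\<lambda>x. (u x)\<^sup>2)"
    using L2_fourier_pair_square_integrable(1)[OF g] unfolding square_integrable_of_real_iff by auto
  have um [measurable]: "u \<in> borel_measurable borel" using u2 by simp
  have [measurable]: "v \<in> borel_measurable borel" unfolding v_def by measurable
  have v2: "square_integrable lborel (\<lambda>x. complex_of_real (v x))"
    by (rule square_integrable_bound[OF L2_fourier_pair_square_integrable(1)[OF g], where C=1]) (auto simp: v_def c)
  from L2_fourier_pair_exists[OF this] obtain h where h: "L2_fourier_pair (\<lambda>x. complex_of_real (v x)) h" ..
  have [measurable]: "h \<in> borel_measurable borel"
    using L2_fourier_pair_square_integrable(2)[OF h] by (simp add: square_integrable_def)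
  have "norm (complex_of_real (v x) - complex_of_real (v y)) \<le> norm (complex_of_real (u x) - complex_of_real (u y))" for x y
    unfolding of_real_diff[symmetric] norm_of_real v_def by (auto simp: min_def)
  from fractional_energy_contraction[OF g h this s]
  have "(\<integral>\<^sup>+\<xi>. ennreal ((norm (complex_of_real (norm \<xi> powr s) * h \<xi>))\<^sup>2) \<partial>lborel)
     \<le> ennreal ((L2norm lborel (\<lambda>\<xi>. complex_of_real (norm \<xi> powr s) * g \<xi>))\<^sup>2)"
    unfolding nn_integral_norm_sq[OF g2] .
  note h2 = square_integrable_nnI[OF _ this L2norm_nonneg]
  have h3: "square_integrable lborel (\<lambda>\<xi>. complex_of_real (norm \<xi> powr s) * h \<xi>)" by (rule h2) measurable
  have h4: "L2norm lborel (\<lambda>\<xi>. complex_of_real (norm \<xi> powr s) * h \<xi>) \<le> L2norm lborel (\<lambda>\<xi>. complex_of_real (norm \<xi> powr s) * g \<xi>)"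
    by (rule h2) measurable
  note hv = L2_fourier_pair_has_fourier[OF h]
  let ?q = "6 / (3 - 2 * s)"
  have q: "?q \<ge> 2" using s by (simp add: field_simps)
  have "integrable lborel (\<lambda>x. norm (v x) powr ?q)"
  proof (rule Bochner_Integration.integrable_bound)
    show "integrable lborel (\<lambda>x. c powr (?q - 2) * (u x)\<^sup>2)" using u2 by simp
    have "norm (v x) powr ?q \<le> c powr (?q - 2) * (u x)\<^sup>2" for x
    proof -
      have "norm (v x) powr ?q = norm (v x) powr (?q - 2) * norm (v x) powr 2"
        by (simp only: powr_add[symmetric]) simp
      also have "\<dots> \<le> c powr (?q - 2) * \<bar>u x\<bar> powr 2"
        using q c by (intro mult_mono powr_mono2) (auto simp: v_def)
      finally show ?thesis by (simp add: powr_two_nonneg)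
    qed
    then show "AE x in lborel. norm (norm (v x) powr ?q) \<le> norm (c powr (?q - 2) * (u x)\<^sup>2)"
      by (auto intro: order_trans[OF _ abs_ge_self])
  qed measurable
  then show "v \<in> Ds2 s"
    unfolding Ds2_def Lq_def[of ?q] Lq_2_iff_square_integrable
    by (intro CollectI conjI exI[of _ h] hv h3) auto
  show "frac_laplacian (s / 2) v \<in> borel_measurable lborel" "integrable lborel (\<lambda>x. (frac_laplacian (s / 2) v x)\<^sup>2)"
    by (rule half_frac_laplacian_L2[OF hv h3])+
  show "(LINT x|lborel. (frac_laplacian (s / 2) v x)\<^sup>2) \<le> (LINT x|lborel. (frac_laplacian (s / 2) u x)\<^sup>2)"
    unfolding half_frac_laplacian_L2(3)[OF hv h3] half_frac_laplacian_L2(3)[OF L2_fourier_pair_has_fourier[OF g] g2]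
    by (intro power_mono h4) simp
qed

lemma abs_power3: "\<bar>t\<bar> ^ 3 = t\<^sup>2 * \<bar>t\<bar>" for t :: real
  by (simp add: power3_eq_cube power2_eq_square)

text \<open>Integrated, this gives \<open>L\<^sup>2 \<inter> L\<^sup>3 \<subseteq> L\<^sup>r\<close>.\<close>
lemma powr_interpolation:
  fixes t :: real
  assumes "t \<ge> 0" "2 \<le> r" "r \<le> 3"
  shows "t powr r \<le> t\<^sup>2 + t ^ 3"
proof (cases "t \<le> 1")
  case True
  then have "t powr r \<le> t powr 2" using assms by (intro powr_mono') auto
  then show ?thesis using assms by (simp add: powr_two_nonneg add_increasing2)
next
  case False
  then have "t powr r \<le> t powr 3" using assms by (intro powr_mono) auto
  then show ?thesis using False by (simp add: powr_numeral add_increasing)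
qed

text \<open>Young's inequality without its constants: compare \<open>b\<close> with \<open>a powr (q - 1)\<close>.\<close>
lemma powr_Young:
  fixes a b q :: real
  assumes a: "a \<ge> 0" and b: "b \<ge> 0" and q: "q > 1"
  shows "a * b \<le> a powr q + b powr (q / (q - 1))"
proof (cases "b \<le> a powr (q - 1)")
  case True
  have "a * b \<le> a powr 1 * a powr (q - 1)" unfolding powr_one[OF a] by (intro mult_left_mono True a)
  also have "\<dots> = a powr (1 + (q - 1))" by (rule powr_add[symmetric])
  also have "\<dots> = a powr q" by simp
  finally show ?thesis using powr_ge_zero[of b "q / (q - 1)"] by linarith
next
  case False
  have e: "(q - 1) * (1 / (q - 1)) = 1" "1 / (q - 1) + 1 = q / (q - 1)" using q by (simp_all add: field_simps)
  have "a = (a powr (q - 1)) powr (1 / (q - 1))" unfolding powr_powr e(1) powr_one[OF a] ..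
  also have "\<dots> \<le> b powr (1 / (q - 1))" using False q by (intro powr_mono2) auto
  finally have "a * b \<le> b powr (1 / (q - 1)) * b powr 1"
    unfolding powr_one[OF b] by (rule mult_right_mono) (rule b)
  also have "\<dots> = b powr (q / (q - 1))" unfolding powr_add[symmetric] e(2) ..
  finally show ?thesis using powr_ge_zero[of a q] by linarith
qed

text \<open>The equation for \<open>\<phi>\<close>, tested with truncations of \<open>|u|\<close>, together with
\<open>a b \<le> a\<^sup>2 / 4 + b\<^sup>2 \<le> lam a\<^sup>2 + b\<^sup>2\<close>; this is where \<open>lam \<ge> 1 / 4\<close> enters. The bound is uniform in
the truncation height, so Fatou's lemma gives both the integrability and the estimate.\<close>
lemma cubic_integrable:
  assumes u: "u \<in> Hs s" and \<phi>: "\<phi> \<in> Ds2 s" and s: "0 < s" "s < 1" and lam: "1 / 4 \<le> lam"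
    and eq1: "\<forall>v\<in>Ds2 s. (LINT x|lborel. frac_laplacian (s / 2) \<phi> x * frac_laplacian (s / 2) v x) = (LINT x|lborel. (u x)\<^sup>2 * v x)"
  shows "integrable lborel (\<lambda>x. \<bar>u x\<bar> ^ 3)"
    and "(LINT x|lborel. \<bar>u x\<bar> ^ 3) \<le> lam * (LINT x|lborel. (frac_laplacian (s / 2) \<phi> x)\<^sup>2) + (LINT x|lborel. (frac_laplacian (s / 2) u x)\<^sup>2)"
proof -
  let ?D = "frac_laplacian (s / 2)"
  let ?R = "lam * (LINT x|lborel. (?D \<phi> x)\<^sup>2) + (LINT x|lborel. (?D u x)\<^sup>2)"
  have u2: "u \<in> borel_measurable lborel" "integrable lborel (\<lambda>x. (u x)\<^sup>2)"
    using u unfolding Hs_def Lq_2_real_iff_square_integrable square_integrable_of_real_iff by auto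
  have [measurable]: "u \<in> borel_measurable borel" using u2 by simp
  obtain g where g: "has_fourier (\<lambda>x. complex_of_real (\<phi> x)) g" "square_integrable lborel (\<lambda>\<xi>. complex_of_real (norm \<xi> powr s) * g \<xi>)"
    using \<phi> unfolding Ds2_def Lq_2_iff_square_integrable by auto
  note D\<phi> = half_frac_laplacian_L2[OF g]
  have R: "?R \<ge> 0" using lam by (intro add_nonneg_nonneg mult_nonneg_nonneg Bochner_Integration.integral_nonneg) auto
  define v where "v = (\<lambda>n::nat. \<lambda>x. min \<bar>u x\<bar> (real n))"
  have v [measurable]: "v n \<in> borel_measurable borel" for n unfolding v_def by measurable
  have le: "(\<integral>\<^sup>+x. ennreal ((u x)\<^sup>2 * v n x) \<partial>lborel) \<le> ennreal ?R" for n
  proof -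
    note T = truncation_Ds2[OF u s, of "real n", folded v_def]
    have Tn: "v n \<in> Ds2 s" "?D (v n) \<in> borel_measurable lborel" "integrable lborel (\<lambda>x. (?D (v n) x)\<^sup>2)"
      "(LINT x|lborel. (?D (v n) x)\<^sup>2) \<le> (LINT x|lborel. (?D u x)\<^sup>2)"
      using T unfolding v_def by auto
    have [measurable]: "?D (v n) \<in> borel_measurable borel" "?D \<phi> \<in> borel_measurable borel" using Tn D\<phi> by auto
    have i: "integrable lborel (\<lambda>x. (u x)\<^sup>2 * v n x)"
    proof (rule Bochner_Integration.integrable_bound)
      show "integrable lborel (\<lambda>x. (u x)\<^sup>2 * real n)" using u2 by simp
      show "AE x in lborel. norm ((u x)\<^sup>2 * v n x) \<le> norm ((u x)\<^sup>2 * real n)"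
        by (auto simp: v_def abs_mult intro!: mult_left_mono)
    qed measurable
    have pt: "?D \<phi> x * ?D (v n) x \<le> lam * (?D \<phi> x)\<^sup>2 + (?D (v n) x)\<^sup>2"
      and pt': "\<bar>?D \<phi> x * ?D (v n) x\<bar> \<le> (?D \<phi> x)\<^sup>2 + (?D (v n) x)\<^sup>2" for x
    proof -
      \<comment> \<open>the splitting of the product whose constant is exactly \<open>1 / 4\<close>\<close>
      have "0 \<le> (?D \<phi> x / 2 - ?D (v n) x)\<^sup>2" by simp
      then have "?D \<phi> x * ?D (v n) x \<le> 1 / 4 * (?D \<phi> x)\<^sup>2 + (?D (v n) x)\<^sup>2"
        by (simp add: power2_diff power_divide)
      also have "1 / 4 * (?D \<phi> x)\<^sup>2 \<le> lam * (?D \<phi> x)\<^sup>2" using lam by (intro mult_right_mono) auto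
      finally show "?D \<phi> x * ?D (v n) x \<le> lam * (?D \<phi> x)\<^sup>2 + (?D (v n) x)\<^sup>2" by simp
      have "2 * \<bar>?D \<phi> x\<bar> * \<bar>?D (v n) x\<bar> \<le> \<bar>?D \<phi> x\<bar>\<^sup>2 + \<bar>?D (v n) x\<bar>\<^sup>2" by (rule sum_squares_bound)
      moreover have "0 \<le> \<bar>?D \<phi> x\<bar> * \<bar>?D (v n) x\<bar>" by simp
      ultimately show "\<bar>?D \<phi> x * ?D (v n) x\<bar> \<le> (?D \<phi> x)\<^sup>2 + (?D (v n) x)\<^sup>2"
        unfolding abs_mult power2_abs by linarith
    qed
    have "integrable lborel (\<lambda>x. ?D \<phi> x * ?D (v n) x)"
    proof (rule Bochner_Integration.integrable_bound)
      show "integrable lborel (\<lambda>x. (?D \<phi> x)\<^sup>2 + (?D (v n) x)\<^sup>2)" using D\<phi> Tn by simp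
    qed (use pt' in auto)
    then have "(LINT x|lborel. ?D \<phi> x * ?D (v n) x) \<le> (LINT x|lborel. lam * (?D \<phi> x)\<^sup>2 + (?D (v n) x)\<^sup>2)"
      using D\<phi> Tn pt by (intro Bochner_Integration.integral_mono) auto
    also have "\<dots> = lam * (LINT x|lborel. (?D \<phi> x)\<^sup>2) + (LINT x|lborel. (?D (v n) x)\<^sup>2)"
      using D\<phi> Tn by simp
    also have "\<dots> \<le> ?R" using Tn by simp
    finally have "(LINT x|lborel. (u x)\<^sup>2 * v n x) \<le> ?R" using bspec[OF eq1 Tn(1)] by simp
    then show ?thesis using i by (subst nn_integral_eq_integral) (auto simp: v_def intro: ennreal_leI)
  qed
  have lim: "(\<lambda>n. ennreal ((u x)\<^sup>2 * v n x)) \<longlonglongrightarrow> ennreal (\<bar>u x\<bar> ^ 3)" for x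
  proof (rule tendsto_eventually)
    show "\<forall>\<^sub>F n in sequentially. ennreal ((u x)\<^sup>2 * v n x) = ennreal (\<bar>u x\<bar> ^ 3)"
      using eventually_ge_at_top[of "nat \<lceil>\<bar>u x\<bar>\<rceil>"]
    proof eventually_elim
      case (elim n)
      then have "\<bar>u x\<bar> \<le> real n" by (simp add: nat_le_iff ceiling_le_iff)
      then have "v n x = \<bar>u x\<bar>" by (simp add: v_def)
      then show ?case by (simp only: abs_power3)
    qed
  qed
  have "(\<integral>\<^sup>+x. ennreal (\<bar>u x\<bar> ^ 3) \<partial>lborel) = (\<integral>\<^sup>+x. liminf (\<lambda>n. ennreal ((u x)\<^sup>2 * v n x)) \<partial>lborel)"
    using lim_imp_Liminf[OF _ lim] by (simp cong: nn_integral_cong)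
  also have "\<dots> \<le> liminf (\<lambda>n. \<integral>\<^sup>+x. ennreal ((u x)\<^sup>2 * v n x) \<partial>lborel)" by (rule nn_integral_liminf) measurable
  also have "\<dots> \<le> ennreal ?R"
    by (rule order_trans[OF Liminf_mono[where g="\<lambda>_. ennreal ?R"]]) (use le in \<open>auto simp: Liminf_const\<close>)
  finally have nn: "(\<integral>\<^sup>+x. ennreal (\<bar>u x\<bar> ^ 3) \<partial>lborel) \<le> ennreal ?R" .
  show i3: "integrable lborel (\<lambda>x. \<bar>u x\<bar> ^ 3)"
    using nn by (intro integrableI_nonneg) (auto intro: le_less_trans)
  show "(LINT x|lborel. \<bar>u x\<bar> ^ 3) \<le> ?R"
    using nn i3 R by (subst (asm) nn_integral_eq_integral) auto
qed

theorem theorem1p6: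
  fixes s p lam :: real and u \<phi> :: "real^3 \<Rightarrow> real"
  assumes "3 / 4 < s" and "s < 1"
    and "1 < p" and "p \<le> 2"
    and "1 / 4 \<le> lam"
    and "weak_solution s p lam u \<phi>"
  shows "(AE x in lborel. u x = 0) \<and> (AE x in lborel. \<phi> x = 0)"
proof -
  let ?D = "frac_laplacian (s / 2)"
  have s: "0 < s" "s < 1" using assms by auto
  have u: "u \<in> Hs s" and \<phi>: "\<phi> \<in> Ds2 s"
    and eq1: "\<forall>v\<in>Ds2 s. (LINT x|lborel. ?D \<phi> x * ?D v x) = (LINT x|lborel. (u x)\<^sup>2 * v x)"
    and eq2: "\<And>v. v \<in> Hs s \<Longrightarrow> (LINT x|lborel. ?D u x * ?D v x + u x * v x + lam * \<phi> x * u x * v x - \<bar>u x\<bar> powr (p - 1) * u x * v x) = 0"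
    using assms(6) unfolding weak_solution_def by auto
  have u2: "u \<in> borel_measurable lborel" "integrable lborel (\<lambda>x. (u x)\<^sup>2)"
    using u unfolding Hs_def Lq_2_real_iff_square_integrable square_integrable_of_real_iff by auto
  have [measurable]: "u \<in> borel_measurable borel" using u2 by simp
  obtain gu where gu: "L2_fourier_pair (\<lambda>x. complex_of_real (u x)) gu"
    "square_integrable lborel (\<lambda>\<xi>. complex_of_real (norm \<xi> powr s) * gu \<xi>)"
    using Hs_fourier_pair[OF u less_imp_le[OF s(1)]] by (elim exE conjE)
  note Du = half_frac_laplacian_L2[OF L2_fourier_pair_has_fourier[OF gu(1)] gu(2)]
  obtain g where g: "has_fourier (\<lambda>x. complex_of_real (\<phi> x)) g" "square_integrable lborel (\<lambda>\<xi>. complex_of_real (norm \<xi> powr s) * g \<xi>)"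
    using \<phi> unfolding Ds2_def Lq_2_iff_square_integrable by auto
  note D\<phi> = half_frac_laplacian_L2[OF g]
  note u3 = cubic_integrable[OF u \<phi> s assms(5) eq1]
  have \<phi>q: "\<phi> \<in> borel_measurable lborel" "integrable lborel (\<lambda>x. \<bar>\<phi> x\<bar> powr (6 / (3 - 2 * s)))"
    using \<phi> unfolding Ds2_def Lq_def by auto
  have [measurable]: "\<phi> \<in> borel_measurable borel" using \<phi>q by simp
  have i\<phi>: "integrable lborel (\<lambda>x. \<phi> x * (u x)\<^sup>2)"
  proof (rule Bochner_Integration.integrable_bound)
    let ?q = "6 / (3 - 2 * s)"
    show "integrable lborel (\<lambda>x. \<bar>\<phi> x\<bar> powr ?q + ((u x)\<^sup>2 + \<bar>u x\<bar> ^ 3))" using \<phi>q u2 u3 by simp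
    have "norm (\<phi> x * (u x)\<^sup>2) \<le> \<bar>\<phi> x\<bar> powr ?q + ((u x)\<^sup>2 + \<bar>u x\<bar> ^ 3)" for x
    proof -
      have q: "?q > 1" using s by (simp add: field_simps)
      \<comment> \<open>the conjugate exponent; twice it lies between 2 and 3\<close>
      have q': "?q / (?q - 1) = 6 / (3 + 2 * s)"
      proof -
        have "?q - 1 = (3 + 2 * s) / (3 - 2 * s)" using s by (simp add: field_simps)
        moreover have "(6 / d) / (k / d) = 6 / k" if "d \<noteq> 0" for d k :: real using that by simp
        moreover have "3 - 2 * s \<noteq> 0" using s by simp
        ultimately show ?thesis by metis
      qed
      have "norm (\<phi> x * (u x)\<^sup>2) = \<bar>\<phi> x\<bar> * (u x)\<^sup>2" by (simp add: abs_mult)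
      also have "\<dots> \<le> \<bar>\<phi> x\<bar> powr ?q + ((u x)\<^sup>2) powr (?q / (?q - 1))"
        by (rule powr_Young[OF _ _ q]) auto
      also have "((u x)\<^sup>2) powr (?q / (?q - 1)) = \<bar>u x\<bar> powr (12 / (3 + 2 * s))"
        unfolding q' using powr_powr[of "\<bar>u x\<bar>" 2 "6 / (3 + 2 * s)"] by (simp add: powr_two_nonneg)
      also have "\<dots> \<le> \<bar>u x\<bar>\<^sup>2 + \<bar>u x\<bar> ^ 3"
        using assms(1) s by (intro powr_interpolation) (auto simp: field_simps)
      finally show ?thesis by simp
    qed
    then show "AE x in lborel. norm (\<phi> x * (u x)\<^sup>2) \<le> norm (\<bar>\<phi> x\<bar> powr ?q + ((u x)\<^sup>2 + \<bar>u x\<bar> ^ 3))"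
      by (auto intro: order_trans[OF _ abs_ge_self])
  qed measurable
  \<comment> \<open>the pointwise inequality behind the theorem, with its case of equality; it rests on \<open>0 < p - 1 \<le> 1\<close>\<close>
  have pw: "\<bar>t\<bar> powr (p - 1) * t\<^sup>2 \<le> t\<^sup>2 + \<bar>t\<bar> ^ 3" "\<bar>t\<bar> powr (p - 1) * t\<^sup>2 = t\<^sup>2 + \<bar>t\<bar> ^ 3 \<Longrightarrow> t = 0" for t :: real
  proof -
    have strict: "\<bar>t\<bar> powr (p - 1) * t\<^sup>2 < t\<^sup>2 + \<bar>t\<bar> ^ 3" if "t \<noteq> 0"
    proof -
      have "\<bar>t\<bar> powr (p - 1) < 1 + \<bar>t\<bar>"
      proof (cases "\<bar>t\<bar> \<le> 1")
        case True
        then have "\<bar>t\<bar> powr (p - 1) \<le> 1" using assms(3) by (intro powr_le1) auto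
        then show ?thesis using that by linarith
      next
        case False
        then have "\<bar>t\<bar> powr (p - 1) \<le> \<bar>t\<bar> powr 1" using assms(4) by (intro powr_mono) auto
        then show ?thesis by simp
      qed
      then have "\<bar>t\<bar> powr (p - 1) * t\<^sup>2 < (1 + \<bar>t\<bar>) * t\<^sup>2" using that by (intro mult_strict_right_mono) auto
      also have "\<dots> = t\<^sup>2 + \<bar>t\<bar> ^ 3" by (simp only: abs_power3 distrib_right mult_1 mult.commute)
      finally show ?thesis .
    qed
    then show "\<bar>t\<bar> powr (p - 1) * t\<^sup>2 \<le> t\<^sup>2 + \<bar>t\<bar> ^ 3" by (cases "t = 0") (auto intro: less_imp_le)
    show "\<bar>t\<bar> powr (p - 1) * t\<^sup>2 = t\<^sup>2 + \<bar>t\<bar> ^ 3 \<Longrightarrow> t = 0" by (rule ccontr) (use strict in simp)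
  qed
  have ip: "integrable lborel (\<lambda>x. \<bar>u x\<bar> powr (p - 1) * (u x)\<^sup>2)"
  proof (rule Bochner_Integration.integrable_bound)
    show "integrable lborel (\<lambda>x. (u x)\<^sup>2 + \<bar>u x\<bar> ^ 3)" using u2 u3 by simp
    show "AE x in lborel. norm (\<bar>u x\<bar> powr (p - 1) * (u x)\<^sup>2) \<le> norm ((u x)\<^sup>2 + \<bar>u x\<bar> ^ 3)"
      using pw(1) by (auto intro: order_trans[OF _ abs_ge_self])
  qed measurable
  \<comment> \<open>the equation for \<open>\<phi>\<close> tested with \<open>\<phi>\<close>; the equation for \<open>u\<close> tested with \<open>u\<close> comes next\<close>
  have A: "(LINT x|lborel. (?D \<phi> x)\<^sup>2) = (LINT x|lborel. \<phi> x * (u x)\<^sup>2)"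
    using bspec[OF eq1 \<phi>] by (simp add: power2_eq_square mult.commute)
  have "0 = (LINT x|lborel. (?D u x)\<^sup>2 + (u x)\<^sup>2 + lam * (\<phi> x * (u x)\<^sup>2) - \<bar>u x\<bar> powr (p - 1) * (u x)\<^sup>2)"
    using eq2[OF u] by (simp add: power2_eq_square mult.assoc)
  also have "\<dots> = (LINT x|lborel. (?D u x)\<^sup>2) + (LINT x|lborel. (u x)\<^sup>2) + lam * (LINT x|lborel. \<phi> x * (u x)\<^sup>2) - (LINT x|lborel. \<bar>u x\<bar> powr (p - 1) * (u x)\<^sup>2)"
    using Du(2) u2(2) i\<phi> ip by simp
  finally have "(LINT x|lborel. (u x)\<^sup>2) + (LINT x|lborel. \<bar>u x\<bar> ^ 3) - (LINT x|lborel. \<bar>u x\<bar> powr (p - 1) * (u x)\<^sup>2) \<le> 0"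
    using u3(2)[unfolded A] by linarith
  moreover have "(LINT x|lborel. (u x)\<^sup>2 + \<bar>u x\<bar> ^ 3 - \<bar>u x\<bar> powr (p - 1) * (u x)\<^sup>2)
    = (LINT x|lborel. (u x)\<^sup>2) + (LINT x|lborel. \<bar>u x\<bar> ^ 3) - (LINT x|lborel. \<bar>u x\<bar> powr (p - 1) * (u x)\<^sup>2)"
    using u2(2) u3(1) ip by simp
  moreover have "0 \<le> (LINT x|lborel. (u x)\<^sup>2 + \<bar>u x\<bar> ^ 3 - \<bar>u x\<bar> powr (p - 1) * (u x)\<^sup>2)"
    using pw(1) by (intro Bochner_Integration.integral_nonneg) auto
  ultimately have "(LINT x|lborel. (u x)\<^sup>2 + \<bar>u x\<bar> ^ 3 - \<bar>u x\<bar> powr (p - 1) * (u x)\<^sup>2) = 0" by linarith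
  then have "AE x in lborel. (u x)\<^sup>2 + \<bar>u x\<bar> ^ 3 - \<bar>u x\<bar> powr (p - 1) * (u x)\<^sup>2 = 0"
    using u2(2) u3(1) ip pw(1) by (subst (asm) integral_nonneg_eq_0_iff_AE) auto
  then have u0: "AE x in lborel. u x = 0"
  proof eventually_elim
    case (elim x)
    then show ?case by (intro pw(2)) linarith
  qed
  have "(LINT x|lborel. \<phi> x * (u x)\<^sup>2) = (LINT x|(lborel :: (real^3) measure). 0)"
    using u0 by (intro integral_cong_AE) (auto elim!: eventually_mono)
  then have "(LINT x|lborel. (norm (complex_of_real (norm x powr s) * g x))\<^sup>2) = 0"
    using A D\<phi>(3) unfolding L2norm_sq by simp
  then have "AE x in lborel. (norm (complex_of_real (norm x powr s) * g x))\<^sup>2 = 0"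
    using g(2) by (subst (asm) integral_nonneg_eq_0_iff_AE) (auto simp: square_integrable_def)
  then have "AE x in lborel. g x = 0"
    using AE_lborel_singleton[of "0 :: real^3"] by eventually_elim auto
  then have "AE x in lborel. complex_of_real (\<phi> x) = 0" by (rule has_fourier_AE_zero[OF g(1)])
  then show ?thesis using u0 by simp
qed

end
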